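(* Let $1\le p\le\infty$, let $q\in[2,\infty)$, let $X$ be a complex Banach space and $Y$ a $q$-concave Banach lattice, let $r\in[1,q)$, and let $T:X\to Y$ be a non-null $(r,1)$-summing operator with $\|T\|\le\lambda$. Then there exists a constant $C_0>0$, independent of $n$, such that for every $n\ge 1$ $$B(B_p^n,T,\lambda)\ \ge\ \frac{C_0}{1+2\lambda}\left(\frac{\|T\|-\lambda}{\|T\|-2\lambda}\right)\frac{(\log n)^{1-\frac1q}}{n^{\frac{pq-p+q}{pq}}},$$ where the exponent $\frac{pq-p+q}{pq}=1-\frac1q+\frac1p$ is read as $1-\frac1q$ when $p=\infty$.
   Context: For $1\le p\le\infty$, $B_p^n=\{z\in\mathbb{C}^n:\|z\|_p<1\}$, where $\|\cdot\|_p$ is the usual $\ell_p$-norm on $\mathbb{C}^n$. A domain $\Omega\subseteq\mathbb{C}^n$ is complete Reinhardt if $(z_1,\dots,z_n)\in\Omega$ and $|\lambda_k|\le 1$ for all $k$ imply $(\lambda_1z_1,\dots,\lambda_nz_n)\in\Omega$. Multi-indices: $\alpha\in\mathbb{N}_0^n$, $z^\alpha=z_1^{\alpha_1}\cdots z_n^{\alpha_n}$. For $r\ge 0$, $r\cdot\Omega=\{rz:z\in\Omega\}$. Definition ($\lambda$-second Bohr radius). Let $\Omega\subset\mathbb{C}^n$ be a bounded complete Reinhardt domain and $T:X\to Y$ a non-null bounded linear operator between complex Banach spaces with $\|T\|\le\lambda$. $B(\Omega,T,\lambda)$ is the largest $r\ge 0$ such that $$\sum_{\alpha\in\mathbb{N}_0^n}\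 \sup_{z\in r\cdot\Omega}\|T(a_\alpha)z^\alpha\|_Y\ \le\ \lambda\sup_{z\in\Omega}\|f(z)\|_X$$ for every (bounded) holomorphic $f:\Omega\to X$ with power series expansion $f(z)=\sum_{\alpha\in\mathbb{N}_0^n}a_\alpha z^\alpha$, $a_\alpha\in X$. A (complex) Banach lattice $Y$ is $q$-concave ($1\le q<\infty$) if there is a constant $C>0$ such that for all finite families $x_1,\dots,x_N\in Y$, $$\Big(\sum_{k=1}^N\|x_k\|^q\Big)^{1/q}\le C\,\Big\|\Big(\sum_{k=1}^N|x_k|^q\Big)^{1/q}\Big\|,$$ where $\big(\sum_k|x_k|^q\big)^{1/q}\in Y$ is defined by the usual Krivine functional calculus of Banach lattices. For $s,t\in[1,\infty)$, a bounded linear operator $T:X\to Y$ is $(s,t)$-summing if there is a constant $C>0$ such that for all finite families $x_1,\dots,x_N\in X$, $$\Big(\sum_{k=1}^N\|T(x_k)\|^s\Big)^{1/s}\le C\sup_{\phi\in X^*,\ \|\phi\|<1}\Big(\sum_{k=1}^N|\phi(x_k)|^t\Big)^{1/t}.$$ *)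

theory Defs
  imports "HOL-Analysis.Analysis" "HOL-Library.Lattice_Algebras" "HOL-Library.Lub_Glb"
begin

class complex_banach = banach +
  fixes scaleC :: "complex \<Rightarrow> 'a \<Rightarrow> 'a" (infixr \<open>*\<^sub>C\<close> 75)
  assumes scaleC_add_right: "c *\<^sub>C (x + y) = c *\<^sub>C x + c *\<^sub>C y"
    and scaleC_add_left: "(c + d) *\<^sub>C x = c *\<^sub>C x + d *\<^sub>C x"
    and scaleC_scaleC: "c *\<^sub>C (d *\<^sub>C x) = (c * d) *\<^sub>C x"
    and scaleR_scaleC: "scaleR a x = complex_of_real a *\<^sub>C x"
    and norm_scaleC: "norm (c *\<^sub>C x) = cmod c * norm x"

instantiation complex :: complex_banach
begin

definition scaleC_complex :: "complex \<Rightarrow> complex \<Rightarrow> complex"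
  where "scaleC_complex c x = c * x"

instance
  by standard (simp_all add: scaleC_complex_def algebra_simps norm_mult scaleR_conv_of_real)

end

definition bounded_clinear :: "('a::complex_banach \<Rightarrow> 'b::complex_banach) \<Rightarrow> bool"
  where "bounded_clinear T \<longleftrightarrow>
    bounded_linear T \<and> (\<forall>c x. T (c *\<^sub>C x) = c *\<^sub>C T x)"

definition summing :: "real \<Rightarrow> real \<Rightarrow> ('a::complex_banach \<Rightarrow> 'b::complex_banach) \<Rightarrow> bool"
  where "summing s t T \<longleftrightarrow> bounded_clinear T \<and>
    (\<exists>C>0. \<forall>(N::nat) (x::nat \<Rightarrow> 'a).
      (\<Sum>k<N. norm (T (x k)) powr s) powr (1 / s) \<le>
      C * (SUP \<phi>\<in>{\<phi>::'a \<Rightarrow> complex. bounded_clinear \<phi> \<and> onorm \<phi> < 1}.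
             (\<Sum>k<N. cmod (\<phi> (x k)) powr t) powr (1 / t)))"

class real_banach_lattice = banach + ordered_real_vector + lattice_ab_group_add_abs +
  assumes norm_mono_abs: "\<bar>x\<bar> \<le> \<bar>y\<bar> \<Longrightarrow> norm x \<le> norm y"

text \<open>The modulus of \<open>a + i b\<close> is the supremum of \<open>cos \<theta> a + sin \<theta> b\<close> over all real \<open>\<theta>\<close>.\<close>

definition is_modulus :: "'e::real_banach_lattice \<Rightarrow> 'e \<Rightarrow> 'e \<Rightarrow> bool"
  where "is_modulus a b m \<longleftrightarrow>
    isLub UNIV (range (\<lambda>\<theta>::real. cos \<theta> *\<^sub>R a + sin \<theta> *\<^sub>R b)) m"

text \<open>A complex Banach lattice is a complex Banach space \<open>'y\<close> together with an
  embedding \<open>\<iota>\<close> of a real Banach lattice \<open>'e\<close> that exhibits \<open>'y\<close> as the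
  complexification of \<open>'e\<close>, the norm of an element being the norm of its modulus.
  (In a real Banach lattice the suprema defining the modulus always exist.)\<close>

definition complex_banach_lattice ::
    "('e::real_banach_lattice \<Rightarrow> 'y::complex_banach) \<Rightarrow> bool"
  where "complex_banach_lattice \<iota> \<longleftrightarrow>
    linear \<iota> \<and>
    (\<forall>y. \<exists>!(a, b). y = \<iota> a + \<i> *\<^sub>C \<iota> b) \<and>
    (\<forall>a b. \<exists>m. is_modulus a b m \<and> norm (\<iota> a + \<i> *\<^sub>C \<iota> b) = norm m)"

definition modulus :: "('e::real_banach_lattice \<Rightarrow> 'y::complex_banach) \<Rightarrow> 'y \<Rightarrow> 'e"
  where "modulus \<iota> y = (THE m. \<exists>a b. y = \<iota> a + \<i> *\<^sub>C \<iota> b \<and> is_modulus a b m)"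

text \<open>Continuous positively homogeneous functions on \<open>\<real>\<^sup>N\<close>, represented as functions of real
  sequences depending on the first \<open>N\<close> coordinates only; for these, continuity for the
  product topology is continuity on \<open>\<real>\<^sup>N\<close>.\<close>

definition pos_homogeneous :: "nat \<Rightarrow> ((nat \<Rightarrow> real) \<Rightarrow> real) set"
  where "pos_homogeneous N = {h.
    (\<forall>s t. (\<forall>i<N. s i = t i) \<longrightarrow> h s = h t) \<and>
    (\<forall>c\<ge>0. \<forall>t. h (\<lambda>i. c * t i) = c * h t) \<and>
    continuous_on UNIV h}"

text \<open>By Krivine's theorem there is exactly one linear lattice homomorphism from
  \<^term>\<open>pos_homogeneous N\<close> that sends the coordinate functions to given elements
  \<open>x 0, \<dots>, x (N - 1)\<close> of a Banach lattice.\<close>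

definition krivine_hom ::
    "nat \<Rightarrow> (nat \<Rightarrow> 'e::real_banach_lattice) \<Rightarrow> (((nat \<Rightarrow> real) \<Rightarrow> real) \<Rightarrow> 'e) \<Rightarrow> bool"
  where "krivine_hom N x \<Phi> \<longleftrightarrow>
    (\<forall>j<N. \<Phi> (\<lambda>t. t j) = x j) \<and>
    (\<forall>g\<in>pos_homogeneous N. \<forall>h\<in>pos_homogeneous N.
       \<Phi> (\<lambda>t. g t + h t) = \<Phi> g + \<Phi> h \<and>
       \<Phi> (\<lambda>t. max (g t) (h t)) = sup (\<Phi> g) (\<Phi> h) \<and>
       \<Phi> (\<lambda>t. min (g t) (h t)) = inf (\<Phi> g) (\<Phi> h)) \<and>
    (\<forall>c. \<forall>h\<in>pos_homogeneous N. \<Phi> (\<lambda>t. c * h t) = c *\<^sub>R \<Phi> h)"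

definition krivine ::
    "nat \<Rightarrow> (nat \<Rightarrow> 'e::real_banach_lattice) \<Rightarrow> ((nat \<Rightarrow> real) \<Rightarrow> real) \<Rightarrow> 'e"
  where "krivine N x h = (THE y. \<exists>\<Phi>. krivine_hom N x \<Phi> \<and> \<Phi> h = y)"

definition q_concave :: "real \<Rightarrow> ('e::real_banach_lattice \<Rightarrow> 'y::complex_banach) \<Rightarrow> bool"
  where "q_concave q \<iota> \<longleftrightarrow>
    (\<exists>C>0. \<forall>(N::nat) (y::nat \<Rightarrow> 'y).
      (\<Sum>k<N. norm (y k) powr q) powr (1 / q) \<le>
      C * norm (krivine N (\<lambda>k. modulus \<iota> (y k)) (\<lambda>t. (\<Sum>k<N. \<bar>t k\<bar> powr q) powr (1 / q))))"

text \<open>Since the dimension varies, \<open>\<complex>\<^sup>n\<close> consists of the sequences vanishing from index \<open>n\<close> on;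
  multi-indices are treated likewise.\<close>

definition cspace :: "nat \<Rightarrow> (nat \<Rightarrow> complex) set"
  where "cspace n = {z. \<forall>i\<ge>n. z i = 0}"

definition multi_indices :: "nat \<Rightarrow> (nat \<Rightarrow> nat) set"
  where "multi_indices n = {\<alpha>. \<forall>i\<ge>n. \<alpha> i = 0}"

definition monomial :: "nat \<Rightarrow> (nat \<Rightarrow> complex) \<Rightarrow> (nat \<Rightarrow> nat) \<Rightarrow> complex"
  where "monomial n z \<alpha> = (\<Prod>i<n. z i ^ \<alpha> i)"

definition lp_norm :: "ereal \<Rightarrow> nat \<Rightarrow> (nat \<Rightarrow> complex) \<Rightarrow> real"
  where "lp_norm p n z =
    (if p = \<infinity> then Max ((\<lambda>i. cmod (z i)) ` {..<n})
     else (\<Sum>i<n. cmod (z i) powr real_of_ereal p) powr (1 / real_of_ereal p))"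

definition lp_ball :: "ereal \<Rightarrow> nat \<Rightarrow> (nat \<Rightarrow> complex) set"
  where "lp_ball p n = {z \<in> cspace n. lp_norm p n z < 1}"

definition dilate :: "real \<Rightarrow> (nat \<Rightarrow> complex) set \<Rightarrow> (nat \<Rightarrow> complex) set"
  where "dilate r \<Omega> = (\<lambda>z i. complex_of_real r * z i) ` \<Omega>"

text \<open>Complex Frechet differentiability at every point of \<open>\<Omega>\<close>, an open subset of \<open>\<complex>\<^sup>n\<close>;
  the complex derivative is the map sending \<open>h\<close> to the sum of the \<open>h i *\<^sub>C l i\<close>.\<close>

definition holomorphic_Cn ::
    "nat \<Rightarrow> ((nat \<Rightarrow> complex) \<Rightarrow> 'a::complex_banach) \<Rightarrow> (nat \<Rightarrow> complex) set \<Rightarrow> bool"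
  where "holomorphic_Cn n f \<Omega> \<longleftrightarrow>
    (\<forall>z\<in>\<Omega>. \<exists>l::nat \<Rightarrow> 'a. \<forall>\<epsilon>>0. \<exists>\<delta>>0. \<forall>h\<in>cspace n.
       L2_set (\<lambda>i. cmod (h i)) {..<n} < \<delta> \<and> (\<lambda>i. z i + h i) \<in> \<Omega> \<longrightarrow>
       norm (f (\<lambda>i. z i + h i) - f z - (\<Sum>i<n. h i *\<^sub>C l i))
         \<le> \<epsilon> * L2_set (\<lambda>i. cmod (h i)) {..<n})"

definition power_series_expansion ::
    "nat \<Rightarrow> ((nat \<Rightarrow> nat) \<Rightarrow> 'a::complex_banach) \<Rightarrow> ((nat \<Rightarrow> complex) \<Rightarrow> 'a) \<Rightarrow>
      (nat \<Rightarrow> complex) set \<Rightarrow> bool"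
  where "power_series_expansion n a f \<Omega> \<longleftrightarrow>
    (\<forall>z\<in>\<Omega>. ((\<lambda>\<alpha>. monomial n z \<alpha> *\<^sub>C a \<alpha>) has_sum f z) (multi_indices n))"

text \<open>Sums and suprema are taken in \<^typ>\<open>ennreal\<close>, so that divergence means the value \<open>\<infinity>\<close>.
  The set \<open>\<Omega>\<close> is meant to be a bounded complete Reinhardt domain in \<open>\<complex>\<^sup>n\<close>.\<close>

definition bohr_radius ::
    "nat \<Rightarrow> (nat \<Rightarrow> complex) set \<Rightarrow> ('a::complex_banach \<Rightarrow> 'b::complex_banach) \<Rightarrow> real \<Rightarrow> real"
  where "bohr_radius n \<Omega> T lam =
    (GREATEST r. 0 \<le> r \<and>
      (\<forall>f a. holomorphic_Cn n f \<Omega> \<and> bounded (f ` \<Omega>) \<and> power_series_expansion n a f \<Omega> \<longrightarrow>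
        (\<Sum>\<^sub>\<infinity>\<alpha>\<in>multi_indices n.
           SUP z\<in>dilate r \<Omega>. ennreal (norm (monomial n z \<alpha> *\<^sub>C T (a \<alpha>))))
        \<le> ennreal lam * (SUP z\<in>\<Omega>. ennreal (norm (f z)))))"

end

theory Submission
  imports Defs
begin

text \<open>
  The ball \<open>B\<^sub>p\<^sup>n\<close> contains the polydisc of radius \<open>n powr (- 1 / p)\<close> and lies in the unit polydisc,
  so a lower bound of order \<open>(ln n / n) powr (1 - 1 / q)\<close> on the polydisc suffices. For an
  \<open>m\<close>-homogeneous polynomial \<open>P\<close> each coefficient occurs, with a factor at least 1, in some partial
  derivative \<open>Q\<^sub>l\<close> of \<open>P\<close>. Hoelder's inequality bounds the sum of the norms of the coefficients of
  \<open>T Q\<^sub>l\<close> by their \<open>\<ell>\<^sub>q\<close>-norm times a power of the number of multi-indices of degree \<open>m - 1\<close>; by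
  \<open>q\<close>-concavity and the scalar \<open>L\<^sub>1\<close>--\<open>L\<^sub>2\<close> comparison this \<open>\<ell>\<^sub>q\<close>-norm is at most \<open>C\<^sup>m\<close> times an
  average of the norms of \<open>T Q\<^sub>l(z)\<close> over points \<open>z\<close> of the torus. At every such point the summing
  property controls the \<open>\<ell>\<^sub>r\<close>-norm over \<open>l\<close> by the norm of \<open>\<Sum> w\<^sub>l Q\<^sub>l(z)\<close> for some \<open>\<bar>w\<^sub>l\<bar> \<le> 1\<close>, which
  is the coefficient of \<open>t\<close> in \<open>P (z + t w)\<close> and hence at most \<open>3\<^sup>m\<close> times the supremum of \<open>P\<close>.
  Because \<open>r < q\<close>, the resulting constant for degree \<open>m\<close> is at most the \<open>m\<close>-th power of
  \<open>K (n / ln n) powr (1 - 1 / q)\<close>, and the homogeneous parts of \<open>f\<close> are summed as a geometric series.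
\<close>

section \<open>Linear lattice expressions\<close>

text \<open>Partial derivatives are used because of the index count. In the range m < n there are,
  up to a factor C^m, about (n/m)^(m-1) multi-indices of degree m - 1, against (n/m)^m of degree m.
  Raised to the power s = 1 - 1/q, the smaller count saves a factor (m/n)^s. Summation over the n
  derivatives costs only n^(1 - 1/r), because the summing property is applied to the whole family at
  once. Since r < q, a power n^(-\<delta>) with \<delta> = 1/r - 1/q is left over, and it pays for
  the factors ((ln n / m)^s)^m.

  Two definitions dictate the rest. \<open>krivine\<close> is a definite description, so q-concavity
  says nothing until the functional calculus is shown to exist and to be unique. Averages over the
  torus are taken over grids of roots of unity, since finite sums, unlike integrals, belong to the
  calculus directly. \<open>bohr_radius\<close> is a greatest element, so the admissible radii must
  be bounded and their supremum attained.

  The quotient involving \<open>onorm T\<close> and \<open>lam\<close> is independent of n and is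
  absorbed into the constant, unless it vanishes; then nonnegativity of the radius is all that is
  claimed.\<close>

definition lin_comb :: "nat \<Rightarrow> (nat \<Rightarrow> 'v::real_vector) \<Rightarrow> (nat \<Rightarrow> real) \<Rightarrow> 'v"
  where "lin_comb N x c = (\<Sum>i<N. c i *\<^sub>R x i)"

text \<open>The sort also covers \<open>real\<close>, so one finite set U of coefficient vectors is
  read both as a convex piecewise linear function of t and as an element of the lattice.\<close>

definition max_lin ::
    "nat \<Rightarrow> (nat \<Rightarrow> 'v::{ordered_real_vector,lattice_ab_group_add_abs}) \<Rightarrow> (nat \<Rightarrow> real) set \<Rightarrow> 'v"
  where "max_lin N x U = Sup_fin (lin_comb N x ` U)"

section \<open>Convex combinations by compactness\<close>

lemma compact_box:
  fixes B :: "'j \<Rightarrow> real set"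
  assumes "\<And>j. compact (B j)"
  shows "compact (PiE UNIV B)"
proof -
  have "compactin (product_topology (\<lambda>_. euclidean) UNIV) (PiE UNIV B)"
    using assms by (subst compactin_PiE) auto
  then show ?thesis by (simp add: euclidean_product_topology)
qed

text \<open>Farkas' alternative. A point of least norm in the convex hull of the vectors
  \<^term>\<open>c j\<close> has to be the origin.\<close>

lemma convex_combination_eq_zero:
  fixes c :: "'j \<Rightarrow> nat \<Rightarrow> real"
  assumes fin: "finite J" and pos: "\<And>t. \<exists>j\<in>J. 0 \<le> (\<Sum>i<N. c j i * t i)"
  obtains \<mu> where "\<And>j. j \<in> J \<Longrightarrow> 0 \<le> \<mu> j" "sum \<mu> J = 1"
    "\<And>i. i < N \<Longrightarrow> (\<Sum>j\<in>J. \<mu> j * c j i) = 0"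
proof -
  \<comment> \<open>The simplex of weights. Weights off J are pinned to 0, so that it is compact in
    the full function space.\<close>
  define K where "K = PiE UNIV (\<lambda>j. if j \<in> J then {0..1::real} else {0}) \<inter> {\<mu>. sum \<mu> J = 1}"
  define F where "F = (\<lambda>\<mu>. \<Sum>i<N. (\<Sum>j\<in>J. \<mu> j * c j i)\<^sup>2)"
  have "closed {\<mu>::'j \<Rightarrow> real. sum \<mu> J = 1}"
    by (intro closed_Collect_eq continuous_on_sum continuous_on_product_coordinates continuous_on_const)
  then have "compact K"
    unfolding K_def by (intro compact_Int_closed compact_box) auto
  obtain j0 where j0: "j0 \<in> J" using pos by blast
  have "(\<lambda>j. if j = j0 then 1 else 0) \<in> K"
    using j0 fin by (auto simp: K_def)
  then have "K \<noteq> {}" by blast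
  have "continuous_on K F"
    unfolding F_def
    by (intro continuous_on_sum continuous_on_power continuous_on_mult continuous_on_const
          continuous_on_subset[OF continuous_on_product_coordinates]) auto
  then obtain \<mu> where \<mu>: "\<mu> \<in> K" and min: "\<And>\<nu>. \<nu> \<in> K \<Longrightarrow> F \<mu> \<le> F \<nu>"
    using continuous_attains_inf[OF \<open>compact K\<close> \<open>K \<noteq> {}\<close>] by blast
  have \<mu>0: "0 \<le> \<mu> j" if "j \<in> J" for j
    using PiE_mem[of \<mu> UNIV _ j] \<mu> that by (auto simp: K_def split: if_splits)
  have \<mu>out: "\<mu> j = 0" if "j \<notin> J" for j
    using PiE_mem[of \<mu> UNIV _ j] \<mu> that by (auto simp: K_def split: if_splits)
  have \<mu>1: "sum \<mu> J = 1" using \<mu> by (simp add: K_def)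
  define v where "v = (\<lambda>i. \<Sum>j\<in>J. \<mu> j * c j i)"
  have Fv: "F \<mu> = (\<Sum>i<N. (v i)\<^sup>2)" by (simp add: F_def v_def)
  \<comment> \<open>First-order condition at the minimizer: moving the weights from \<mu> towards
    the vertex j cannot shorten v, so v makes a nonnegative inner product with
    \<open>c j - v\<close>.\<close>
  have key: "(\<Sum>i<N. (v i)\<^sup>2) \<le> (\<Sum>i<N. c j i * v i)" if j: "j \<in> J" for j
  proof -
    define A where "A = (\<Sum>i<N. v i * (c j i - v i))"
    define B where "B = (\<Sum>i<N. (c j i - v i)\<^sup>2)"
    have step: "0 \<le> 2 * A + s * B" if s: "0 < s" "s \<le> 1" for s
    proof -
      define \<nu> where "\<nu> = (\<lambda>k. (1 - s) * \<mu> k + (if k = j then s else 0))"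
      have sum1: "sum \<nu> J = 1"
      proof -
        have "sum \<nu> J = (1 - s) * sum \<mu> J + (\<Sum>k\<in>J. if k = j then s else 0)"
          by (simp add: \<nu>_def sum.distrib sum_distrib_left)
        then show ?thesis using j fin \<mu>1 by simp
      qed
      have nn: "0 \<le> \<nu> k" if "k \<in> J" for k using \<mu>0[OF that] s by (simp add: \<nu>_def)
      have "\<nu> k \<le> 1" if "k \<in> J" for k
        using member_le_sum[of k J \<nu>] nn fin that sum1 by auto
      then have "\<nu> \<in> K" using nn sum1 j \<mu>out by (auto simp: K_def \<nu>_def)
      have "(\<Sum>k\<in>J. \<nu> k * c k i) = v i + s * (c j i - v i)" for i
      proof -
        have "(\<Sum>k\<in>J. \<nu> k * c k i) = (\<Sum>k\<in>J. (1 - s) * (\<mu> k * c k i) + (if k = j then s * c k i else 0))"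
          by (intro sum.cong) (auto simp: \<nu>_def distrib_right)
        also have "\<dots> = (1 - s) * v i + (\<Sum>k\<in>J. if k = j then s * c k i else 0)"
          by (simp only: sum.distrib v_def sum_distrib_left)
        also have "\<dots> = (1 - s) * v i + s * c j i"
          using j fin by simp
        finally show ?thesis by (simp add: algebra_simps)
      qed
      then have "F \<nu> = (\<Sum>i<N. (v i + s * (c j i - v i))\<^sup>2)" by (simp add: F_def)
      also have "\<dots> = (\<Sum>i<N. (v i)\<^sup>2) + s * (2 * A + s * B)"
        unfolding A_def B_def sum_distrib_left sum.distrib[symmetric]
        by (intro sum.cong) (auto simp: power2_eq_square algebra_simps)
      finally have "0 \<le> s * (2 * A + s * B)" using min[OF \<open>\<nu> \<in> K\<close>] Fv by simp
      then show ?thesis using s by (simp add: zero_le_mult_iff)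
    qed
    \<comment> \<open>The quadratic increment has been divided by s; letting s tend to 0 isolates
      its linear part A.\<close>
    have "((\<lambda>s. 2 * A + s * B) \<longlongrightarrow> 2 * A + 0 * B) (at_right 0)"
      by (intro tendsto_intros)
    moreover have "eventually (\<lambda>s. 0 \<le> 2 * A + s * B) (at_right 0)"
      using step by (intro eventually_at_rightI[of 0 1]) auto
    ultimately have "0 \<le> 2 * A + 0 * B"
      by (intro tendsto_lowerbound) auto
    then have "0 \<le> A" by simp
    then show ?thesis
      by (simp add: A_def right_diff_distrib sum_subtractf power2_eq_square mult.commute)
  qed
  \<comment> \<open>The hypothesis at t = -v produces a vertex whose inner product with v is at most
    0, which together with \<open>key\<close> forces v = 0.\<close>
  obtain j where j: "j \<in> J" "0 \<le> (\<Sum>i<N. c j i * - v i)"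
    using pos[of "\<lambda>i. - v i"] by blast
  then have "(\<Sum>i<N. (v i)\<^sup>2) \<le> 0" using key[OF j(1)] by (simp add: sum_negf)
  then have "(\<Sum>i<N. (v i)\<^sup>2) = 0" by (intro antisym sum_nonneg) auto
  then have "v i = 0" if "i < N" for i using that by (subst (asm) sum_nonneg_eq_0_iff) auto
  with \<mu>0 \<mu>1 show thesis by (intro that[of \<mu>]) (auto simp: v_def)
qed

lemma lin_comb_add: "lin_comb N x (\<lambda>i. c i + d i) = lin_comb N x c + lin_comb N x d"
  by (simp add: lin_comb_def scaleR_add_left sum.distrib)

lemma lin_comb_scale: "lin_comb N x (\<lambda>i. a * c i) = a *\<^sub>R lin_comb N x c"
  by (simp add: lin_comb_def scaleR_sum_right)

lemma lin_comb_unit: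
  assumes "j < N"
  shows "lin_comb N x (\<lambda>i. if i = j then 1 else 0) = x j"
proof -
  have "lin_comb N x (\<lambda>i. if i = j then 1 else 0) = (\<Sum>i<N. if i = j then x i else 0)"
    unfolding lin_comb_def by (intro sum.cong) auto
  then show ?thesis using assms by simp
qed

lemma max_lin_le_iff:
  "finite U \<Longrightarrow> U \<noteq> {} \<Longrightarrow> max_lin N x U \<le> w \<longleftrightarrow> (\<forall>c\<in>U. lin_comb N x c \<le> w)"
  by (simp add: max_lin_def Sup_fin.bounded_iff)

text \<open>Elements defined as suprema are identified through their upper bounds; each identity for
  \<open>max_lin\<close> then reduces to inequalities between linear combinations.\<close>

lemma eq_if_same_upper_bounds:
  fixes a b :: "'v::order"
  assumes "\<And>w. a \<le> w \<longleftrightarrow> b \<le> w"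
  shows "a = b"
  using assms[of a] assms[of b] by simp

lemma max_lin_union:
  assumes "finite U" "U \<noteq> {}" "finite V" "V \<noteq> {}"
  shows "max_lin N x (U \<union> V) = sup (max_lin N x U) (max_lin N x V)"
  by (rule eq_if_same_upper_bounds) (use assms in \<open>auto simp: max_lin_le_iff\<close>)

text \<open>Translations are order isomorphisms, so adding two suprema gives the supremum over the
  Minkowski sum of the coefficient sets.\<close>

lemma max_lin_plus:
  assumes "finite U" "U \<noteq> {}" "finite V" "V \<noteq> {}"
  shows "max_lin N x ((\<lambda>(c, d) i. c i + d i) ` (U \<times> V)) = max_lin N x U + max_lin N x V"
proof (rule eq_if_same_upper_bounds)
  fix w
  have "max_lin N x U + max_lin N x V \<le> w \<longleftrightarrow> max_lin N x U \<le> w - max_lin N x V"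
    by (simp add: le_diff_eq)
  also have "\<dots> \<longleftrightarrow> (\<forall>c\<in>U. lin_comb N x c \<le> w - max_lin N x V)"
    using assms by (simp add: max_lin_le_iff)
  also have "\<dots> \<longleftrightarrow> (\<forall>c\<in>U. max_lin N x V \<le> w - lin_comb N x c)"
    by (simp add: le_diff_eq add.commute)
  also have "\<dots> \<longleftrightarrow> (\<forall>c\<in>U. \<forall>d\<in>V. lin_comb N x c + lin_comb N x d \<le> w)"
    using assms by (simp add: max_lin_le_iff) (simp add: le_diff_eq add.commute)
  also have "\<dots> \<longleftrightarrow> max_lin N x ((\<lambda>(c, d) i. c i + d i) ` (U \<times> V)) \<le> w"
    using assms by (subst max_lin_le_iff) (auto simp: lin_comb_add)
  finally show "max_lin N x ((\<lambda>(c, d) i. c i + d i) ` (U \<times> V)) \<le> w \<longleftrightarrow> max_lin N x U + max_lin N x V \<le> w"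
    by simp
qed

lemma max_lin_scale:
  assumes "finite U" "U \<noteq> {}" "0 < a"
  shows "max_lin N x ((\<lambda>c i. a * c i) ` U) = a *\<^sub>R max_lin N x U"
proof (rule eq_if_same_upper_bounds)
  fix w
  have "max_lin N x ((\<lambda>c i. a * c i) ` U) \<le> w \<longleftrightarrow> (\<forall>c\<in>U. a *\<^sub>R lin_comb N x c \<le> w)"
    using assms by (subst max_lin_le_iff) (auto simp: lin_comb_scale)
  also have "\<dots> \<longleftrightarrow> (\<forall>c\<in>U. lin_comb N x c \<le> inverse a *\<^sub>R w)"
    using assms by (simp add: pos_le_divideR_eq divideR_right flip: divideR_right)
  also have "\<dots> \<longleftrightarrow> max_lin N x U \<le> inverse a *\<^sub>R w"
    using assms by (simp add: max_lin_le_iff)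
  also have "\<dots> \<longleftrightarrow> a *\<^sub>R max_lin N x U \<le> w"
    using assms by (simp add: pos_le_divideR_eq)
  finally show "max_lin N x ((\<lambda>c i. a * c i) ` U) \<le> w \<longleftrightarrow> a *\<^sub>R max_lin N x U \<le> w" .
qed

text \<open>The passage from numbers to lattices. If one maximum of linear forms dominates another
  at every real point, each form d of the smaller one is a convex combination of the forms of the
  larger one. Such a certificate makes sense in every ordered vector space.\<close>

lemma max_lin_mono:
  fixes x :: "nat \<Rightarrow> 'v::{ordered_real_vector,lattice_ab_group_add_abs}"
  assumes U: "finite U" "U \<noteq> {}" and V: "finite V" "V \<noteq> {}"
    and le: "\<And>t::nat \<Rightarrow> real. max_lin N t V \<le> max_lin N t U"
  shows "max_lin N x V \<le> max_lin N x U"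
proof (subst max_lin_le_iff[OF V], intro ballI)
  fix d assume d: "d \<in> V"
  have "\<exists>c\<in>U. 0 \<le> (\<Sum>i<N. (c i - d i) * t i)" for t :: "nat \<Rightarrow> real"
  proof -
    have "lin_comb N t d \<le> max_lin N t U"
      using le[of t] d by (simp add: max_lin_le_iff[OF V])
    \<comment> \<open>The order of \<open>real\<close> is total, so the supremum is one of the
      linear forms; this supplies the hypothesis of Farkas' alternative for the vectors c -
      d.\<close>
    moreover have "max_lin N t U \<in> lin_comb N t ` U"
      unfolding max_lin_def using U Max_in[of "lin_comb N t ` U"] by (simp add: Sup_fin_Max)
    ultimately obtain c where "c \<in> U" "lin_comb N t d \<le> lin_comb N t c" by auto
    then show ?thesis by (intro bexI[of _ c]) (auto simp: lin_comb_def left_diff_distrib sum_subtractf)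
  qed
  then obtain \<mu> where \<mu>: "\<And>c. c \<in> U \<Longrightarrow> 0 \<le> \<mu> c" "sum \<mu> U = 1"
    "\<And>i. i < N \<Longrightarrow> (\<Sum>c\<in>U. \<mu> c * (c i - d i)) = 0"
    using convex_combination_eq_zero[where J = U and N = N and c = "\<lambda>c i. c i - d i", OF U(1)] by blast
  have d_eq: "d i = (\<Sum>c\<in>U. \<mu> c * c i)" if "i < N" for i
    using \<mu>(3)[OF that] \<mu>(2) by (simp add: right_diff_distrib sum_subtractf flip: sum_distrib_right)
  have "lin_comb N x d = (\<Sum>i<N. \<Sum>c\<in>U. \<mu> c *\<^sub>R c i *\<^sub>R x i)"
    unfolding lin_comb_def by (intro sum.cong) (auto simp: d_eq scaleR_sum_left)
  also have "\<dots> = (\<Sum>c\<in>U. \<mu> c *\<^sub>R lin_comb N x c)"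
    by (subst sum.swap) (simp add: lin_comb_def scaleR_sum_right)
  also have "\<dots> \<le> (\<Sum>c\<in>U. \<mu> c *\<^sub>R max_lin N x U)"
    using \<mu>(1) max_lin_le_iff[OF U, of N x "max_lin N x U"]
    by (intro sum_mono scaleR_left_mono) auto
  also have "\<dots> = max_lin N x U" using \<mu>(2) by (simp flip: scaleR_sum_left)
  finally show "lin_comb N x d \<le> max_lin N x U" .
qed

text \<open>The graph of the Krivine calculus on lattice-linear expressions.\<close>

inductive lattice_term ::
    "nat \<Rightarrow> (nat \<Rightarrow> 'e::{ordered_real_vector,lattice_ab_group_add_abs}) \<Rightarrow> ((nat \<Rightarrow> real) \<Rightarrow> real) \<Rightarrow> 'e \<Rightarrow> bool"
  for N x where
  zero: "lattice_term N x (\<lambda>t. 0) 0"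
| coord: "j < N \<Longrightarrow> lattice_term N x (\<lambda>t. t j) (x j)"
| add: "lattice_term N x g y \<Longrightarrow> lattice_term N x h z \<Longrightarrow> lattice_term N x (\<lambda>t. g t + h t) (y + z)"
| scale: "lattice_term N x h z \<Longrightarrow> lattice_term N x (\<lambda>t. c * h t) (c *\<^sub>R z)"
| max: "lattice_term N x g y \<Longrightarrow> lattice_term N x h z \<Longrightarrow>
    lattice_term N x (\<lambda>t. max (g t) (h t)) (sup y z)"

text \<open>Translating by b + d clears both differences. This keeps differences of maxima closed
  under \<open>sup\<close>.\<close>

lemma diff_of_max_sup:
  fixes a b c d :: "'v::lattice_ab_group_add"
  shows "sup (a - b) (c - d) = sup (a + d) (c + b) - (b + d)"
proof -
  have "a - b + (b + d) = a + d" "c - d + (b + d) = c + b"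
    by (simp_all add: add.assoc[symmetric])
  then have "sup (a - b) (c - d) + (b + d) = sup (a + d) (c + b)"
    by (simp only: add_sup_distrib_right)
  then show ?thesis by (simp only: eq_diff_eq)
qed

text \<open>The point is that the same sets U and V represent the function and the element, so that
  \<open>max_lin_mono\<close> can carry inequalities from one to the other.\<close>

lemma lattice_term_normal_form:
  assumes "lattice_term N x h y"
  obtains U V where "finite U" "U \<noteq> {}" "finite V" "V \<noteq> {}"
    "\<And>t. h t = max_lin N t U - max_lin N t V" "y = max_lin N x U - max_lin N x V"
proof -
  define R where "R = (\<lambda>(h::(nat \<Rightarrow> real) \<Rightarrow> real) y. \<exists>U V. finite U \<and> U \<noteq> {} \<and> finite V \<and> V \<noteq> {} \<and>
    (\<forall>t. h t = max_lin N t U - max_lin N t V) \<and> y = max_lin N x U - max_lin N x V)"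
  have RI: "R h y" if "finite U" "U \<noteq> {}" "finite V" "V \<noteq> {}"
    "\<And>t. h t = max_lin N t U - max_lin N t V" "y = max_lin N x U - max_lin N x V" for h y U V
    using that unfolding R_def by (intro exI[of _ U] exI[of _ V]) auto
  have RE: thesis if Rhy: "R h y" and step: "\<And>U V. finite U \<Longrightarrow> U \<noteq> {} \<Longrightarrow> finite V \<Longrightarrow> V \<noteq> {} \<Longrightarrow>
    (\<And>t. h t = max_lin N t U - max_lin N t V) \<Longrightarrow> y = max_lin N x U - max_lin N x V \<Longrightarrow> thesis" for h y thesis
  proof -
    obtain U V where UV: "finite U" "U \<noteq> {}" "finite V" "V \<noteq> {}"
      "\<forall>t. h t = max_lin N t U - max_lin N t V" "y = max_lin N x U - max_lin N x V"
      using Rhy unfolding R_def by (elim exE conjE) (rule that)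
    show thesis by (rule step[OF UV(1-4) UV(5)[rule_format] UV(6)])
  qed
  let ?plus = "\<lambda>U V. (\<lambda>(c, d) i. c i + d i :: real) ` (U \<times> V)"
  have "R h y" using assms
  proof induction
    case zero
    show ?case
      by (rule RI[of "{\<lambda>_. 0}" "{\<lambda>_. 0}"]) simp_all
  next
    case (coord j)
    then show ?case
      by (intro RI[of "{\<lambda>i. if i = j then 1 else 0}" "{\<lambda>_. 0}"])
         (simp_all add: max_lin_def lin_comb_unit, simp_all add: lin_comb_def)
  next
    case (add g y h z)
    obtain U V where UV: "finite U" "U \<noteq> {}" "finite V" "V \<noteq> {}"
      "\<And>t. g t = max_lin N t U - max_lin N t V" "y = max_lin N x U - max_lin N x V"
      by (rule RE[OF add.IH(1)]) (rule that)
    obtain U' V' where UV': "finite U'" "U' \<noteq> {}" "finite V'" "V' \<noteq> {}"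
      "\<And>t. h t = max_lin N t U' - max_lin N t V'" "z = max_lin N x U' - max_lin N x V'"
      by (rule RE[OF add.IH(2)]) (rule that)
    show ?case using UV UV'
      by (intro RI[of "?plus U U'" "?plus V V'"]) (simp_all add: max_lin_plus)
  next
    case (scale h z a)
    obtain U V where UV: "finite U" "U \<noteq> {}" "finite V" "V \<noteq> {}"
      "\<And>t. h t = max_lin N t U - max_lin N t V" "z = max_lin N x U - max_lin N x V"
      by (rule RE[OF scale.IH]) (rule that)
    consider "a = 0" | "a > 0" | "a < 0" by linarith
    then show ?case
    proof cases
      case 1
      show ?thesis unfolding 1 by (rule RI[of "{\<lambda>_. 0}" "{\<lambda>_. 0}"]) simp_all
    next
      case 2
      have "max_lin N t ((\<lambda>c i. a * c i) ` U) = a * max_lin N t U" 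
           "max_lin N t ((\<lambda>c i. a * c i) ` V) = a * max_lin N t V" for t :: "nat \<Rightarrow> real"
        using UV 2 by (simp_all add: max_lin_scale)
      then show ?thesis using UV 2
        by (intro RI[of "(\<lambda>c i. a * c i) ` U" "(\<lambda>c i. a * c i) ` V"])
           (simp_all add: max_lin_scale right_diff_distrib scaleR_diff_right)
    next
      case 3
      \<comment> \<open>A negative factor exchanges the two maxima of the difference, each being
        scaled by the positive number \<open>- a\<close>.\<close>
      then have pos: "0 < - a" by simp
      have "max_lin N t ((\<lambda>c i. (- a) * c i) ` U) = (- a) * max_lin N t U" 
           "max_lin N t ((\<lambda>c i. (- a) * c i) ` V) = (- a) * max_lin N t V" for t :: "nat \<Rightarrow> real"
        using max_lin_scale[OF UV(1,2) pos, where x = t] max_lin_scale[OF UV(3,4) pos, where x = t] by simp_all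
      moreover note max_lin_scale[OF UV(1,2) pos, where x = x] max_lin_scale[OF UV(3,4) pos, where x = x]
      ultimately show ?thesis using UV(1-4)
        by (intro RI[of "(\<lambda>c i. (- a) * c i) ` V" "(\<lambda>c i. (- a) * c i) ` U"])
           (simp_all add: UV(5,6) right_diff_distrib scaleR_diff_right)
    qed
  next
    case (max g y h z)
    obtain U V where UV: "finite U" "U \<noteq> {}" "finite V" "V \<noteq> {}"
      "\<And>t. g t = max_lin N t U - max_lin N t V" "y = max_lin N x U - max_lin N x V"
      by (rule RE[OF max.IH(1)]) (rule that)
    obtain U' V' where UV': "finite U'" "U' \<noteq> {}" "finite V'" "V' \<noteq> {}"
      "\<And>t. h t = max_lin N t U' - max_lin N t V'" "z = max_lin N x U' - max_lin N x V'"
      by (rule RE[OF max.IH(2)]) (rule that)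
    have "max (g t) (h t) = max_lin N t (?plus U V' \<union> ?plus U' V) - max_lin N t (?plus V V')" for t
      using UV(1-4) UV'(1-4) unfolding UV(5) UV'(5) sup_max[symmetric] diff_of_max_sup
      by (simp add: max_lin_plus max_lin_union)
    moreover have "sup y z = max_lin N x (?plus U V' \<union> ?plus U' V) - max_lin N x (?plus V V')"
      using UV(1-4) UV'(1-4) unfolding UV(6) UV'(6) diff_of_max_sup
      by (simp add: max_lin_plus max_lin_union)
    ultimately show ?case
      using UV(1-4) UV'(1-4) by (intro RI[of "?plus U V' \<union> ?plus U' V" "?plus V V'"]) simp_all
  qed
  then show thesis by (rule RE) (rule that)
qed

text \<open>Applied to differences, this gives monotonicity and shows that the element depends on
  the function only, not on the expression that produced it.\<close>

lemma lattice_term_nonneg: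
  assumes "lattice_term N x h y" "\<And>t. 0 \<le> h t"
  shows "0 \<le> y"
proof -
  obtain U V where UV: "finite U" "U \<noteq> {}" "finite V" "V \<noteq> {}"
    "\<And>t. h t = max_lin N t U - max_lin N t V" "y = max_lin N x U - max_lin N x V"
    by (rule lattice_term_normal_form[OF assms(1)]) (rule that)
  have "max_lin N t V \<le> max_lin N t U" for t :: "nat \<Rightarrow> real"
    using assms(2)[of t] by (simp add: UV(5))
  then have "max_lin N x V \<le> max_lin N x U" by (rule max_lin_mono[OF UV(1-4)])
  then show ?thesis by (simp add: UV(6))
qed

section \<open>The Krivine functional calculus\<close>

lemma norm_abs_lattice [simp]: "norm \<bar>x\<bar> = norm (x::'e::real_banach_lattice)"
  by (intro antisym norm_mono_abs) simp_all

lemma norm_le_if_abs_le: "\<bar>x\<bar> \<le> y \<Longrightarrow> norm x \<le> norm (y::'e::real_banach_lattice)"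
  by (rule norm_mono_abs) (metis abs_ge_self order_trans)

lemma norm_mono_nonneg: "0 \<le> x \<Longrightarrow> x \<le> y \<Longrightarrow> norm x \<le> norm (y::'e::real_banach_lattice)"
  by (rule norm_le_if_abs_le) simp

text \<open>The estimate behind the norm continuity of the lattice operations; the one-sided bound
  suffices by symmetry.\<close>

lemma abs_diff_sup_le:
  fixes a b c d :: "'e::lattice_ab_group_add_abs"
  shows "\<bar>sup a c - sup b d\<bar> \<le> \<bar>a - b\<bar> + \<bar>c - d\<bar>"
proof -
  have *: "sup a c \<le> sup b d + (\<bar>a - b\<bar> + \<bar>c - d\<bar>)" for a b c d :: 'e
  proof (rule sup_least)
    have "a - b \<le> \<bar>a - b\<bar> + \<bar>c - d\<bar>" "c - d \<le> \<bar>a - b\<bar> + \<bar>c - d\<bar>"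
      by (simp_all add: add_increasing add_increasing2 abs_ge_self)
    then show "a \<le> sup b d + (\<bar>a - b\<bar> + \<bar>c - d\<bar>)" "c \<le> sup b d + (\<bar>a - b\<bar> + \<bar>c - d\<bar>)"
      by (metis add_mono diff_add_cancel add.commute sup_ge1, metis add_mono diff_add_cancel add.commute sup_ge2)
  qed
  show ?thesis
    using *[of a c b d] *[of b d a c]
    by (intro abs_leI) (simp_all only: minus_diff_eq diff_le_eq abs_minus_commute add.commute)
qed

text \<open>The positive cone is closed: the negative part \<open>sup (- y) 0\<close> is Lipschitz
  in y and vanishes on the approximants.\<close>

lemma nonneg_if_approx:
  fixes y :: "'e::real_banach_lattice"
  assumes "\<And>\<epsilon>. 0 < \<epsilon> \<Longrightarrow> \<exists>z\<ge>0. norm (y - z) \<le> \<epsilon>"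
  shows "0 \<le> y"
proof -
  have "norm (sup (- y) 0) \<le> \<epsilon>" if \<epsilon>: "0 < \<epsilon>" for \<epsilon>
  proof -
    obtain z where z: "0 \<le> z" "norm (y - z) \<le> \<epsilon>" using assms[OF \<epsilon>] by blast
    have "sup (- z) 0 = 0" using z by (simp add: sup_absorb2)
    then have "\<bar>sup (- y) 0\<bar> \<le> \<bar>y - z\<bar>"
      using abs_diff_sup_le[of "- y" 0 "- z" 0] by (simp add: abs_minus_commute)
    then have "norm (sup (- y) 0) \<le> norm (y - z)" by (rule norm_mono_abs)
    with z show ?thesis by simp
  qed
  then have "norm (sup (- y) 0) \<le> 0" by (rule field_le_epsilon) simp
  then have "sup (- y) 0 = 0" by simp
  then have "- y \<le> 0" by (metis sup_ge1)
  then show ?thesis by simp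
qed

text \<open>The Archimedean property, from closedness of the cone: the surplus \<epsilon> v tends to
  0 in norm.\<close>

lemma le_if_le_add_scaleR:
  fixes y m v :: "'e::real_banach_lattice"
  assumes "\<And>\<epsilon>. 0 < \<epsilon> \<Longrightarrow> y \<le> m + \<epsilon> *\<^sub>R v"
  shows "y \<le> m"
proof -
  have "0 \<le> m - y"
  proof (rule nonneg_if_approx)
    fix \<epsilon> :: real assume \<epsilon>: "0 < \<epsilon>"
    define \<delta> where "\<delta> = \<epsilon> / (norm v + 1)"
    have v: "0 < norm v + 1" using norm_ge_zero[of v] by linarith
    then have "0 < \<delta>" using \<epsilon> by (simp add: \<delta>_def)
    then have "0 \<le> m - y + \<delta> *\<^sub>R v"
      using assms[of \<delta>] by (simp add: algebra_simps)
    moreover have "\<delta> * norm v \<le> \<epsilon>"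
      using \<epsilon> v by (simp add: \<delta>_def pos_divide_le_eq mult_left_mono)
    then have "norm (m - y - (m - y + \<delta> *\<^sub>R v)) \<le> \<epsilon>"
      using \<open>0 < \<delta>\<close> by simp
    ultimately show "\<exists>z\<ge>0. norm (m - y - z) \<le> \<epsilon>" by blast
  qed
  then show ?thesis by simp
qed

text \<open>Takes the place of the constant function 1, which is not homogeneous: it equals 1 on the
  \<ell>1 sphere, and errors of approximation are measured against it.\<close>

definition ell1 :: "nat \<Rightarrow> (nat \<Rightarrow> real) \<Rightarrow> real"
  where "ell1 N t = (\<Sum>i<N. \<bar>t i\<bar>)"

lemma ell1_nonneg [simp]: "0 \<le> ell1 N t"
  by (simp add: ell1_def sum_nonneg)

section \<open>Closure properties of positively homogeneous functions\<close>

lemma pos_homogeneousD: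
  assumes "h \<in> pos_homogeneous N"
  shows pos_homogeneous_cong: "(\<And>i. i < N \<Longrightarrow> s i = t i) \<Longrightarrow> h s = h t"
    and pos_homogeneous_scaled: "0 \<le> c \<Longrightarrow> h (\<lambda>i. c * t i) = c * h t"
    and pos_homogeneous_continuous: "continuous_on UNIV h"
  using assms unfolding pos_homogeneous_def by blast+

lemma pos_homogeneous_add:
  assumes "g \<in> pos_homogeneous N" "h \<in> pos_homogeneous N"
  shows "(\<lambda>t. g t + h t) \<in> pos_homogeneous N"
proof -
  have "g s + h s = g t + h t" if "\<forall>i<N. s i = t i" for s t
    using pos_homogeneous_cong[OF assms(1), of s t] pos_homogeneous_cong[OF assms(2), of s t] that by simp
  then show ?thesis
    using pos_homogeneous_scaled[OF assms(1)] pos_homogeneous_scaled[OF assms(2)]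
      pos_homogeneous_continuous[OF assms(1)] pos_homogeneous_continuous[OF assms(2)]
    unfolding pos_homogeneous_def by (auto simp: distrib_left intro: continuous_on_add)
qed

lemma pos_homogeneous_scale:
  assumes "h \<in> pos_homogeneous N"
  shows "(\<lambda>t. c * h t) \<in> pos_homogeneous N"
proof -
  have "c * h s = c * h t" if "\<forall>i<N. s i = t i" for s t
    using pos_homogeneous_cong[OF assms(1), of s t] that by simp
  then show ?thesis
    using pos_homogeneous_scaled[OF assms(1)] pos_homogeneous_continuous[OF assms(1)]
    unfolding pos_homogeneous_def by (auto intro: continuous_on_mult_left)
qed

lemma pos_homogeneous_max:
  assumes "g \<in> pos_homogeneous N" "h \<in> pos_homogeneous N"
  shows "(\<lambda>t. max (g t) (h t)) \<in> pos_homogeneous N"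
proof -
  have "max (g s) (h s) = max (g t) (h t)" if "\<forall>i<N. s i = t i" for s t
    using pos_homogeneous_cong[OF assms(1), of s t] pos_homogeneous_cong[OF assms(2), of s t] that by simp
  then show ?thesis
    using pos_homogeneous_scaled[OF assms(1)] pos_homogeneous_scaled[OF assms(2)]
      pos_homogeneous_continuous[OF assms(1)] pos_homogeneous_continuous[OF assms(2)]
    unfolding pos_homogeneous_def by (auto simp: max_mult_distrib_left intro: continuous_on_max)
qed

lemma pos_homogeneous_zero: "(\<lambda>t. 0) \<in> pos_homogeneous N"
  by (simp add: pos_homogeneous_def)

lemma pos_homogeneous_coord: "j < N \<Longrightarrow> (\<lambda>t. t j) \<in> pos_homogeneous N"
  by (simp add: pos_homogeneous_def)

lemma pos_homogeneous_sum:
  assumes "\<And>i. i \<in> I \<Longrightarrow> h i \<in> pos_homogeneous N"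
  shows "(\<lambda>t. \<Sum>i\<in>I. h i t) \<in> pos_homogeneous N"
  using assms
proof (induction I rule: infinite_finite_induct)
  case (insert i I)
  then show ?case using pos_homogeneous_add[of "h i" N "\<lambda>t. \<Sum>i\<in>I. h i t"] by simp
qed (simp_all add: pos_homogeneous_zero)

lemma max_minus_eq_abs: "max a (- 1 * a) = \<bar>a\<bar>" for a :: real by simp

lemma pos_homogeneous_abs: "h \<in> pos_homogeneous N \<Longrightarrow> (\<lambda>t. \<bar>h t\<bar>) \<in> pos_homogeneous N"
  using pos_homogeneous_max[OF _ pos_homogeneous_scale, of h N h "- 1"]
  by (simp only: max_minus_eq_abs)

lemma pos_homogeneous_ell1: "ell1 N \<in> pos_homogeneous N"
proof -
  have "(\<lambda>t. \<Sum>i<N. \<bar>t i\<bar>) \<in> pos_homogeneous N"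
    by (intro pos_homogeneous_sum pos_homogeneous_abs pos_homogeneous_coord) simp
  then show ?thesis by (simp add: ell1_def[abs_def])
qed

lemma lattice_term_pos_homogeneous: "lattice_term N x h y \<Longrightarrow> h \<in> pos_homogeneous N"
  by (induction rule: lattice_term.induct)
     (simp_all add: pos_homogeneous_zero pos_homogeneous_coord pos_homogeneous_add
       pos_homogeneous_scale pos_homogeneous_max)

section \<open>Lattice terms: closure, continuity and density\<close>

lemma lattice_term_diff:
  assumes "lattice_term N x g y" "lattice_term N x h z"
  shows "lattice_term N x (\<lambda>t. g t - h t) (y - z)"
  using lattice_term.add[OF assms(1) lattice_term.scale[OF assms(2), of "- 1"]] by simp

lemma lattice_term_abs:
  assumes "lattice_term N x h y"
  shows "lattice_term N x (\<lambda>t. \<bar>h t\<bar>) \<bar>y\<bar>"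
  using lattice_term.max[OF assms lattice_term.scale[OF assms, of "- 1"]]
  by (simp only: max_minus_eq_abs scaleR_minus1_left abs_lattice)

lemma lattice_term_sum:
  assumes "\<And>i. i \<in> I \<Longrightarrow> lattice_term N x (h i) (y i)"
  shows "lattice_term N x (\<lambda>t. \<Sum>i\<in>I. h i t) (\<Sum>i\<in>I. y i)"
  using assms
proof (induction I rule: infinite_finite_induct)
  case (insert i I)
  then show ?case using lattice_term.add[of N x "h i" "y i" "\<lambda>t. \<Sum>i\<in>I. h i t"] by simp
qed (simp_all add: lattice_term.zero)

lemma lattice_term_ell1: "lattice_term N x (ell1 N) (\<Sum>i<N. \<bar>x i\<bar>)"
  unfolding ell1_def[abs_def]
  by (intro lattice_term_sum lattice_term_abs lattice_term.coord) simp

text \<open>The bound by \<epsilon> \<open>ell1\<close> is an inequality between lattice terms, so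
  it holds for the elements too. This continuity of the calculus is what permits its extension by
  density.\<close>

lemma lattice_term_norm_le:
  fixes x :: "nat \<Rightarrow> 'e::real_banach_lattice"
  assumes "lattice_term N x h y" and le: "\<And>t. \<bar>h t\<bar> \<le> \<epsilon> * ell1 N t" and "0 \<le> \<epsilon>"
  shows "norm y \<le> \<epsilon> * norm (\<Sum>i<N. \<bar>x i\<bar>)"
proof -
  have "0 \<le> \<epsilon> *\<^sub>R (\<Sum>i<N. \<bar>x i\<bar>) - \<bar>y\<bar>"
    by (rule lattice_term_nonneg)
       (rule lattice_term_diff[OF lattice_term.scale[OF lattice_term_ell1, of N x \<epsilon>] lattice_term_abs[OF assms(1)]],
        simp add: le)
  then have "norm y \<le> norm (\<epsilon> *\<^sub>R (\<Sum>i<N. \<bar>x i\<bar>))" by (intro norm_le_if_abs_le) simp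
  then show ?thesis using \<open>0 \<le> \<epsilon>\<close> by simp
qed

lemma lattice_term_finite_max:
  assumes "finite S" "S \<noteq> {}" "\<And>s. s \<in> S \<Longrightarrow> \<exists>y. lattice_term N x (g s) y"
  shows "\<exists>m y. lattice_term N x m y \<and> (\<forall>v. (\<forall>s\<in>S. g s v \<le> m v) \<and> (\<exists>s\<in>S. m v = g s v))"
  using assms
proof (induction S rule: finite_ne_induct)
  case (singleton s)
  then show ?case by auto
next
  case (insert s S)
  have "\<exists>m y. lattice_term N x m y \<and> (\<forall>v. (\<forall>s\<in>S. g s v \<le> m v) \<and> (\<exists>s\<in>S. m v = g s v))"
    using insert.prems by (intro insert.IH) simp
  then obtain m y where m: "lattice_term N x m y" "\<And>v. \<forall>s\<in>S. g s v \<le> m v" "\<And>v. \<exists>s\<in>S. m v = g s v"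
    by blast
  obtain z where z: "lattice_term N x (g s) z" using insert.prems by auto
  have "(\<forall>r\<in>insert s S. g r v \<le> max (g s v) (m v)) \<and> (\<exists>r\<in>insert s S. max (g s v) (m v) = g r v)" for v
    using m(2)[of v] m(3)[of v] by (auto simp: max_def intro: order_trans)
  then show ?case using lattice_term.max[OF z m(1)] by blast
qed

lemma lattice_term_finite_min:
  assumes "finite S" "S \<noteq> {}" "\<And>s. s \<in> S \<Longrightarrow> \<exists>y. lattice_term N x (g s) y"
  shows "\<exists>m y. lattice_term N x m y \<and> (\<forall>v. (\<forall>s\<in>S. m v \<le> g s v) \<and> (\<exists>s\<in>S. m v = g s v))"
proof -
  have "\<exists>y. lattice_term N x (\<lambda>t. - 1 * g s t) y" if "s \<in> S" for s
    using assms(3)[OF that] lattice_term.scale by blast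
  then obtain m y where m: "lattice_term N x m y" "\<And>v. \<forall>s\<in>S. - 1 * g s v \<le> m v" "\<And>v. \<exists>s\<in>S. m v = - 1 * g s v"
    using lattice_term_finite_max[OF assms(1,2), of N x "\<lambda>s t. - 1 * g s t"] by blast
  have "(\<forall>s\<in>S. - 1 * m v \<le> g s v) \<and> (\<exists>s\<in>S. - 1 * m v = g s v)" for v
    using m(2)[of v] m(3)[of v] by force
  then show ?thesis using lattice_term.scale[OF m(1), of "- 1"] by blast
qed

text \<open>The lattice version of the Stone--Weierstrass argument, on the unit sphere of the
  \<open>\<ell>\<^sub>1\<close>-norm.\<close>

lemma lattice_term_dense:
  assumes h: "h \<in> pos_homogeneous N" and \<epsilon>: "0 < \<epsilon>"
  shows "\<exists>g y. lattice_term N x g y \<and> (\<forall>t. \<bar>h t - g t\<bar> \<le> \<epsilon> * ell1 N t)"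
proof -
  define K where "K = PiE UNIV (\<lambda>i. if i < N then {-1..1::real} else {0}) \<inter> {t. ell1 N t = 1}"
  have "closed {t. ell1 N t = 1}"
    using pos_homogeneous_continuous[OF pos_homogeneous_ell1, of N]
    by (intro closed_Collect_eq) auto
  then have K: "compact K"
    unfolding K_def by (intro compact_Int_closed compact_box) auto
  have ell1_K: "ell1 N t = 1" if "t \<in> K" for t using that by (simp add: K_def)
  have K_outside: "t i = 0" if "t \<in> K" "\<not> i < N" for t i
  proof -
    have "t \<in> PiE UNIV (\<lambda>i. if i < N then {-1..1} else {0})" using that(1) by (simp add: K_def)
    from PiE_mem[OF this UNIV_I, of i] show ?thesis using that(2) by simp
  qed
  note cont = pos_homogeneous_continuous[OF h]
  \<comment> \<open>Since \<open>ell1\<close> is 1 on K, the combinations of \<open>ell1\<close> and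
    one coordinate are affine functions there; a coordinate separating s and u lets them take any
    two prescribed values.\<close>
  have two_points: "\<exists>g. (\<exists>y. lattice_term N x g y) \<and> g s = h s \<and> g u = h u" if s: "s \<in> K" and u: "u \<in> K" for s u
  proof (cases "s = u")
    case True
    then show ?thesis
      using lattice_term.scale[OF lattice_term_ell1, of N x "h u"] ell1_K[OF u]
      by (intro exI[of _ "\<lambda>t. h u * ell1 N t"]) auto
  next
    case False
    then obtain i where i: "s i \<noteq> u i" by (auto simp: fun_eq_iff)
    have "i < N" using i K_outside[OF s, of i] K_outside[OF u, of i] by (cases "i < N") simp_all
    define b where "b = (h s - h u) / (s i - u i)"
    define a where "a = h s - b * s i"
    have "b * (s i - u i) = h s - h u" using i by (simp add: b_def)
    then have "a + b * u i = h u" by (simp add: a_def algebra_simps)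
    then show ?thesis
      using lattice_term.add[OF lattice_term.scale[OF lattice_term_ell1, of N x a]
          lattice_term.scale[OF lattice_term.coord[OF \<open>i < N\<close>], of x b]] ell1_K[OF u] ell1_K[OF s]
      by (intro exI[of _ "\<lambda>t. a * ell1 N t + b * t i"]) (auto simp: a_def)
  qed
  \<comment> \<open>Fix s and vary u: a finite subcover and a minimum keep the value at s exact
    while staying below h + \<epsilon> on all of K. Afterwards a maximum over finitely many s gives
    the lower bound.\<close>
  have above: "\<exists>g. (\<exists>y. lattice_term N x g y) \<and> g s = h s \<and> (\<forall>v\<in>K. g v < h v + \<epsilon>)" if s: "s \<in> K" for s
  proof -
    obtain G where G: "\<And>u. u \<in> K \<Longrightarrow> (\<exists>y. lattice_term N x (G u) y) \<and> G u s = h s \<and> G u u = h u"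
      using two_points[OF s] by metis
    have "open {v. G u v < h v + \<epsilon>}" if "u \<in> K" for u
      using G[OF that] lattice_term_pos_homogeneous[of N x "G u"] cont
      by (intro open_Collect_less continuous_on_add continuous_on_const)
         (auto intro: pos_homogeneous_continuous)
    moreover have "K \<subseteq> (\<Union>u\<in>K. {v. G u v < h v + \<epsilon>})" using G \<epsilon> by force
    ultimately obtain S where S: "S \<subseteq> K" "finite S" "K \<subseteq> (\<Union>u\<in>S. {v. G u v < h v + \<epsilon>})"
      by (rule compactE_image[OF K])
    with s have "S \<noteq> {}" by auto
    obtain m y where m: "lattice_term N x m y" "\<And>v. \<forall>u\<in>S. m v \<le> G u v" "\<And>v. \<exists>u\<in>S. m v = G u v"
      using lattice_term_finite_min[OF S(2) \<open>S \<noteq> {}\<close>, of N x G] G S(1) by blast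
    have "m s = h s" using m(3)[of s] G S(1) by auto
    moreover have "m v < h v + \<epsilon>" if v: "v \<in> K" for v
    proof -
      obtain u where u: "u \<in> S" "v \<in> {v. G u v < h v + \<epsilon>}"
        using subsetD[OF S(3) v] by (rule UN_E)
      then show ?thesis using bspec[OF m(2)[of v] u(1)] by simp
    qed
    ultimately show ?thesis using m(1) by blast
  qed
  obtain g y where g: "lattice_term N x g y" and g_close: "\<And>v. v \<in> K \<Longrightarrow> \<bar>h v - g v\<bar> \<le> \<epsilon>"
  proof (cases "K = {}")
    \<comment> \<open>This happens for N = 0, where the sphere is empty.\<close>
    case True
    then show thesis using that[OF lattice_term.zero] by simp
  next
    case False
    obtain G where G: "\<And>u. u \<in> K \<Longrightarrow> (\<exists>y. lattice_term N x (G u) y) \<and> G u u = h u \<and> (\<forall>v\<in>K. G u v < h v + \<epsilon>)"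
      using above by metis
    have "open {v. h v < G u v + \<epsilon>}" if "u \<in> K" for u
      using G[OF that] lattice_term_pos_homogeneous[of N x "G u"] cont
      by (intro open_Collect_less continuous_on_add continuous_on_const)
         (auto intro: pos_homogeneous_continuous)
    moreover have "K \<subseteq> (\<Union>u\<in>K. {v. h v < G u v + \<epsilon>})" using G \<epsilon> by force
    ultimately obtain S where S: "S \<subseteq> K" "finite S" "K \<subseteq> (\<Union>u\<in>S. {v. h v < G u v + \<epsilon>})"
      by (rule compactE_image[OF K])
    with False have "S \<noteq> {}" by auto
    obtain m y where m: "lattice_term N x m y" "\<And>v. \<forall>u\<in>S. G u v \<le> m v" "\<And>v. \<exists>u\<in>S. m v = G u v"
      using lattice_term_finite_max[OF S(2) \<open>S \<noteq> {}\<close>, of N x G] G S(1) by blast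
    have "m v < h v + \<epsilon>" if v: "v \<in> K" for v
    proof -
      obtain u where u: "u \<in> S" "m v = G u v" using m(3) by blast
      then show ?thesis using G[of u] S(1) v by auto
    qed
    moreover have "h v < m v + \<epsilon>" if v: "v \<in> K" for v
    proof -
      obtain u where u: "u \<in> S" "v \<in> {v. h v < G u v + \<epsilon>}"
        using subsetD[OF S(3) v] by (rule UN_E)
      then show ?thesis using bspec[OF m(2)[of v] u(1)] by simp
    qed
    ultimately have "\<bar>h v - m v\<bar> \<le> \<epsilon>" if "v \<in> K" for v
      using that by (simp add: abs_le_iff less_imp_le diff_le_eq add.commute)
    then show thesis using that m(1) by blast
  qed
  \<comment> \<open>Homogeneity spreads the estimate from the sphere to all t; if
    \<open>ell1 N t\<close> is 0, both values vanish.\<close>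
  have "\<bar>h t - g t\<bar> \<le> \<epsilon> * ell1 N t" for t
  proof -
    define c where "c = ell1 N t"
    define t' where "t' = (\<lambda>i. if i < N then t i / c else 0)"
    have g': "g \<in> pos_homogeneous N" by (rule lattice_term_pos_homogeneous[OF g])
    have "0 \<le> c" by (simp add: c_def)
    have ti: "\<bar>t i\<bar> \<le> c" if "i < N" for i
      unfolding c_def ell1_def using that by (intro member_le_sum) auto
    have split: "f t = c * f t'" if f: "f \<in> pos_homogeneous N" for f
    proof -
      have "f t = f (\<lambda>i. c * t' i)"
        using ti by (intro pos_homogeneous_cong[OF f]) (auto simp: t'_def)
      then show ?thesis using pos_homogeneous_scaled[OF f \<open>0 \<le> c\<close>] by simp
    qed
    show ?thesis
    proof (cases "c = 0")
      case True
      then show ?thesis using split[OF h] split[OF g'] by (simp flip: c_def)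
    next
      case False
      then have "0 < c" using \<open>0 \<le> c\<close> by simp
      have "ell1 N t' = 1"
        using split[OF pos_homogeneous_ell1] False by (simp flip: c_def)
      then have "t' \<in> K"
        using ti \<open>0 < c\<close> by (auto simp: K_def t'_def abs_le_iff divide_simps) (metis minus_le_iff)+
      then have "c * \<bar>h t' - g t'\<bar> \<le> c * \<epsilon>" using g_close \<open>0 \<le> c\<close> by (intro mult_left_mono)
      then show ?thesis
        using split[OF h] split[OF g'] \<open>0 < c\<close>
        by (simp add: abs_mult mult.commute flip: c_def right_diff_distrib)
    qed
  qed
  then show ?thesis using g by blast
qed


text \<open>The closure of the graph \<open>lattice_term\<close>: uniform distance on the \<ell>1
  sphere for functions, norm distance for elements. As a relation it can be handled before it is
  known to be single-valued.\<close>

definition krivine_graph ::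
    "nat \<Rightarrow> (nat \<Rightarrow> 'e::real_banach_lattice) \<Rightarrow> ((nat \<Rightarrow> real) \<Rightarrow> real) \<Rightarrow> 'e \<Rightarrow> bool"
  where "krivine_graph N x h y \<longleftrightarrow>
    (\<forall>\<epsilon>>0. \<exists>g z. lattice_term N x g z \<and> (\<forall>t. \<bar>h t - g t\<bar> \<le> \<epsilon> * ell1 N t) \<and> norm (y - z) \<le> \<epsilon>)"

lemma krivine_graphI:
  assumes "\<And>\<epsilon>. 0 < \<epsilon> \<Longrightarrow> \<exists>g z. lattice_term N x g z \<and> (\<forall>t. \<bar>h t - g t\<bar> \<le> \<epsilon> * ell1 N t) \<and>
    norm (y - z) \<le> C * \<epsilon>"
  shows "krivine_graph N x h y"
  unfolding krivine_graph_def
proof (intro allI impI)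
  fix \<epsilon> :: real assume \<epsilon>: "0 < \<epsilon>"
  define \<delta> where "\<delta> = \<epsilon> / max 1 C"
  have "0 < \<delta>" using \<epsilon> by (simp add: \<delta>_def)
  have "\<delta> * max 1 C = \<epsilon>" by (simp add: \<delta>_def)
  then have "\<delta> \<le> \<epsilon>" "C * \<delta> \<le> \<epsilon>"
    using \<open>0 < \<delta>\<close> mult_left_mono[of 1 "max 1 C" \<delta>] mult_left_mono[of C "max 1 C" \<delta>]
    by (simp_all add: mult.commute)
  then have "\<delta> * ell1 N t \<le> \<epsilon> * ell1 N t" for t by (simp add: mult_right_mono)
  with assms[OF \<open>0 < \<delta>\<close>] \<open>C * \<delta> \<le> \<epsilon>\<close>
  show "\<exists>g z. lattice_term N x g z \<and> (\<forall>t. \<bar>h t - g t\<bar> \<le> \<epsilon> * ell1 N t) \<and> norm (y - z) \<le> \<epsilon>"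
    by (meson order_trans)
qed

lemma krivine_graphD:
  assumes "krivine_graph N x h y" "0 < \<epsilon>"
  obtains g z where "lattice_term N x g z" "\<And>t. \<bar>h t - g t\<bar> \<le> \<epsilon> * ell1 N t" "norm (y - z) \<le> \<epsilon>"
  using assms unfolding krivine_graph_def by blast

lemma lattice_term_close:
  fixes x :: "nat \<Rightarrow> 'e::real_banach_lattice"
  assumes "lattice_term N x g y" "\<And>t. \<bar>h t - g t\<bar> \<le> \<delta> * ell1 N t"
    and "lattice_term N x g' z" "\<And>t. \<bar>h t - g' t\<bar> \<le> \<epsilon> * ell1 N t" and "0 \<le> \<delta>" "0 \<le> \<epsilon>"
  shows "norm (y - z) \<le> (\<delta> + \<epsilon>) * norm (\<Sum>i<N. \<bar>x i\<bar>)"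
proof (rule lattice_term_norm_le[OF lattice_term_diff[OF assms(1,3)]])
  fix t
  show "\<bar>g t - g' t\<bar> \<le> (\<delta> + \<epsilon>) * ell1 N t"
    using assms(2)[of t] assms(4)[of t] by (simp add: distrib_right)
qed (use assms in simp)

text \<open>Two terms close to the same h are close to each other, so by the continuity estimate
  their elements are close in norm.\<close>

lemma krivine_graph_unique:
  assumes "krivine_graph N x h y" "krivine_graph N x h z"
  shows "y = z"
proof -
  define e where "e = norm (\<Sum>i<N. \<bar>x i\<bar>)"
  have "norm (y - z) \<le> \<epsilon>" if \<epsilon>: "0 < \<epsilon>" for \<epsilon>
  proof -
    define \<delta> where "\<delta> = \<epsilon> / (2 * e + 2)"
    have e: "0 < 2 * e + 2" by (simp add: e_def add_nonneg_pos)
    then have \<delta>: "0 < \<delta>" using \<epsilon> by (simp add: \<delta>_def)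
    obtain g u where g: "lattice_term N x g u" "\<And>t. \<bar>h t - g t\<bar> \<le> \<delta> * ell1 N t" "norm (y - u) \<le> \<delta>"
      by (rule krivine_graphD[OF assms(1) \<delta>]) (rule that)
    obtain g' v where g': "lattice_term N x g' v" "\<And>t. \<bar>h t - g' t\<bar> \<le> \<delta> * ell1 N t" "norm (z - v) \<le> \<delta>"
      by (rule krivine_graphD[OF assms(2) \<delta>]) (rule that)
    have "norm (u - v) \<le> (\<delta> + \<delta>) * e"
      unfolding e_def using \<delta> by (intro lattice_term_close[OF g(1,2) g'(1,2)]) auto
    moreover have "norm (y - z) \<le> norm (y - u) + norm (u - v) + norm (v - z)"
      using norm_triangle_ineq[of "y - u" "u - v"] norm_triangle_ineq[of "y - v" "v - z"] by simp
    ultimately have "norm (y - z) \<le> \<delta> * (2 * e + 2)"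
      using g(3) g'(3) by (simp add: algebra_simps norm_minus_commute)
    then show ?thesis using e by (simp add: \<delta>_def)
  qed
  then have "norm (y - z) \<le> 0" by (rule field_le_epsilon) simp
  then show ?thesis by simp
qed

text \<open>Terms approximating h with errors 1/(k+1) have elements forming a Cauchy sequence;
  completeness supplies the value.\<close>

lemma krivine_graph_exists:
  fixes x :: "nat \<Rightarrow> 'e::real_banach_lattice"
  assumes h: "h \<in> pos_homogeneous N"
  shows "\<exists>y. krivine_graph N x h y"
proof -
  define \<delta> where "\<delta> = (\<lambda>k::nat. inverse (real (Suc k)))"
  define e where "e = norm (\<Sum>i<N. \<bar>x i\<bar>)"
  have \<delta>: "0 < \<delta> k" for k by (simp add: \<delta>_def)
  have "\<forall>k. \<exists>g y. lattice_term N x g y \<and> (\<forall>t. \<bar>h t - g t\<bar> \<le> \<delta> k * ell1 N t)"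
    using lattice_term_dense[OF h \<delta>] by blast
  then obtain g y where gy: "\<And>k. lattice_term N x (g k) (y k)" "\<And>k t. \<bar>h t - g k t\<bar> \<le> \<delta> k * ell1 N t"
    by metis
  have close: "norm (y k - y l) \<le> (\<delta> k + \<delta> l) * e" for k l
    unfolding e_def using \<delta> by (intro lattice_term_close[OF gy(1,2) gy(1,2)]) (auto intro: less_imp_le)
  have \<delta>_lim: "\<delta> \<longlonglongrightarrow> 0"
    unfolding \<delta>_def by (rule LIMSEQ_inverse_real_of_nat)
  have "Cauchy y"
  proof (rule metric_CauchyI)
    fix \<epsilon> :: real assume \<epsilon>: "0 < \<epsilon>"
    have "(\<lambda>k. \<delta> k * e) \<longlonglongrightarrow> 0" using tendsto_mult_right[OF \<delta>_lim, of e] by simp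
    then have "eventually (\<lambda>k. \<delta> k * e < \<epsilon> / 2) sequentially"
      using \<epsilon> by (intro order_tendstoD) auto
    then obtain M where M: "\<And>k. k \<ge> M \<Longrightarrow> \<delta> k * e < \<epsilon> / 2" by (auto simp: eventually_sequentially)
    have "dist (y k) (y l) < \<epsilon>" if "k \<ge> M" "l \<ge> M" for k l
      using close[of k l] M[OF that(1)] M[OF that(2)] by (simp add: dist_norm distrib_right)
    then show "\<exists>M. \<forall>k\<ge>M. \<forall>l\<ge>M. dist (y k) (y l) < \<epsilon>" by blast
  qed
  then obtain z where z: "y \<longlonglongrightarrow> z" using Cauchy_convergent convergent_def by blast
  have "krivine_graph N x h z"
    unfolding krivine_graph_def
  proof (intro allI impI)
    fix \<epsilon> :: real assume \<epsilon>: "0 < \<epsilon>"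
    have "eventually (\<lambda>k. \<delta> k < \<epsilon> \<and> dist (y k) z < \<epsilon>) sequentially"
      using \<epsilon> \<delta>_lim z by (intro eventually_conj order_tendstoD tendstoD) auto
    then obtain k where k: "\<delta> k < \<epsilon>" "dist (y k) z < \<epsilon>" by (auto simp: eventually_sequentially)
    have "\<bar>h t - g k t\<bar> \<le> \<epsilon> * ell1 N t" for t
      using gy(2)[of t k] mult_right_mono[of "\<delta> k" \<epsilon> "ell1 N t"] k(1) by simp
    then show "\<exists>g w. lattice_term N x g w \<and> (\<forall>t. \<bar>h t - g t\<bar> \<le> \<epsilon> * ell1 N t) \<and> norm (z - w) \<le> \<epsilon>"
      using gy(1) k(2) by (intro exI[of _ "g k"] exI[of _ "y k"]) (auto simp: dist_norm norm_minus_commute)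
  qed
  then show ?thesis by blast
qed

lemma krivine_graph_lattice_term: "lattice_term N x h y \<Longrightarrow> krivine_graph N x h y"
  unfolding krivine_graph_def by (intro allI impI exI[of _ h] exI[of _ y]) simp

lemma krivine_graph_add:
  assumes "krivine_graph N x g y" "krivine_graph N x h z"
  shows "krivine_graph N x (\<lambda>t. g t + h t) (y + z)"
proof (rule krivine_graphI[where C = 1])
  fix \<epsilon> :: real assume "0 < \<epsilon>"
  then have \<epsilon>: "0 < \<epsilon> / 2" by simp
  obtain g' u where g': "lattice_term N x g' u" "\<And>t. \<bar>g t - g' t\<bar> \<le> \<epsilon> / 2 * ell1 N t" "norm (y - u) \<le> \<epsilon> / 2"
    by (rule krivine_graphD[OF assms(1) \<epsilon>]) (rule that)
  obtain h' v where h': "lattice_term N x h' v" "\<And>t. \<bar>h t - h' t\<bar> \<le> \<epsilon> / 2 * ell1 N t" "norm (z - v) \<le> \<epsilon> / 2"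
    by (rule krivine_graphD[OF assms(2) \<epsilon>]) (rule that)
  have "norm (y + z - (u + v)) \<le> norm (y - u) + norm (z - v)"
    by (metis add_diff_add norm_triangle_ineq)
  moreover have "\<bar>g t + h t - (g' t + h' t)\<bar> \<le> \<epsilon> * ell1 N t" for t
  proof -
    have "\<epsilon> / 2 * ell1 N t = (\<epsilon> * ell1 N t) / 2" by simp
    then show ?thesis using g'(2)[of t] h'(2)[of t] by linarith
  qed
  ultimately show "\<exists>f w. lattice_term N x f w \<and> (\<forall>t. \<bar>g t + h t - f t\<bar> \<le> \<epsilon> * ell1 N t) \<and>
      norm (y + z - w) \<le> 1 * \<epsilon>"
    using g'(3) h'(3) lattice_term.add[OF g'(1) h'(1)]
    by (intro exI[of _ "\<lambda>t. g' t + h' t"] exI[of _ "u + v"]) simp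
qed

lemma krivine_graph_scale:
  assumes "krivine_graph N x h z"
  shows "krivine_graph N x (\<lambda>t. c * h t) (c *\<^sub>R z)"
proof (rule krivine_graphI[where C = 1])
  fix \<epsilon> :: real assume \<epsilon>: "0 < \<epsilon>"
  define \<delta> where "\<delta> = \<epsilon> / (\<bar>c\<bar> + 1)"
  have \<delta>: "0 < \<delta>" using \<epsilon> by (simp add: \<delta>_def add_nonneg_pos)
  have c\<delta>: "\<bar>c\<bar> * \<delta> \<le> \<epsilon>" using \<epsilon> by (simp add: \<delta>_def pos_divide_le_eq add_nonneg_pos mult_left_mono)
  obtain h' v where h': "lattice_term N x h' v" "\<And>t. \<bar>h t - h' t\<bar> \<le> \<delta> * ell1 N t" "norm (z - v) \<le> \<delta>"
    by (rule krivine_graphD[OF assms(1) \<delta>]) (rule that)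
  have "\<bar>c * h t - c * h' t\<bar> \<le> \<epsilon> * ell1 N t" for t
  proof -
    have "\<bar>c * h t - c * h' t\<bar> = \<bar>c\<bar> * \<bar>h t - h' t\<bar>" by (simp flip: abs_mult right_diff_distrib)
    also have "\<dots> \<le> \<bar>c\<bar> * (\<delta> * ell1 N t)" by (intro mult_left_mono h'(2)) simp
    also have "\<dots> \<le> \<epsilon> * ell1 N t"
      using mult_right_mono[OF c\<delta>, of "ell1 N t"] by (simp add: mult.assoc)
    finally show ?thesis .
  qed
  moreover have "norm (c *\<^sub>R z - c *\<^sub>R v) \<le> 1 * \<epsilon>"
    using mult_left_mono[OF h'(3), of "\<bar>c\<bar>"] c\<delta> by (simp flip: scaleR_diff_right)
  ultimately show "\<exists>f w. lattice_term N x f w \<and> (\<forall>t. \<bar>c * h t - f t\<bar> \<le> \<epsilon> * ell1 N t) \<and>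
      norm (c *\<^sub>R z - w) \<le> 1 * \<epsilon>"
    using lattice_term.scale[OF h'(1), of c]
    by (intro exI[of _ "\<lambda>t. c * h' t"] exI[of _ "c *\<^sub>R v"]) simp
qed

lemma krivine_graph_max:
  assumes "krivine_graph N x g y" "krivine_graph N x h z"
  shows "krivine_graph N x (\<lambda>t. max (g t) (h t)) (sup y z)"
proof (rule krivine_graphI[where C = 2])
  fix \<epsilon> :: real assume \<epsilon>: "0 < \<epsilon>"
  obtain g' u where g': "lattice_term N x g' u" "\<And>t. \<bar>g t - g' t\<bar> \<le> \<epsilon> * ell1 N t" "norm (y - u) \<le> \<epsilon>"
    by (rule krivine_graphD[OF assms(1) \<epsilon>]) (rule that)
  obtain h' v where h': "lattice_term N x h' v" "\<And>t. \<bar>h t - h' t\<bar> \<le> \<epsilon> * ell1 N t" "norm (z - v) \<le> \<epsilon>"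
    by (rule krivine_graphD[OF assms(2) \<epsilon>]) (rule that)
  have "norm (sup y z - sup u v) \<le> norm (\<bar>y - u\<bar> + \<bar>z - v\<bar>)"
    by (intro norm_le_if_abs_le abs_diff_sup_le)
  also have "\<dots> \<le> norm (y - u) + norm (z - v)"
    using norm_triangle_ineq[of "\<bar>y - u\<bar>" "\<bar>z - v\<bar>"] by simp
  finally have "norm (sup y z - sup u v) \<le> 2 * \<epsilon>" using g'(3) h'(3) by simp
  moreover have "\<bar>max (g t) (h t) - max (g' t) (h' t)\<bar> \<le> \<epsilon> * ell1 N t" for t
    using g'(2)[of t] h'(2)[of t] by (simp add: max_def abs_le_iff)
  ultimately show "\<exists>f w. lattice_term N x f w \<and> (\<forall>t. \<bar>max (g t) (h t) - f t\<bar> \<le> \<epsilon> * ell1 N t) \<and>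
      norm (sup y z - w) \<le> 2 * \<epsilon>"
    using lattice_term.max[OF g'(1) h'(1)]
    by (intro exI[of _ "\<lambda>t. max (g' t) (h' t)"] exI[of _ "sup u v"]) simp
qed

lemma krivine_graph_min:
  assumes "krivine_graph N x g y" "krivine_graph N x h z"
  shows "krivine_graph N x (\<lambda>t. min (g t) (h t)) (inf y z)"
proof -
  have "- 1 * max (- 1 * a) (- 1 * b) = min a b" for a b :: real by (simp add: minus_max_eq_min)
  moreover have "- 1 *\<^sub>R sup (- 1 *\<^sub>R y) (- 1 *\<^sub>R z) = inf y z" by (simp add: neg_sup_eq_inf)
  ultimately show ?thesis
    using krivine_graph_scale[OF krivine_graph_max[OF krivine_graph_scale[OF assms(1), of "- 1"]
          krivine_graph_scale[OF assms(2), of "- 1"]], of "- 1"]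
    by (simp only:)
qed

text \<open>Outside \<open>pos_homogeneous\<close> the chosen value is arbitrary, and
  \<open>krivine_hom\<close> constrains nothing there.\<close>

lemma krivine_hom_exists:
  fixes x :: "nat \<Rightarrow> 'e::real_banach_lattice"
  obtains \<Phi> where "krivine_hom N x \<Phi>"
proof -
  define \<Phi> where "\<Phi> = (\<lambda>h. SOME y. krivine_graph N x h y)"
  have graph: "krivine_graph N x h (\<Phi> h)" if "h \<in> pos_homogeneous N" for h
    unfolding \<Phi>_def using krivine_graph_exists[OF that] by (rule someI_ex)
  have eq: "\<Phi> h = y" if "krivine_graph N x h y" for h y
    unfolding \<Phi>_def using that krivine_graph_unique by blast
  have "krivine_hom N x \<Phi>"
    unfolding krivine_hom_def
    by (intro conjI ballI allI impI eq krivine_graph_add krivine_graph_max krivine_graph_min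
          krivine_graph_scale graph krivine_graph_lattice_term lattice_term.coord)
  then show thesis by (rule that)
qed

lemma krivine_hom_add:
  "krivine_hom N x \<Phi> \<Longrightarrow> g \<in> pos_homogeneous N \<Longrightarrow> h \<in> pos_homogeneous N \<Longrightarrow>
    \<Phi> (\<lambda>t. g t + h t) = \<Phi> g + \<Phi> h"
  unfolding krivine_hom_def by blast

lemma krivine_hom_scale:
  "krivine_hom N x \<Phi> \<Longrightarrow> h \<in> pos_homogeneous N \<Longrightarrow> \<Phi> (\<lambda>t. c * h t) = c *\<^sub>R \<Phi> h"
  unfolding krivine_hom_def by blast

lemma krivine_hom_max:
  "krivine_hom N x \<Phi> \<Longrightarrow> g \<in> pos_homogeneous N \<Longrightarrow> h \<in> pos_homogeneous N \<Longrightarrow>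
    \<Phi> (\<lambda>t. max (g t) (h t)) = sup (\<Phi> g) (\<Phi> h)"
  unfolding krivine_hom_def by blast

lemma krivine_hom_coord: "krivine_hom N x \<Phi> \<Longrightarrow> j < N \<Longrightarrow> \<Phi> (\<lambda>t. t j) = x j"
  unfolding krivine_hom_def by blast

lemma krivine_hom_zero: "krivine_hom N x \<Phi> \<Longrightarrow> \<Phi> (\<lambda>t. 0) = 0"
  using krivine_hom_scale[OF _ pos_homogeneous_zero, of N x \<Phi> 0] by simp

lemma krivine_hom_lattice_term:
  assumes "krivine_hom N x \<Phi>" "lattice_term N x h y"
  shows "\<Phi> h = y"
  using assms(2)
  by induction
    (simp_all add: krivine_hom_zero[OF assms(1)] krivine_hom_coord[OF assms(1)] krivine_hom_add[OF assms(1)]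
      krivine_hom_scale[OF assms(1)] krivine_hom_max[OF assms(1)] lattice_term_pos_homogeneous)

lemma krivine_hom_mono:
  assumes "krivine_hom N x \<Phi>" "g \<in> pos_homogeneous N" "h \<in> pos_homogeneous N" "\<And>t. g t \<le> h t"
  shows "\<Phi> g \<le> \<Phi> h"
proof -
  have "(\<lambda>t. max (g t) (h t)) = h" using assms(4) by (simp add: max_def fun_eq_iff)
  moreover have "\<Phi> (\<lambda>t. max (g t) (h t)) = sup (\<Phi> g) (\<Phi> h)"
    by (rule krivine_hom_max[OF assms(1-3)])
  ultimately show ?thesis by (simp add: le_iff_sup)
qed

text \<open>Continuity is automatic: a lattice homomorphism is monotone, so trapping h within
  \<epsilon> \<open>ell1\<close> of a lattice term traps its image. Hence all homomorphisms agree on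
  \<open>pos_homogeneous\<close>, and the definite description in \<open>krivine\<close> has a
  referent.\<close>

lemma krivine_hom_graph:
  assumes \<Phi>: "krivine_hom N x \<Phi>" and h: "h \<in> pos_homogeneous N"
  shows "krivine_graph N x h (\<Phi> h)"
proof (rule krivine_graphI[where C = "norm (\<Sum>i<N. \<bar>x i\<bar>)"])
  fix \<epsilon> :: real assume \<epsilon>: "0 < \<epsilon>"
  obtain g z where g: "lattice_term N x g z" "\<And>t. \<bar>h t - g t\<bar> \<le> \<epsilon> * ell1 N t"
    using lattice_term_dense[OF h \<epsilon>] by blast
  have g': "g \<in> pos_homogeneous N" by (rule lattice_term_pos_homogeneous[OF g(1)])
  have e': "(\<lambda>t. \<epsilon> * ell1 N t) \<in> pos_homogeneous N"
    by (intro pos_homogeneous_scale pos_homogeneous_ell1)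
  have e: "\<Phi> (\<lambda>t. \<epsilon> * ell1 N t) = \<epsilon> *\<^sub>R (\<Sum>i<N. \<bar>x i\<bar>)"
    by (intro krivine_hom_lattice_term[OF \<Phi>] lattice_term.scale lattice_term_ell1)
  have "\<Phi> h \<le> \<Phi> (\<lambda>t. g t + \<epsilon> * ell1 N t)" "\<Phi> g \<le> \<Phi> (\<lambda>t. h t + \<epsilon> * ell1 N t)"
    using g(2) by (auto intro!: krivine_hom_mono[OF \<Phi>] pos_homogeneous_add g' h e' simp: abs_le_iff algebra_simps)
  then have "\<Phi> h \<le> z + \<epsilon> *\<^sub>R (\<Sum>i<N. \<bar>x i\<bar>)" "z \<le> \<Phi> h + \<epsilon> *\<^sub>R (\<Sum>i<N. \<bar>x i\<bar>)"
    by (simp_all add: krivine_hom_add[OF \<Phi> g' e'] krivine_hom_add[OF \<Phi> h e'] e krivine_hom_lattice_term[OF \<Phi> g(1)])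
  then have "\<bar>\<Phi> h - z\<bar> \<le> \<epsilon> *\<^sub>R (\<Sum>i<N. \<bar>x i\<bar>)"
    by (intro abs_leI) (simp_all add: diff_le_eq add.commute)
  then have "norm (\<Phi> h - z) \<le> norm (\<epsilon> *\<^sub>R (\<Sum>i<N. \<bar>x i\<bar>))" by (rule norm_le_if_abs_le)
  then show "\<exists>g z. lattice_term N x g z \<and> (\<forall>t. \<bar>h t - g t\<bar> \<le> \<epsilon> * ell1 N t) \<and>
      norm (\<Phi> h - z) \<le> norm (\<Sum>i<N. \<bar>x i\<bar>) * \<epsilon>"
    using g \<epsilon> by (intro exI[of _ g] exI[of _ z]) (simp add: mult.commute)
qed

lemma krivine_eq:
  assumes "krivine_hom N x \<Phi>" "h \<in> pos_homogeneous N"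
  shows "krivine N x h = \<Phi> h"
  unfolding krivine_def
proof (rule the_equality)
  fix y assume "\<exists>\<Psi>. krivine_hom N x \<Psi> \<and> \<Psi> h = y"
  then show "y = \<Phi> h"
    using krivine_hom_graph[OF _ assms(2)] assms(1) krivine_graph_unique by metis
qed (use assms in blast)

section \<open>Moduli and concavity\<close>

lemma scaleC_zero_left [simp]: "0 *\<^sub>C x = (0::'a::complex_banach)"
  using norm_scaleC[of 0 x] by simp

lemma scaleC_zero_right [simp]: "c *\<^sub>C 0 = (0::'a::complex_banach)"
  using norm_scaleC[of c "0::'a"] by simp

lemma scaleC_one [simp]: "1 *\<^sub>C x = (x::'a::complex_banach)"
  using scaleR_scaleC[of 1 x] by simp

lemma scaleC_minus_left: "(- c) *\<^sub>C x = - (c *\<^sub>C (x::'a::complex_banach))"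
  using scaleC_add_left[of c "- c" x] by (simp add: add_eq_0_iff)

lemma scaleC_sum_right: "c *\<^sub>C sum f I = (\<Sum>i\<in>I. c *\<^sub>C (f i :: 'a::complex_banach))"
  by (induction I rule: infinite_finite_induct) (simp_all add: scaleC_add_right)

lemma scaleC_sum_left: "sum c I *\<^sub>C (x::'a::complex_banach) = (\<Sum>i\<in>I. c i *\<^sub>C x)"
  by (induction I rule: infinite_finite_induct) (simp_all add: scaleC_add_left)

lemma scaleC_complexification:
  fixes \<iota> :: "'e::real_vector \<Rightarrow> 'y::complex_banach"
  assumes "linear \<iota>"
  shows "c *\<^sub>C (\<iota> a + \<i> *\<^sub>C \<iota> b) =
    \<iota> (Re c *\<^sub>R a - Im c *\<^sub>R b) + \<i> *\<^sub>C \<iota> (Re c *\<^sub>R b + Im c *\<^sub>R a)"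
proof -
  interpret \<iota>: linear \<iota> by fact
  have "\<iota> (Re c *\<^sub>R a - Im c *\<^sub>R b) + \<i> *\<^sub>C \<iota> (Re c *\<^sub>R b + Im c *\<^sub>R a) =
    complex_of_real (Re c) *\<^sub>C \<iota> a + (- complex_of_real (Im c)) *\<^sub>C \<iota> b +
    ((\<i> * complex_of_real (Re c)) *\<^sub>C \<iota> b + (\<i> * complex_of_real (Im c)) *\<^sub>C \<iota> a)"
    by (simp add: \<iota>.add \<iota>.diff \<iota>.scale scaleR_scaleC scaleC_add_right scaleC_scaleC scaleC_minus_left)
  also have "\<dots> = (complex_of_real (Re c) + \<i> * complex_of_real (Im c)) *\<^sub>C \<iota> a +
    (- complex_of_real (Im c) + \<i> * complex_of_real (Re c)) *\<^sub>C \<iota> b"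
    by (simp only: scaleC_add_left ac_simps)
  also have "complex_of_real (Re c) + \<i> * complex_of_real (Im c) = c" by (rule complex_eq[symmetric])
  also have "- complex_of_real (Im c) + \<i> * complex_of_real (Re c) = c * \<i>" by (simp add: complex_eq_iff)
  finally show ?thesis by (simp add: scaleC_add_right scaleC_scaleC)
qed

lemma modulus_eqI:
  fixes \<iota> :: "'e::real_banach_lattice \<Rightarrow> 'y::complex_banach"
  assumes \<iota>: "complex_banach_lattice \<iota>" and m: "is_modulus a b m"
  shows "modulus \<iota> (\<iota> a + \<i> *\<^sub>C \<iota> b) = m"
  unfolding modulus_def
proof (rule the_equality)
  show "\<exists>a' b'. \<iota> a + \<i> *\<^sub>C \<iota> b = \<iota> a' + \<i> *\<^sub>C \<iota> b' \<and> is_modulus a' b' m"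
    using m by blast
next
  fix m' assume "\<exists>a' b'. \<iota> a + \<i> *\<^sub>C \<iota> b = \<iota> a' + \<i> *\<^sub>C \<iota> b' \<and> is_modulus a' b' m'"
  then obtain a' b' where ab: "\<iota> a + \<i> *\<^sub>C \<iota> b = \<iota> a' + \<i> *\<^sub>C \<iota> b'" and m': "is_modulus a' b' m'" by blast
  have "\<exists>!(u, v). \<iota> a + \<i> *\<^sub>C \<iota> b = \<iota> u + \<i> *\<^sub>C \<iota> v"
    using \<iota> unfolding complex_banach_lattice_def by blast
  then have "(a, b) = (a', b')"
    using ab by (elim ex1E) (metis (mono_tags, lifting) case_prod_conv)
  then have "is_modulus a b m'" using m' by simp
  then show "m' = m"
    using m unfolding is_modulus_def isLub_def leastP_def setge_def
    by (intro antisym) auto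
qed

lemma norm_modulus:
  fixes \<iota> :: "'e::real_banach_lattice \<Rightarrow> 'y::complex_banach"
  assumes \<iota>: "complex_banach_lattice \<iota>"
  shows "norm (modulus \<iota> y) = norm y"
proof -
  have "\<exists>!(u, v). y = \<iota> u + \<i> *\<^sub>C \<iota> v"
    using \<iota> unfolding complex_banach_lattice_def by blast
  then obtain a b where y: "y = \<iota> a + \<i> *\<^sub>C \<iota> b" by auto
  obtain m where "is_modulus a b m" "norm (\<iota> a + \<i> *\<^sub>C \<iota> b) = norm m"
    using \<iota> unfolding complex_banach_lattice_def by blast
  then show ?thesis using modulus_eqI[OF \<iota>] y by metis
qed

text \<open>The modulus is a supremum over all \<theta>, whereas lattice terms admit finite maxima
  only. Compactness of the unit circle gives finitely many directions that are good enough up to a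
  relative error.\<close>

lemma finite_net_of_directions:
  fixes \<epsilon> :: real
  assumes \<epsilon>: "0 < \<epsilon>"
  obtains \<Theta> where "finite \<Theta>" "\<Theta> \<noteq> {}"
    "\<And>w. \<exists>\<theta>\<in>\<Theta>. cmod w \<le> cos \<theta> * Re w + sin \<theta> * Im w + \<epsilon> * cmod w"
proof -
  have cover: "sphere (0::complex) 1 \<subseteq> (\<Union>u\<in>sphere 0 1. ball u \<epsilon>)" using \<epsilon> by force
  obtain S where S: "S \<subseteq> sphere 0 1" "finite S" "sphere (0::complex) 1 \<subseteq> (\<Union>u\<in>S. ball u \<epsilon>)"
    using compactE_image[OF compact_sphere open_ball cover] by blast
  have "\<exists>\<theta>\<in>Arg ` S. cmod w \<le> cos \<theta> * Re w + sin \<theta> * Im w + \<epsilon> * cmod w" for w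
  proof -
    \<comment> \<open>The value 1 at w = 0 keeps v on the unit circle and the polar form of w valid
      in all cases.\<close>
    define v where "v = (if w = 0 then 1 else sgn w)"
    have v: "w = complex_of_real (cmod w) * v"
      by (simp add: v_def sgn_div_norm scaleR_conv_of_real)
    have "v \<in> sphere 0 1" by (simp add: v_def norm_sgn)
    from subsetD[OF S(3) this] obtain u where u: "u \<in> S" "v \<in> ball u \<epsilon>" by (rule UN_E)
    have "cmod u = 1" using u(1) S(1) by auto
    then have u_cis: "u = cis (Arg u)" by (metis cis_Arg norm_zero sgn_eq zero_neq_one div_by_1 of_real_1)
    have "cos (Arg u) * Re w + sin (Arg u) * Im w = Re (cnj u * w)"
      by (subst (3) u_cis) simp
    also have "\<dots> = Re (cnj u * u * cmod w) - Re (cnj u * (u - v) * cmod w)"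
      by (subst v) (simp add: algebra_simps)
    also have "cnj u * u = 1" using \<open>cmod u = 1\<close> by (simp add: complex_norm_square[symmetric] mult.commute)
    finally have eq: "cos (Arg u) * Re w + sin (Arg u) * Im w = cmod w - Re (cnj u * (u - v) * cmod w)"
      by simp
    have "Re (cnj u * (u - v) * cmod w) \<le> cmod (cnj u * (u - v) * cmod w)" by (rule complex_Re_le_cmod)
    also have "\<dots> = cmod (u - v) * cmod w" using \<open>cmod u = 1\<close> by (simp add: norm_mult)
    also have "\<dots> \<le> \<epsilon> * cmod w"
      using u(2) by (intro mult_right_mono) (auto simp: dist_norm)
    finally have "cmod w \<le> cos (Arg u) * Re w + sin (Arg u) * Im w + \<epsilon> * cmod w"
      using eq by simp
    then show ?thesis using u(1) by blast
  qed
  moreover from this[of 0] have "Arg ` S \<noteq> {}" by blast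
  ultimately show thesis using that S(2) by blast
qed

text \<open>Separates the two roles of a finite maximum: its function dominates all the given
  functions, while its element stays below every common upper bound u of the given elements.\<close>

lemma lattice_term_upper_envelope:
  assumes "finite S" "S \<noteq> {}" "\<And>s. s \<in> S \<Longrightarrow> lattice_term N x (g s) (z s)" "\<And>s. s \<in> S \<Longrightarrow> z s \<le> u"
  shows "\<exists>m y. lattice_term N x m y \<and> y \<le> u \<and> (\<forall>v. \<forall>s\<in>S. g s v \<le> m v)"
  using assms
proof (induction S rule: finite_ne_induct)
  case (singleton s)
  then show ?case by auto
next
  case (insert s S)
  have "\<exists>m y. lattice_term N x m y \<and> y \<le> u \<and> (\<forall>v. \<forall>s\<in>S. g s v \<le> m v)"
    using insert.prems by (intro insert.IH) simp_all
  then obtain m y where m: "lattice_term N x m y" "y \<le> u" "\<And>v s. s \<in> S \<Longrightarrow> g s v \<le> m v" by blast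
  show ?case
    using lattice_term.max[OF insert.prems(1)[of s] m(1)] insert.prems(2)[of s] m(2) m(3)
    by (intro exI[of _ "\<lambda>t. max (g s t) (m t)"] exI[of _ "sup (z s) y"])
       (auto simp: le_max_iff_disj)
qed

lemma krivine_hom_min:
  "krivine_hom N x \<Phi> \<Longrightarrow> g \<in> pos_homogeneous N \<Longrightarrow> h \<in> pos_homogeneous N \<Longrightarrow>
    \<Phi> (\<lambda>t. min (g t) (h t)) = inf (\<Phi> g) (\<Phi> h)"
  unfolding krivine_hom_def by blast

lemma krivine_hom_sum:
  assumes \<Phi>: "krivine_hom N x \<Phi>" and "\<And>i. i \<in> I \<Longrightarrow> h i \<in> pos_homogeneous N"
  shows "\<Phi> (\<lambda>t. \<Sum>i\<in>I. h i t) = (\<Sum>i\<in>I. \<Phi> (h i))"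
  using assms(2)
proof (induction I rule: infinite_finite_induct)
  case (insert i I)
  then show ?case
    using krivine_hom_add[OF \<Phi>, of "h i" "\<lambda>t. \<Sum>i\<in>I. h i t"] pos_homogeneous_sum[of I h N] by simp
qed (simp_all add: krivine_hom_zero[OF \<Phi>])

lemma pos_homogeneous_lq:
  assumes "0 < q"
  shows "(\<lambda>t. (\<Sum>k<N. \<bar>t k\<bar> powr q) powr (1 / q)) \<in> pos_homogeneous N"
proof -
  have "(\<Sum>k<N. \<bar>s k\<bar> powr q) powr (1 / q) = (\<Sum>k<N. \<bar>t k\<bar> powr q) powr (1 / q)" if "\<forall>i<N. s i = t i" for s t :: "nat \<Rightarrow> real"
    using that by simp
  moreover have "(\<Sum>k<N. \<bar>c * t k\<bar> powr q) powr (1 / q) = c * (\<Sum>k<N. \<bar>t k\<bar> powr q) powr (1 / q)"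
    if "0 \<le> c" for c and t :: "nat \<Rightarrow> real"
  proof -
    have "(\<Sum>k<N. \<bar>c * t k\<bar> powr q) = c powr q * (\<Sum>k<N. \<bar>t k\<bar> powr q)"
      using that by (simp add: abs_mult powr_mult sum_distrib_left)
    then show ?thesis
      using assms that by (simp add: powr_mult sum_nonneg powr_powr)
  qed
  moreover have "continuous_on UNIV (\<lambda>t::nat \<Rightarrow> real. (\<Sum>k<N. \<bar>t k\<bar> powr q) powr (1 / q))"
    using assms
    by (intro continuous_on_powr' continuous_on_sum continuous_on_rabs continuous_on_product_coordinates
         continuous_on_const) (auto intro: sum_nonneg)
  ultimately show ?thesis unfolding pos_homogeneous_def by blast
qed

text \<open>N complex variables stored as 2N real ones, real parts in the first N slots and
  imaginary parts in the next N; a calculus at the vectors a and b, concatenated in this order, thus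
  handles the elements a + i b.\<close>

definition complex_coord :: "nat \<Rightarrow> (nat \<Rightarrow> real) \<Rightarrow> nat \<Rightarrow> complex"
  where "complex_coord N t k = Complex (t k) (t (N + k))"

lemma pos_homogeneous_compose_cmod:
  assumes "h \<in> pos_homogeneous N"
  shows "(\<lambda>t. h (\<lambda>k. cmod (complex_coord N t k))) \<in> pos_homogeneous (N + N)"
proof -
  have coord_scale: "cmod (complex_coord N (\<lambda>i. c * t i) k) = c * cmod (complex_coord N t k)" if "0 \<le> c" for c t k
  proof -
    have "complex_coord N (\<lambda>i. c * t i) k = c *\<^sub>R complex_coord N t k"
      by (simp add: complex_coord_def complex_eq_iff)
    then show ?thesis using that by simp
  qed
  have "continuous_on UNIV (\<lambda>t. cmod (complex_coord N t k))" for k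
    unfolding complex_coord_def cmod_def complex.sel
    by (intro continuous_on_real_sqrt continuous_on_add continuous_on_power continuous_on_product_coordinates)
  then have cont: "continuous_on UNIV (\<lambda>t k. cmod (complex_coord N t k))"
    by (intro continuous_on_coordinatewise_then_product)
  have "h (\<lambda>k. cmod (complex_coord N s k)) = h (\<lambda>k. cmod (complex_coord N t k))" if "\<forall>i<N+N. s i = t i" for s t
    using that by (intro pos_homogeneous_cong[OF assms]) (simp add: complex_coord_def)
  moreover have "h (\<lambda>k. cmod (complex_coord N (\<lambda>i. c * t i) k)) = c * h (\<lambda>k. cmod (complex_coord N t k))"
    if "0 \<le> c" for c t
    using pos_homogeneous_scaled[OF assms that] by (simp add: coord_scale[OF that])
  moreover have "continuous_on UNIV (\<lambda>t. h (\<lambda>k. cmod (complex_coord N t k)))"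
    by (rule continuous_on_compose2[OF pos_homogeneous_continuous[OF assms] cont]) simp
  ultimately show ?thesis unfolding pos_homogeneous_def by blast
qed

lemma pos_homogeneous_cmod_sum:
  "(\<lambda>t. cmod (\<Sum>k<N. c k * complex_coord N t k)) \<in> pos_homogeneous (N + N)"
proof -
  have "cmod (\<Sum>k<N. c k * complex_coord N (\<lambda>i. a * t i) k) = a * cmod (\<Sum>k<N. c k * complex_coord N t k)"
    if "0 \<le> a" for a t
  proof -
    have "complex_coord N (\<lambda>i. a * t i) k = complex_of_real a * complex_coord N t k" for k
      by (simp add: complex_coord_def complex_eq_iff)
    then have "(\<Sum>k<N. c k * complex_coord N (\<lambda>i. a * t i) k) = complex_of_real a * (\<Sum>k<N. c k * complex_coord N t k)"
      by (simp add: sum_distrib_left algebra_simps)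
    then show ?thesis using that by (simp add: norm_mult)
  qed
  moreover have "continuous_on UNIV (\<lambda>t. cmod (\<Sum>k<N. c k * complex_coord N t k))"
    unfolding complex_coord_def complex_eq_iff Complex_eq
    by (intro continuous_on_norm continuous_on_sum continuous_on_mult continuous_on_const
        continuous_on_add continuous_on_of_real continuous_on_product_coordinates)
  moreover have "cmod (\<Sum>k<N. c k * complex_coord N s k) = cmod (\<Sum>k<N. c k * complex_coord N t k)"
    if "\<forall>i<N+N. s i = t i" for s t
    using that by (simp add: complex_coord_def)
  ultimately show ?thesis unfolding pos_homogeneous_def by blast
qed

text \<open>The function on the right is the supremum over \<theta> of the lattice terms cos
  \<theta> Re + sin \<theta> Im. Monotonicity of \<Phi> makes its image an upper bound of their
  elements; that it is the least one needs a reduction to finitely many directions.\<close>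

lemma modulus_linear_combination:
  fixes \<iota> :: "'e::real_banach_lattice \<Rightarrow> 'y::complex_banach"
  assumes \<iota>: "complex_banach_lattice \<iota>"
    and \<Phi>: "krivine_hom (N + N) (\<lambda>j. if j < N then a j else b (j - N)) \<Phi>"
  shows "modulus \<iota> (\<Sum>k<N. c k *\<^sub>C (\<iota> (a k) + \<i> *\<^sub>C \<iota> (b k))) =
    \<Phi> (\<lambda>t. cmod (\<Sum>k<N. c k * complex_coord N t k))"
proof -
  let ?x = "\<lambda>j. if j < N then a j else b (j - N)"
  let ?f = "\<lambda>t. \<Sum>k<N. c k * complex_coord N t k"
  define A where "A = (\<Sum>k<N. Re (c k) *\<^sub>R a k - Im (c k) *\<^sub>R b k)"
  define B where "B = (\<Sum>k<N. Re (c k) *\<^sub>R b k + Im (c k) *\<^sub>R a k)"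
  have lin: "linear \<iota>" using \<iota> by (simp add: complex_banach_lattice_def)
  have "(\<Sum>k<N. c k *\<^sub>C (\<iota> (a k) + \<i> *\<^sub>C \<iota> (b k))) = \<iota> A + \<i> *\<^sub>C \<iota> B"
  proof -
    have "(\<Sum>k<N. c k *\<^sub>C (\<iota> (a k) + \<i> *\<^sub>C \<iota> (b k))) =
        (\<Sum>k<N. \<iota> (Re (c k) *\<^sub>R a k - Im (c k) *\<^sub>R b k)) +
        (\<Sum>k<N. \<i> *\<^sub>C \<iota> (Re (c k) *\<^sub>R b k + Im (c k) *\<^sub>R a k))"
      unfolding scaleC_complexification[OF lin] by (rule sum.distrib)
    also have "\<dots> = \<iota> A + \<i> *\<^sub>C \<iota> B"
      by (simp only: A_def B_def linear_sum[OF lin] scaleC_sum_right)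
    finally show ?thesis .
  qed
  moreover have "is_modulus A B (\<Phi> (\<lambda>t. cmod (?f t)))"
  proof -
    have a: "lattice_term (N + N) ?x (\<lambda>t. t k) (a k)" if "k < N" for k
      using lattice_term.coord[of k "N + N" ?x] that by simp
    have b: "lattice_term (N + N) ?x (\<lambda>t. t (N + k)) (b k)" if "k < N" for k
      using lattice_term.coord[of "N + k" "N + N" ?x] that by simp
    have ReF: "Re (?f t) = (\<Sum>k<N. Re (c k) * t k - Im (c k) * t (N + k))" for t
      by (simp add: complex_coord_def)
    have ImF: "Im (?f t) = (\<Sum>k<N. Re (c k) * t (N + k) + Im (c k) * t k)" for t
      by (simp add: complex_coord_def)
    have comb: "lattice_term (N + N) ?x (\<lambda>t. cos \<theta> * Re (?f t) + sin \<theta> * Im (?f t)) (cos \<theta> *\<^sub>R A + sin \<theta> *\<^sub>R B)" for \<theta>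
      unfolding ReF ImF A_def B_def
      by (intro lattice_term.add lattice_term.scale lattice_term_sum lattice_term_diff a b) simp_all
    note pos = pos_homogeneous_cmod_sum[of c N]
    have upper: "cos \<theta> *\<^sub>R A + sin \<theta> *\<^sub>R B \<le> \<Phi> (\<lambda>t. cmod (?f t))" for \<theta>
    proof -
      have "cos \<theta> * Re w + sin \<theta> * Im w \<le> cmod w" for w
        using complex_Re_le_cmod[of "cnj (cis \<theta>) * w"] by (simp add: norm_mult)
      then have "\<Phi> (\<lambda>t. cos \<theta> * Re (?f t) + sin \<theta> * Im (?f t)) \<le> \<Phi> (\<lambda>t. cmod (?f t))"
        by (intro krivine_hom_mono[OF \<Phi> lattice_term_pos_homogeneous[OF comb] pos])
      then show ?thesis by (simp only: krivine_hom_lattice_term[OF \<Phi> comb])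
    qed
    \<comment> \<open>The error of the finite net is relative, \<epsilon> times the modulus itself,
      so it maps to \<epsilon> times a fixed element and disappears by the Archimedean
      property.\<close>
    have least: "\<Phi> (\<lambda>t. cmod (?f t)) \<le> u" if u: "\<And>\<theta>. cos \<theta> *\<^sub>R A + sin \<theta> *\<^sub>R B \<le> u" for u
    proof (rule le_if_le_add_scaleR)
      fix \<epsilon> :: real assume \<epsilon>: "0 < \<epsilon>"
      obtain \<Theta> where \<Theta>: "finite \<Theta>" "\<Theta> \<noteq> {}"
        "\<And>w. \<exists>\<theta>\<in>\<Theta>. cmod w \<le> cos \<theta> * Re w + sin \<theta> * Im w + \<epsilon> * cmod w"
        by (rule finite_net_of_directions[OF \<epsilon>]) (rule that)
      obtain m y where m: "lattice_term (N + N) ?x m y" "y \<le> u"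
        "\<And>v \<theta>. \<theta> \<in> \<Theta> \<Longrightarrow> cos \<theta> * Re (?f v) + sin \<theta> * Im (?f v) \<le> m v"
        using lattice_term_upper_envelope[where g = "\<lambda>\<theta> t. cos \<theta> * Re (?f t) + sin \<theta> * Im (?f t)", OF \<Theta>(1,2) comb u]
        by blast
      have m': "m \<in> pos_homogeneous (N + N)" by (rule lattice_term_pos_homogeneous[OF m(1)])
      have "cmod (?f t) \<le> m t + \<epsilon> * cmod (?f t)" for t
        using \<Theta>(3)[of "?f t"] m(3)[of _ t] by (meson add_right_mono order_trans)
      then have "\<Phi> (\<lambda>t. cmod (?f t)) \<le> \<Phi> (\<lambda>t. m t + \<epsilon> * cmod (?f t))"
        by (intro krivine_hom_mono[OF \<Phi> pos] pos_homogeneous_add pos_homogeneous_scale pos m')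
      also have "\<dots> = y + \<epsilon> *\<^sub>R \<Phi> (\<lambda>t. cmod (?f t))"
        by (simp only: krivine_hom_add[OF \<Phi> m' pos_homogeneous_scale[OF pos]] krivine_hom_scale[OF \<Phi> pos]
              krivine_hom_lattice_term[OF \<Phi> m(1)])
      also have "\<dots> \<le> u + \<epsilon> *\<^sub>R \<Phi> (\<lambda>t. cmod (?f t))" using m(2) by simp
      finally show "\<Phi> (\<lambda>t. cmod (?f t)) \<le> u + \<epsilon> *\<^sub>R \<Phi> (\<lambda>t. cmod (?f t))" .
    qed
    show ?thesis
      unfolding is_modulus_def isLub_def leastP_def isUb_def setle_def setge_def
      using upper least by auto
  qed
  ultimately show ?thesis using modulus_eqI[OF \<iota>] by simp
qed

text \<open>The moduli of the y k and of all combinations of them are images under one calculus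
  \<Phi> in the real and imaginary parts. The scalar inequality is therefore an inequality between
  functions, and monotonicity of \<Phi> carries it to the lattice.\<close>

lemma q_concave_transfer:
  fixes \<iota> :: "'e::real_banach_lattice \<Rightarrow> 'y::complex_banach" and y :: "nat \<Rightarrow> 'y"
  assumes \<iota>: "complex_banach_lattice \<iota>" and q: "0 < q" and K: "0 \<le> K" and C: "0 \<le> C"
    and concave: "\<And>(N::nat) (y::nat \<Rightarrow> 'y). (\<Sum>k<N. norm (y k) powr q) powr (1 / q) \<le>
      C * norm (krivine N (\<lambda>k. modulus \<iota> (y k)) (\<lambda>t. (\<Sum>k<N. \<bar>t k\<bar> powr q) powr (1 / q)))"
    and scalar: "\<And>w::nat \<Rightarrow> complex. (\<Sum>k<N. cmod (w k) powr q) powr (1 / q) \<le>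
      K * (\<Sum>z\<in>Z. cmod (\<Sum>k<N. c z k * w k))"
  shows "(\<Sum>k<N. norm (y k) powr q) powr (1 / q) \<le> C * (K * (\<Sum>z\<in>Z. norm (\<Sum>k<N. c z k *\<^sub>C y k)))"
proof -
  have "\<forall>k. \<exists>a b. y k = \<iota> a + \<i> *\<^sub>C \<iota> b"
  proof
    fix k
    have "\<exists>!(u, v). y k = \<iota> u + \<i> *\<^sub>C \<iota> v"
      using \<iota> unfolding complex_banach_lattice_def by blast
    then show "\<exists>a b. y k = \<iota> a + \<i> *\<^sub>C \<iota> b" by auto
  qed
  then obtain a b where y: "\<And>k. y k = \<iota> (a k) + \<i> *\<^sub>C \<iota> (b k)" by metis
  obtain \<Phi> where \<Phi>: "krivine_hom (N + N) (\<lambda>j. if j < N then a j else b (j - N)) \<Phi>"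
    by (rule krivine_hom_exists)
  have mod: "modulus \<iota> (\<Sum>k<N. d k *\<^sub>C y k) = \<Phi> (\<lambda>t. cmod (\<Sum>k<N. d k * complex_coord N t k))" for d
    using modulus_linear_combination[OF \<iota> \<Phi>, of d] by (simp add: y)
  \<comment> \<open>Precomposing \<Phi> with the coordinatewise modulus yields a homomorphism based
    at the moduli; by uniqueness it computes the \<open>krivine\<close> expression that occurs in
    q-concavity.\<close>
  let ?\<Psi> = "\<lambda>h. \<Phi> (\<lambda>t. h (\<lambda>k. cmod (complex_coord N t k)))"
  let ?lq = "\<lambda>t. (\<Sum>k<N. \<bar>t k\<bar> powr q) powr (1 / q)"
  have "?\<Psi> (\<lambda>t. t j) = modulus \<iota> (y j)" if j: "j < N" for j
  proof -
    have "(\<Sum>k<N. (if k = j then 1 else 0) *\<^sub>C y k) = (\<Sum>k<N. if k = j then y k else 0)"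
      by (intro sum.cong) auto
    moreover have "(\<Sum>k<N. (if k = j then 1 else 0) * complex_coord N t k) =
        (\<Sum>k<N. if k = j then complex_coord N t k else 0)" for t
      by (intro sum.cong) auto
    ultimately show ?thesis using mod[of "\<lambda>k. if k = j then 1 else 0"] j by simp
  qed
  then have \<Psi>: "krivine_hom N (\<lambda>k. modulus \<iota> (y k)) ?\<Psi>"
    unfolding krivine_hom_def
    by (intro conjI allI impI ballI krivine_hom_add[OF \<Phi>] krivine_hom_max[OF \<Phi>] krivine_hom_min[OF \<Phi>]
          krivine_hom_scale[OF \<Phi>] pos_homogeneous_compose_cmod)
  have lin: "(\<lambda>t. K * (\<Sum>z\<in>Z. cmod (\<Sum>k<N. c z k * complex_coord N t k))) \<in> pos_homogeneous (N + N)"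
    by (intro pos_homogeneous_scale pos_homogeneous_sum pos_homogeneous_cmod_sum)
  note lq = pos_homogeneous_compose_cmod[OF pos_homogeneous_lq[OF q], of N]
  have "krivine N (\<lambda>k. modulus \<iota> (y k)) ?lq = ?\<Psi> ?lq"
    by (rule krivine_eq[OF \<Psi> pos_homogeneous_lq[OF q]])
  also have "\<dots> \<le> \<Phi> (\<lambda>t. K * (\<Sum>z\<in>Z. cmod (\<Sum>k<N. c z k * complex_coord N t k)))"
    by (rule krivine_hom_mono[OF \<Phi> lq lin]) (use scalar in simp)
  also have "\<dots> = K *\<^sub>R (\<Sum>z\<in>Z. modulus \<iota> (\<Sum>k<N. c z k *\<^sub>C y k))"
    unfolding mod krivine_hom_sum[OF \<Phi> pos_homogeneous_cmod_sum, symmetric]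
    by (rule krivine_hom_scale[OF \<Phi>]) (intro pos_homogeneous_sum pos_homogeneous_cmod_sum)
  finally have le: "krivine N (\<lambda>k. modulus \<iota> (y k)) ?lq \<le> K *\<^sub>R (\<Sum>z\<in>Z. modulus \<iota> (\<Sum>k<N. c z k *\<^sub>C y k))" .
  \<comment> \<open>The norm is monotone on the positive cone, so the smaller side has to be shown
    positive as well.\<close>
  have "0 \<le> ?\<Psi> ?lq"
    using krivine_hom_mono[OF \<Phi> pos_homogeneous_zero lq] by (simp add: krivine_hom_zero[OF \<Phi>])
  then have "0 \<le> krivine N (\<lambda>k. modulus \<iota> (y k)) ?lq"
    by (simp only: krivine_eq[OF \<Psi> pos_homogeneous_lq[OF q]])
  then have "norm (krivine N (\<lambda>k. modulus \<iota> (y k)) ?lq) \<le> norm (K *\<^sub>R (\<Sum>z\<in>Z. modulus \<iota> (\<Sum>k<N. c z k *\<^sub>C y k)))"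
    using le by (rule norm_mono_nonneg)
  also have "\<dots> \<le> K * (\<Sum>z\<in>Z. norm (modulus \<iota> (\<Sum>k<N. c z k *\<^sub>C y k)))"
    using K by (simp add: mult_left_mono norm_sum)
  finally have "norm (krivine N (\<lambda>k. modulus \<iota> (y k)) ?lq) \<le> K * (\<Sum>z\<in>Z. norm (\<Sum>k<N. c z k *\<^sub>C y k))"
    by (simp only: norm_modulus[OF \<iota>])
  then show ?thesis using concave[of y N] mult_left_mono[OF _ C] by (meson order_trans)
qed

section \<open>Homogeneous polynomials on grids of roots of unity\<close>

lemma inj_on_restrict_multi_indices: "inj_on (\<lambda>\<beta>. restrict \<beta> {..<n}) (multi_indices n)"
proof (rule inj_onI)
  fix \<alpha> \<beta> assume *: "\<alpha> \<in> multi_indices n" "\<beta> \<in> multi_indices n" "restrict \<alpha> {..<n} = restrict \<beta> {..<n}"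
  have "\<alpha> i = \<beta> i" for i
    using fun_cong[OF *(3), of i] *(1,2) by (cases "i < n") (auto simp: multi_indices_def)
  then show "\<alpha> = \<beta>" by auto
qed

definition homogeneous_indices :: "nat \<Rightarrow> nat \<Rightarrow> (nat \<Rightarrow> nat) set"
  where "homogeneous_indices n d = {\<beta> \<in> multi_indices n. (\<Sum>i<n. \<beta> i) = d}"

lemma homogeneous_indicesD:
  assumes "\<beta> \<in> homogeneous_indices n d"
  shows "\<beta> \<in> multi_indices n" "(\<Sum>i<n. \<beta> i) = d" "i < n \<Longrightarrow> \<beta> i \<le> d"
proof -
  show *: "\<beta> \<in> multi_indices n" "(\<Sum>i<n. \<beta> i) = d" using assms by (auto simp: homogeneous_indices_def)
  show "i < n \<Longrightarrow> \<beta> i \<le> d" unfolding *(2)[symmetric] by (rule member_le_sum) auto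
qed

lemma homogeneous_indices_less: "\<beta> \<in> homogeneous_indices n d \<Longrightarrow> i < n \<Longrightarrow> d < M \<Longrightarrow> \<beta> i < M"
  using homogeneous_indicesD(3) le_less_trans by blast

lemma finite_bounded_indices: "finite {\<beta> \<in> multi_indices n. \<forall>i<n. \<beta> i \<le> \<gamma> i}"
  and card_bounded_indices_le: "card {\<beta> \<in> multi_indices n. \<forall>i<n. \<beta> i \<le> \<gamma> i} \<le> (\<Prod>i<n. Suc (\<gamma> i))"
proof -
  let ?A = "{\<beta> \<in> multi_indices n. \<forall>i<n. \<beta> i \<le> \<gamma> i}"
  have inj: "inj_on (\<lambda>\<beta>. restrict \<beta> {..<n}) ?A"
    by (rule inj_on_subset[OF inj_on_restrict_multi_indices]) auto
  have sub: "(\<lambda>\<beta>. restrict \<beta> {..<n}) ` ?A \<subseteq> PiE {..<n} (\<lambda>i. {..\<gamma> i})"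
    by (rule image_subsetI) (simp add: restrict_PiE_iff)
  have fin: "finite (PiE {..<n} (\<lambda>i. {..\<gamma> i}))" by (intro finite_PiE) auto
  show "finite ?A" by (rule inj_on_finite[OF inj sub fin])
  show "card ?A \<le> (\<Prod>i<n. Suc (\<gamma> i))"
    using card_inj_on_le[OF inj sub fin] by (simp add: card_PiE)
qed

lemma finite_homogeneous_indices [simp]: "finite (homogeneous_indices n d)"
  by (rule finite_subset[OF _ finite_bounded_indices[of n "\<lambda>_. d"]])
     (auto dest: homogeneous_indicesD)

text \<open>Every index of degree \<^term>\<open>d\<close> has weight \<^term>\<open>x ^ d\<close> in the product of the
  geometric series \<open>1 / (1 - x)\<close>; the choice \<open>x = m / (n + m)\<close> is optimal for \<open>d = m\<close>.\<close>

lemma card_homogeneous_indices_le: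
  assumes "0 < m" "0 < n"
  shows "real (card (homogeneous_indices n d)) \<le> exp (real m) * (1 + real n / real m) ^ d"
proof -
  define x where "x = real m / (real n + real m)"
  have x: "0 < x" "x < 1" using assms by (simp_all add: x_def)
  let ?r = "\<lambda>\<beta>. restrict \<beta> {..<n} :: nat \<Rightarrow> nat"
  have inj: "inj_on ?r (homogeneous_indices n d)"
    by (rule inj_on_subset[OF inj_on_restrict_multi_indices]) (auto dest: homogeneous_indicesD)
  have "real (card (homogeneous_indices n d)) * x ^ d = (\<Sum>\<beta>\<in>homogeneous_indices n d. \<Prod>i<n. x ^ \<beta> i)"
    by (simp add: power_sum[symmetric] homogeneous_indicesD(2))
  also have "\<dots> = (\<Sum>\<beta>\<in>?r ` homogeneous_indices n d. \<Prod>i<n. x ^ \<beta> i)"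
    by (subst sum.reindex[OF inj]) simp
  also have "\<dots> \<le> (\<Sum>\<beta>\<in>PiE {..<n} (\<lambda>_. {..d}). \<Prod>i<n. x ^ \<beta> i)"
    using x homogeneous_indicesD(3)
    by (intro sum_mono2 finite_PiE prod_nonneg image_subsetI) (simp_all add: restrict_PiE_iff)
  also have "\<dots> = (\<Prod>i<n. \<Sum>j\<le>d. x ^ j)" by (rule prod_sum_PiE[symmetric]) auto
  also have "\<dots> \<le> (\<Prod>i<n. 1 / (1 - x))"
  proof (rule prod_mono)
    fix i assume "i \<in> {..<n}"
    have "(\<Sum>j\<le>d. x ^ j) = (1 - x ^ Suc d) / (1 - x)"
      using x by (simp add: sum_gp0)
    also have "\<dots> \<le> 1 / (1 - x)" using x by (intro divide_right_mono) auto
    finally show "0 \<le> (\<Sum>j\<le>d. x ^ j) \<and> (\<Sum>j\<le>d. x ^ j) \<le> 1 / (1 - x)"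
      using x by (auto intro: sum_nonneg)
  qed
  also have "\<dots> = (1 + real m / real n) ^ n"
    using assms by (simp add: x_def field_simps)
  also have "\<dots> \<le> exp (real m / real n) ^ n"
    by (intro power_mono exp_ge_add_one_self) auto
  also have "\<dots> = exp (real m)" using assms by (simp flip: exp_of_nat_mult)
  finally have "real (card (homogeneous_indices n d)) \<le> exp (real m) * (1 / x) ^ d"
    using x by (simp add: power_one_over field_simps)
  also have "1 / x = 1 + real n / real m" using assms by (simp add: x_def field_simps)
  finally show ?thesis .
qed

section \<open>Discrete Fourier analysis on the torus\<close>

lemma sum_roots_of_unity:
  assumes "a < M" "b < M"
  shows "(\<Sum>j<M. cis (2 * pi * real j / real M) ^ a * cnj (cis (2 * pi * real j / real M) ^ b)) =
    (if a = b then of_nat M else 0)"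
proof -
  define x where "x = (real a - real b) / real M"
  have M: "0 < M" using assms by simp
  have summand: "cis (2 * pi * real j / real M) ^ a * cnj (cis (2 * pi * real j / real M) ^ b) = cis (2 * pi * x) ^ j" for j
    by (simp add: Complex.DeMoivre cis_cnj cis_mult x_def algebra_simps diff_divide_distrib flip: complex_cnj_power)
  show ?thesis
  proof (cases "a = b")
    case True
    then show ?thesis unfolding summand by (simp add: x_def)
  next
    case False
    have "cis (2 * pi * x) \<noteq> 1"
    proof
      assume "cis (2 * pi * x) = 1"
      then have "cos (2 * pi * x) = 1" by (metis cis.simps(1) one_complex.simps(1))
      then obtain k :: int where k: "2 * pi * x = of_int k * 2 * pi" using cos_one_2pi_int by blast
      then have "x = of_int k" by simp
      then have "real a - real b = of_int k * real M" using M by (simp add: x_def field_simps)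
      then have ab: "int a - int b = k * int M"
        by (simp only: of_int_eq_iff[where 'a = real, symmetric] of_int_diff of_int_mult of_int_of_nat_eq)
      have "\<bar>int a - int b\<bar> < int M" using assms by linarith
      with ab have "\<bar>k\<bar> * int M < 1 * int M" by (simp add: abs_mult)
      then have "k = 0" by (simp only: mult_less_cancel_right) simp
      then show False using ab False by simp
    qed
    moreover have "cis (2 * pi * x) ^ M = 1"
    proof -
      have "cis (2 * pi * x) ^ M = cis (2 * pi * (of_int (int a - int b)))"
        using M by (simp add: Complex.DeMoivre x_def)
      also have "\<dots> = 1" by (rule cis_multiple_2pi) simp
      finally show ?thesis .
    qed
    ultimately show ?thesis unfolding summand using False by (simp add: geometric_sum)
  qed
qed

text \<open>A finite substitute for the torus. Averages over these points give exact orthogonality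
  of monomials as soon as M exceeds every exponent involved.\<close>

definition root_point :: "nat \<Rightarrow> nat \<Rightarrow> (nat \<Rightarrow> nat) \<Rightarrow> nat \<Rightarrow> complex"
  where "root_point n M k i = (if i < n then cis (2 * pi * real (k i) / real M) else 0)"

definition root_grid :: "nat \<Rightarrow> nat \<Rightarrow> (nat \<Rightarrow> nat) set"
  where "root_grid n M = PiE {..<n} (\<lambda>_. {..<M})"

lemma finite_root_grid [simp]: "finite (root_grid n M)"
  by (simp add: root_grid_def finite_PiE)

lemma card_root_grid: "card (root_grid n M) = M ^ n"
  by (simp add: root_grid_def card_PiE)

lemma monomials_orthogonal:
  assumes \<alpha>: "\<alpha> \<in> multi_indices n" "\<And>i. i < n \<Longrightarrow> \<alpha> i < M"
    and \<beta>: "\<beta> \<in> multi_indices n" "\<And>i. i < n \<Longrightarrow> \<beta> i < M"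
  shows "(\<Sum>k\<in>root_grid n M. monomial n (root_point n M k) \<alpha> * cnj (monomial n (root_point n M k) \<beta>)) =
    (if \<alpha> = \<beta> then of_nat (M ^ n) else 0)"
proof -
  let ?u = "\<lambda>i j. cis (2 * pi * real j / real M) ^ \<alpha> i * cnj (cis (2 * pi * real j / real M) ^ \<beta> i)"
  have "(\<Sum>k\<in>root_grid n M. monomial n (root_point n M k) \<alpha> * cnj (monomial n (root_point n M k) \<beta>)) =
      (\<Sum>k\<in>root_grid n M. \<Prod>i<n. ?u i (k i))"
    by (intro sum.cong refl) (simp add: monomial_def root_point_def prod.distrib)
  also have "\<dots> = (\<Prod>i<n. \<Sum>j<M. ?u i j)"
    unfolding root_grid_def by (rule prod_sum_PiE[symmetric]) auto
  also have "\<dots> = (\<Prod>i<n. if \<alpha> i = \<beta> i then of_nat M else 0)"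
    by (intro prod.cong refl sum_roots_of_unity) (use \<alpha> \<beta> in auto)
  also have "\<dots> = (if \<alpha> = \<beta> then of_nat (M ^ n) else 0)"
  proof (cases "\<alpha> = \<beta>")
    case False
    then obtain i where i: "\<alpha> i \<noteq> \<beta> i" by auto
    then have "i < n" using \<alpha>(1) \<beta>(1) by (force simp: multi_indices_def not_less[symmetric])
    then have "(\<Prod>i<n. if \<alpha> i = \<beta> i then of_nat M else (0::complex)) = 0"
      using i by (intro prod_zero) auto
    then show ?thesis using False by simp
  qed simp
  finally show ?thesis .
qed

lemma parseval_root_grid:
  assumes fin: "finite G" and G: "\<And>\<gamma>. \<gamma> \<in> G \<Longrightarrow> \<gamma> \<in> multi_indices n" "\<And>\<gamma> i. \<gamma> \<in> G \<Longrightarrow> i < n \<Longrightarrow> \<gamma> i < M"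
  shows "(\<Sum>k\<in>root_grid n M. (cmod (\<Sum>\<gamma>\<in>G. c \<gamma> * monomial n (root_point n M k) \<gamma>))\<^sup>2) =
    real (M ^ n) * (\<Sum>\<gamma>\<in>G. (cmod (c \<gamma>))\<^sup>2)"
proof -
  let ?m = "\<lambda>k \<gamma>. monomial n (root_point n M k) \<gamma>"
  have "complex_of_real (\<Sum>k\<in>root_grid n M. (cmod (\<Sum>\<gamma>\<in>G. c \<gamma> * ?m k \<gamma>))\<^sup>2) =
      (\<Sum>k\<in>root_grid n M. \<Sum>\<gamma>\<in>G. \<Sum>\<delta>\<in>G. c \<gamma> * cnj (c \<delta>) * (?m k \<gamma> * cnj (?m k \<delta>)))"
    unfolding of_real_sum complex_norm_square by (simp add: sum_product mult_ac)
  also have "\<dots> = (\<Sum>\<gamma>\<in>G. \<Sum>\<delta>\<in>G. c \<gamma> * cnj (c \<delta>) * (\<Sum>k\<in>root_grid n M. ?m k \<gamma> * cnj (?m k \<delta>)))"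
    unfolding sum_distrib_left by (rule trans[OF sum.swap], rule sum.cong[OF refl], rule sum.swap)
  also have "\<dots> = (\<Sum>\<gamma>\<in>G. \<Sum>\<delta>\<in>G. if \<gamma> = \<delta> then c \<gamma> * cnj (c \<gamma>) * of_nat (M ^ n) else 0)"
    by (intro sum.cong refl) (auto simp: monomials_orthogonal G)
  also have "\<dots> = (\<Sum>\<gamma>\<in>G. c \<gamma> * cnj (c \<gamma>) * of_nat (M ^ n))"
    using fin by simp
  also have "\<dots> = complex_of_real (real (M ^ n) * (\<Sum>\<gamma>\<in>G. (cmod (c \<gamma>))\<^sup>2))"
    by (simp add: complex_norm_square[symmetric] sum_distrib_left algebra_simps)
  finally show ?thesis by (simp only: of_real_eq_iff)
qed

lemma monomial_add: "monomial n z (\<lambda>i. \<alpha> i + \<beta> i) = monomial n z \<alpha> * monomial n z \<beta>"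
  by (simp add: monomial_def power_add prod.distrib)

text \<open>The square of a homogeneous polynomial of degree \<open>d\<close> has degree \<open>2 d\<close>, and an index of
  degree \<open>2 d\<close> splits in at most \<open>4\<^sup>d\<close> ways.\<close>

lemma fourth_moment_le:
  assumes M: "2 * d < M"
  shows "(\<Sum>k\<in>root_grid n M. (cmod (\<Sum>\<beta>\<in>homogeneous_indices n d. w \<beta> * monomial n (root_point n M k) \<beta>)) ^ 4) \<le>
    real (M ^ n) * 4 ^ d * (\<Sum>\<beta>\<in>homogeneous_indices n d. (cmod (w \<beta>))\<^sup>2)\<^sup>2"
proof -
  let ?B = "homogeneous_indices n d" and ?G = "homogeneous_indices n (2 * d)"
  let ?m = "\<lambda>k \<gamma>. monomial n (root_point n M k) \<gamma>"
  define plus where "plus = (\<lambda>(\<alpha>::nat \<Rightarrow> nat, \<beta>::nat \<Rightarrow> nat) i. \<alpha> i + \<beta> i)"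
  define W where "W = (\<lambda>(\<alpha>, \<beta>). w \<alpha> * w \<beta>)"
  define P where "P = (\<lambda>\<gamma>. {p \<in> ?B \<times> ?B. plus p = \<gamma>})"
  define c where "c = (\<lambda>\<gamma>. \<Sum>p\<in>P \<gamma>. W p)"
  have plus_in: "plus ` (?B \<times> ?B) \<subseteq> ?G"
    by (auto simp: plus_def homogeneous_indices_def multi_indices_def sum.distrib)
  have square: "(\<Sum>\<beta>\<in>?B. w \<beta> * ?m k \<beta>)\<^sup>2 = (\<Sum>\<gamma>\<in>?G. c \<gamma> * ?m k \<gamma>)" for k
  proof -
    have "(\<Sum>\<beta>\<in>?B. w \<beta> * ?m k \<beta>)\<^sup>2 = (\<Sum>p\<in>?B \<times> ?B. W p * ?m k (plus p))"
      unfolding power2_eq_square sum_product sum.cartesian_product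
      by (intro sum.cong refl) (auto simp: W_def plus_def monomial_add)
    also have "\<dots> = (\<Sum>\<gamma>\<in>?G. \<Sum>p\<in>P \<gamma>. W p * ?m k (plus p))"
      unfolding P_def by (rule sum.group[symmetric]) (use plus_in in auto)
    also have "\<dots> = (\<Sum>\<gamma>\<in>?G. c \<gamma> * ?m k \<gamma>)"
      by (intro sum.cong refl) (auto simp: c_def P_def sum_distrib_right)
    finally show ?thesis .
  qed
  have card_P: "real (card (P \<gamma>)) \<le> 4 ^ d" if \<gamma>: "\<gamma> \<in> ?G" for \<gamma>
  proof -
    \<comment> \<open>In a splitting \<gamma> = \<alpha> + \<beta> the first part determines the
      second and lies below \<gamma>, so splittings are counted by the indices below
      \<gamma>.\<close>
    have inj: "inj_on fst (P \<gamma>)"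
      by (rule inj_onI) (auto simp: P_def plus_def fun_eq_iff, metis add_left_cancel)
    have sub: "fst ` P \<gamma> \<subseteq> {\<beta> \<in> multi_indices n. \<forall>i<n. \<beta> i \<le> \<gamma> i}"
      by (auto simp: P_def plus_def homogeneous_indices_def)
    have "card (P \<gamma>) \<le> card {\<beta> \<in> multi_indices n. \<forall>i<n. \<beta> i \<le> \<gamma> i}"
      by (rule card_inj_on_le[OF inj sub finite_bounded_indices])
    also have "\<dots> \<le> (\<Prod>i<n. Suc (\<gamma> i))" by (rule card_bounded_indices_le)
    \<comment> \<open>Suc k is at most 2^k, and the exponents of \<gamma> add up to 2 d; hence the
      factor 4^d.\<close>
    also have "\<dots> \<le> (\<Prod>i<n. 2 ^ \<gamma> i)" by (intro prod_mono) (auto simp: Suc_le_eq)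
    also have "\<dots> = 4 ^ d"
      using homogeneous_indicesD(2)[OF \<gamma>] by (simp add: power_sum[symmetric] power_mult)
    finally show ?thesis by (metis of_nat_le_iff of_nat_numeral of_nat_power)
  qed
  have c_le: "(cmod (c \<gamma>))\<^sup>2 \<le> 4 ^ d * (\<Sum>p\<in>P \<gamma>. (cmod (W p))\<^sup>2)" if \<gamma>: "\<gamma> \<in> ?G" for \<gamma>
  proof -
    have "cmod (c \<gamma>) \<le> (\<Sum>p\<in>P \<gamma>. 1 * cmod (W p))" unfolding c_def by (simp add: norm_sum)
    then have "(cmod (c \<gamma>))\<^sup>2 \<le> (\<Sum>p\<in>P \<gamma>. 1 * cmod (W p))\<^sup>2" by (intro power_mono) auto
    also have "\<dots> \<le> (\<Sum>p\<in>P \<gamma>. 1\<^sup>2) * (\<Sum>p\<in>P \<gamma>. (cmod (W p))\<^sup>2)" by (rule Cauchy_Schwarz_ineq_sum)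
    also have "\<dots> \<le> 4 ^ d * (\<Sum>p\<in>P \<gamma>. (cmod (W p))\<^sup>2)"
    proof (rule mult_right_mono)
      have "(\<Sum>p\<in>P \<gamma>. 1\<^sup>2) = real (card (P \<gamma>))" by simp
      then show "(\<Sum>p\<in>P \<gamma>. 1\<^sup>2 :: real) \<le> 4 ^ d" using card_P[OF \<gamma>] by (simp only:)
      show "0 \<le> (\<Sum>p\<in>P \<gamma>. (cmod (W p))\<^sup>2)" by (rule sum_nonneg) simp
    qed
    finally show ?thesis .
  qed
  have "(\<Sum>k\<in>root_grid n M. (cmod (\<Sum>\<beta>\<in>?B. w \<beta> * ?m k \<beta>)) ^ 4) =
      (\<Sum>k\<in>root_grid n M. (cmod (\<Sum>\<gamma>\<in>?G. c \<gamma> * ?m k \<gamma>))\<^sup>2)"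
    unfolding square[symmetric] by (simp add: norm_power flip: power_mult)
  also have "\<dots> = real (M ^ n) * (\<Sum>\<gamma>\<in>?G. (cmod (c \<gamma>))\<^sup>2)"
    by (rule parseval_root_grid) (use M in \<open>simp_all add: homogeneous_indicesD(1) homogeneous_indices_less\<close>)
  also have "(\<Sum>\<gamma>\<in>?G. (cmod (c \<gamma>))\<^sup>2) \<le> (\<Sum>\<gamma>\<in>?G. 4 ^ d * (\<Sum>p\<in>P \<gamma>. (cmod (W p))\<^sup>2))"
    by (intro sum_mono c_le)
  also have "\<dots> = 4 ^ d * (\<Sum>p\<in>?B \<times> ?B. (cmod (W p))\<^sup>2)"
    unfolding sum_distrib_left[symmetric] P_def
    by (subst sum.group) (use plus_in in auto)
  also have "(\<Sum>p\<in>?B \<times> ?B. (cmod (W p))\<^sup>2) = (\<Sum>\<beta>\<in>?B. (cmod (w \<beta>))\<^sup>2)\<^sup>2"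
    unfolding power2_eq_square sum_product sum.cartesian_product
    by (intro sum.cong refl) (auto simp: W_def norm_mult)
  finally show ?thesis by (simp add: mult_left_mono mult.assoc)
qed

lemma square_le_interpolation:
  fixes s \<tau> :: real
  assumes "0 \<le> s" "0 < \<tau>"
  shows "s\<^sup>2 \<le> \<tau> * s + s ^ 4 / \<tau>\<^sup>2"
proof (cases "s \<le> \<tau>")
  case True
  then have "s\<^sup>2 \<le> \<tau> * s" using assms by (simp add: power2_eq_square mult_right_mono)
  then show ?thesis using assms by (simp add: add_increasing2)
next
  case False
  then have "s\<^sup>2 * \<tau>\<^sup>2 \<le> s\<^sup>2 * s\<^sup>2" using assms by (intro mult_left_mono power_mono) auto
  then have "s\<^sup>2 \<le> s ^ 4 / \<tau>\<^sup>2" using assms by (simp add: pos_le_divide_eq flip: power_add)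
  then show ?thesis using assms by (simp add: add_increasing)
qed

text \<open>The fourth moment interpolates: \<open>s\<^sup>2 \<le> \<tau> s + s\<^sup>4 / \<tau>\<^sup>2\<close> with \<open>\<tau>\<close> a multiple of the \<open>L\<^sub>2\<close>-norm.\<close>

lemma l2_norm_le_first_moment:
  assumes M: "2 * d < M"
  shows "sqrt (\<Sum>\<beta>\<in>homogeneous_indices n d. (cmod (w \<beta>))\<^sup>2) \<le> 3 * 2 ^ d / real (M ^ n) *
    (\<Sum>k\<in>root_grid n M. cmod (\<Sum>\<beta>\<in>homogeneous_indices n d. w \<beta> * monomial n (root_point n M k) \<beta>))"
proof -
  let ?B = "homogeneous_indices n d"
  define f where "f = (\<lambda>k. cmod (\<Sum>\<beta>\<in>?B. w \<beta> * monomial n (root_point n M k) \<beta>))"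
  define S where "S = (\<Sum>\<beta>\<in>?B. (cmod (w \<beta>))\<^sup>2)"
  define V where "V = real (M ^ n)"
  define E where "E = (\<Sum>k\<in>root_grid n M. f k)"
  have S: "0 \<le> S" unfolding S_def by (intro sum_nonneg) auto
  have E: "0 \<le> E" unfolding E_def f_def by (intro sum_nonneg) auto
  have V: "0 < V" using M by (simp add: V_def)
  have "sqrt S \<le> 3 * 2 ^ d / V * E"
  proof (cases "S = 0")
    case True
    then show ?thesis using E V by simp
  next
    case False
    then have Sp: "0 < S" using S by simp
    \<comment> \<open>Chosen so that the fourth-moment term becomes a quarter of V S. What remains
      is 3/4 V S \<le> \<tau> E, giving the constant 8/3, which is rounded up to 3.\<close>
    define \<tau> where "\<tau> = 2 * 2 ^ d * sqrt S"
    have \<tau>: "0 < \<tau>" using Sp by (simp add: \<tau>_def)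
    have \<tau>2: "\<tau>\<^sup>2 = 4 * 4 ^ d * S"
      using S by (simp add: \<tau>_def power_mult_distrib power_mult[symmetric] mult.commute[of d 2])
         (simp add: power_mult)
    have "V * S = (\<Sum>k\<in>root_grid n M. (f k)\<^sup>2)"
      unfolding V_def S_def f_def
      by (rule parseval_root_grid[symmetric]) (use M in \<open>simp_all add: homogeneous_indicesD(1) homogeneous_indices_less\<close>)
    also have "\<dots> \<le> (\<Sum>k\<in>root_grid n M. \<tau> * f k + f k ^ 4 / \<tau>\<^sup>2)"
      using \<tau> by (intro sum_mono square_le_interpolation) (auto simp: f_def)
    also have "\<dots> = \<tau> * E + (\<Sum>k\<in>root_grid n M. f k ^ 4) / \<tau>\<^sup>2"
      by (simp add: sum.distrib E_def sum_distrib_left sum_divide_distrib)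
    also have "(\<Sum>k\<in>root_grid n M. f k ^ 4) \<le> V * 4 ^ d * S\<^sup>2"
      unfolding V_def S_def f_def by (rule fourth_moment_le[OF M])
    also have "V * 4 ^ d * S\<^sup>2 / \<tau>\<^sup>2 = V * S / 4"
      unfolding \<tau>2 using Sp by (simp add: power2_eq_square)
    finally have "V * S \<le> \<tau> * E + V * S / 4" using \<tau> by (simp add: divide_right_mono)
    then have "3 * (V * S) \<le> 4 * (\<tau> * E)" by simp
    have "sqrt S * (3 * (V * sqrt S)) = 3 * (V * (sqrt S)\<^sup>2)" by (simp only: power2_eq_square ac_simps)
    also have "\<dots> \<le> 4 * (\<tau> * E)" using \<open>3 * (V * S) \<le> 4 * (\<tau> * E)\<close> S by simp
    also have "\<dots> = sqrt S * (8 * 2 ^ d * E)" by (simp add: \<tau>_def)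
    finally have "sqrt S * (3 * (V * sqrt S)) \<le> sqrt S * (8 * 2 ^ d * E)" .
    then have "3 * (V * sqrt S) \<le> 8 * 2 ^ d * E" using Sp by simp
    also have "\<dots> \<le> 9 * 2 ^ d * E" using E by (intro mult_right_mono) auto
    finally have "V * sqrt S \<le> 3 * 2 ^ d * E" by (simp add: mult_ac)
    then show ?thesis using V by (simp add: pos_le_divide_eq mult.commute)
  qed
  then show ?thesis by (simp add: S_def V_def E_def f_def)
qed

lemma lq_norm_le_l2_norm:
  fixes a :: "'i \<Rightarrow> real"
  assumes q: "2 \<le> q" and fin: "finite I" and a: "\<And>i. i \<in> I \<Longrightarrow> 0 \<le> a i"
  shows "(\<Sum>i\<in>I. a i powr q) powr (1 / q) \<le> sqrt (\<Sum>i\<in>I. (a i)\<^sup>2)"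
proof -
  define s where "s = sqrt (\<Sum>i\<in>I. (a i)\<^sup>2)"
  have s2: "s\<^sup>2 = (\<Sum>i\<in>I. (a i)\<^sup>2)" unfolding s_def by (simp add: sum_nonneg)
  have s: "0 \<le> s" unfolding s_def by (simp add: sum_nonneg)
  have le: "a i \<le> s" if "i \<in> I" for i
    unfolding s_def using that fin by (intro real_le_rsqrt member_le_sum) auto
  have summand: "a i powr q \<le> s powr (q - 2) * (a i)\<^sup>2" if i: "i \<in> I" for i
  proof -
    have "a i powr q = a i powr (q - 2) * a i powr 2" by (simp flip: powr_add)
    also have "\<dots> \<le> s powr (q - 2) * a i powr 2"
      using q a[OF i] le[OF i] by (intro mult_right_mono powr_mono2) auto
    finally show ?thesis using a[OF i] by (simp add: powr_numeral)
  qed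
  have "(\<Sum>i\<in>I. a i powr q) \<le> s powr (q - 2) * s\<^sup>2"
    unfolding s2 sum_distrib_left by (intro sum_mono summand)
  also have "s\<^sup>2 = s powr 2" using s by (simp add: powr_numeral)
  also have "s powr (q - 2) * s powr 2 = s powr q" by (simp flip: powr_add)
  finally have "(\<Sum>i\<in>I. a i powr q) powr (1 / q) \<le> (s powr q) powr (1 / q)"
    using q by (intro powr_mono2 sum_nonneg) auto
  also have "\<dots> = s" using q s by (simp add: powr_powr)
  finally show ?thesis by (simp add: s_def)
qed

section \<open>Summing operators and homogeneous polynomials\<close>

text \<open>Hoelder's inequality against the constant 1, obtained as Jensen's inequality for the
  convex function \<open>x powr p\<close>. Zero terms are discarded separately by passing to the
  support.\<close>

lemma sum_le_card_powr_mult_pos: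
  fixes a :: "'i \<Rightarrow> real"
  assumes p: "1 \<le> p" and fin: "finite I" and a: "\<And>i. i \<in> I \<Longrightarrow> 0 < a i"
  shows "sum a I \<le> real (card I) powr (1 - 1 / p) * (\<Sum>i\<in>I. a i powr p) powr (1 / p)"
proof (cases "I = {}")
  case False
  define N where "N = real (card I)"
  have N: "0 < N" using False fin by (simp add: N_def card_gt_0_iff)
  have "(\<Sum>i\<in>I. (1 / N) *\<^sub>R a i) powr p \<le> (\<Sum>i\<in>I. (1 / N) * a i powr p)"
    by (rule convex_on_sum[OF fin False powr_convex[OF p]]) (use N a in \<open>simp_all add: N_def\<close>)
  then have "(sum a I / N) powr p \<le> (\<Sum>i\<in>I. a i powr p) / N"
    by (simp add: sum_divide_distrib)
  then have "((sum a I / N) powr p) powr (1 / p) \<le> ((\<Sum>i\<in>I. a i powr p) / N) powr (1 / p)"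
    using p by (intro powr_mono2) auto
  moreover have "0 \<le> sum a I" using a by (intro sum_nonneg) (auto intro: less_imp_le)
  ultimately have "sum a I / N \<le> (\<Sum>i\<in>I. a i powr p) powr (1 / p) / N powr (1 / p)"
    using p N by (simp add: powr_powr powr_divide sum_nonneg)
  then have "sum a I \<le> N * ((\<Sum>i\<in>I. a i powr p) powr (1 / p) / N powr (1 / p))"
    using N by (simp add: pos_divide_le_eq mult.commute)
  also have "\<dots> = N powr (1 - 1 / p) * (\<Sum>i\<in>I. a i powr p) powr (1 / p)"
    using N by (simp add: powr_diff)
  finally show ?thesis by (simp add: N_def)
qed simp

lemma sum_le_card_powr_mult:
  fixes a :: "'i \<Rightarrow> real"
  assumes p: "1 \<le> p" and fin: "finite I" and a: "\<And>i. i \<in> I \<Longrightarrow> 0 \<le> a i"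
  shows "sum a I \<le> real (card I) powr (1 - 1 / p) * (\<Sum>i\<in>I. a i powr p) powr (1 / p)"
proof -
  let ?J = "{i \<in> I. 0 < a i}"
  have "sum a I = sum a ?J"
    using a by (intro sum.mono_neutral_right fin) (auto simp: not_less intro: antisym)
  also have "\<dots> \<le> real (card ?J) powr (1 - 1 / p) * (\<Sum>i\<in>?J. a i powr p) powr (1 / p)"
    using p fin by (intro sum_le_card_powr_mult_pos) auto
  also have "\<dots> \<le> real (card I) powr (1 - 1 / p) * (\<Sum>i\<in>I. a i powr p) powr (1 / p)"
    using p fin by (intro mult_mono powr_mono2 sum_nonneg sum_mono2) (auto intro: card_mono)
  finally show ?thesis .
qed

text \<open>The scalar chain is: \<ell>q-norm below \<ell>2-norm (here q \<ge> 2 enters), and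
  \<ell>2-norm below the grid average of the modulus. It is lifted by
  \<open>q_concave_transfer\<close>; the enumeration e is needed because concavity speaks of
  families indexed by an initial segment.\<close>

lemma lq_sum_homogeneous_le:
  fixes \<iota> :: "'e::real_banach_lattice \<Rightarrow> 'y::complex_banach" and y :: "(nat \<Rightarrow> nat) \<Rightarrow> 'y"
  assumes \<iota>: "complex_banach_lattice \<iota>" and q: "2 \<le> q" and C: "0 \<le> C"
    and concave: "\<And>(N::nat) (y::nat \<Rightarrow> 'y). (\<Sum>k<N. norm (y k) powr q) powr (1 / q) \<le>
      C * norm (krivine N (\<lambda>k. modulus \<iota> (y k)) (\<lambda>t. (\<Sum>k<N. \<bar>t k\<bar> powr q) powr (1 / q)))"
    and M: "2 * d < M"
  shows "(\<Sum>\<beta>\<in>homogeneous_indices n d. norm (y \<beta>) powr q) powr (1 / q) \<le>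
    C * (3 * 2 ^ d / real (M ^ n) * (\<Sum>k\<in>root_grid n M.
      norm (\<Sum>\<beta>\<in>homogeneous_indices n d. monomial n (root_point n M k) \<beta> *\<^sub>C y \<beta>)))"
proof -
  let ?B = "homogeneous_indices n d"
  define N where "N = card ?B"
  obtain e where e: "bij_betw e {..<N} ?B"
    using ex_bij_betw_nat_finite[OF finite_homogeneous_indices, of n d] by (auto simp: N_def atLeast0LessThan)
  let ?c = "\<lambda>k j. monomial n (root_point n M k) (e j)"
  let ?K = "3 * 2 ^ d / real (M ^ n)"
  have "(\<Sum>j<N. cmod (w j) powr q) powr (1 / q) \<le> ?K * (\<Sum>k\<in>root_grid n M. cmod (\<Sum>j<N. ?c k j * w j))"
    for w :: "nat \<Rightarrow> complex"
  proof -
    define v where "v = (\<lambda>\<beta>. w (inv_into {..<N} e \<beta>))"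
    have v: "v (e j) = w j" if "j < N" for j
      using e that by (simp add: v_def bij_betw_def)
    have "(\<Sum>j<N. cmod (w j) powr q) = (\<Sum>j<N. cmod (v (e j)) powr q)"
      by (intro sum.cong) (auto simp: v)
    also have "\<dots> = (\<Sum>\<beta>\<in>?B. cmod (v \<beta>) powr q)" by (rule sum.reindex_bij_betw[OF e])
    finally have lhs: "(\<Sum>j<N. cmod (w j) powr q) = (\<Sum>\<beta>\<in>?B. cmod (v \<beta>) powr q)" .
    have "(\<Sum>j<N. ?c k j * w j) = (\<Sum>j<N. v (e j) * ?c k j)" for k
      by (intro sum.cong) (auto simp: v mult.commute)
    also have "(\<Sum>j<N. v (e j) * ?c k j) = (\<Sum>\<beta>\<in>?B. v \<beta> * monomial n (root_point n M k) \<beta>)" for k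
      by (rule sum.reindex_bij_betw[OF e, of "\<lambda>\<beta>. v \<beta> * monomial n (root_point n M k) \<beta>"])
    finally have rhs: "(\<Sum>j<N. ?c k j * w j) = (\<Sum>\<beta>\<in>?B. v \<beta> * monomial n (root_point n M k) \<beta>)" for k .
    show ?thesis
      unfolding lhs rhs
      using lq_norm_le_l2_norm[OF q finite_homogeneous_indices[of n d], of "\<lambda>\<beta>. cmod (v \<beta>)"]
        l2_norm_le_first_moment[OF M, where w = v and n = n]
      by simp
  qed
  then have "(\<Sum>j<N. norm (y (e j)) powr q) powr (1 / q) \<le>
      C * (?K * (\<Sum>k\<in>root_grid n M. norm (\<Sum>j<N. ?c k j *\<^sub>C y (e j))))"
    using q C by (intro q_concave_transfer[OF \<iota> _ _ _ concave]) auto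
  moreover have "(\<Sum>j<N. norm (y (e j)) powr q) = (\<Sum>\<beta>\<in>?B. norm (y \<beta>) powr q)"
    by (rule sum.reindex_bij_betw[OF e])
  moreover have "(\<Sum>j<N. ?c k j *\<^sub>C y (e j)) = (\<Sum>\<beta>\<in>?B. monomial n (root_point n M k) \<beta> *\<^sub>C y \<beta>)" for k
    by (rule sum.reindex_bij_betw[OF e, of "\<lambda>\<beta>. monomial n (root_point n M k) \<beta> *\<^sub>C y \<beta>"])
  ultimately show ?thesis by simp
qed

section \<open>Partial derivatives of homogeneous polynomials\<close>

definition hom_poly :: "nat \<Rightarrow> nat \<Rightarrow> ((nat \<Rightarrow> nat) \<Rightarrow> 'a::complex_banach) \<Rightarrow> (nat \<Rightarrow> complex) \<Rightarrow> 'a"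
  where "hom_poly n m a z = (\<Sum>\<alpha>\<in>homogeneous_indices n m. monomial n z \<alpha> *\<^sub>C a \<alpha>)"

definition raise_index :: "nat \<Rightarrow> (nat \<Rightarrow> nat) \<Rightarrow> nat \<Rightarrow> nat"
  where "raise_index l \<beta> = \<beta>(l := Suc (\<beta> l))"

text \<open>The coefficients of the partial derivative with respect to the \<open>l\<close>-th variable.\<close>

definition pd_coeff :: "nat \<Rightarrow> ((nat \<Rightarrow> nat) \<Rightarrow> 'a::complex_banach) \<Rightarrow> (nat \<Rightarrow> nat) \<Rightarrow> 'a"
  where "pd_coeff l a \<beta> = of_nat (Suc (\<beta> l)) *\<^sub>C a (raise_index l \<beta>)"

lemma hom_poly_scale: "hom_poly n m a (\<lambda>i. c * z i) = c ^ m *\<^sub>C hom_poly n m a z"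
proof -
  have "monomial n (\<lambda>i. c * z i) \<alpha> = c ^ m * monomial n z \<alpha>" if "\<alpha> \<in> homogeneous_indices n m" for \<alpha>
    using homogeneous_indicesD(2)[OF that]
    by (simp add: monomial_def power_mult_distrib prod.distrib power_sum[symmetric])
  then show ?thesis by (simp add: hom_poly_def scaleC_sum_right scaleC_scaleC)
qed

lemma raise_index_bij_betw:
  assumes "l < n"
  shows "bij_betw (raise_index l) (homogeneous_indices n d) {\<alpha> \<in> homogeneous_indices n (Suc d). 0 < \<alpha> l}"
proof (rule bij_betw_byWitness[where f' = "\<lambda>\<alpha>. \<alpha>(l := \<alpha> l - 1)"])
  have upd: "(\<Sum>i<n. (\<alpha>(l := v)) i) + \<alpha> l = (\<Sum>i<n. \<alpha> i) + v" for \<alpha> :: "nat \<Rightarrow> nat" and v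
  proof -
    have "(\<Sum>i<n. (\<alpha>(l := v)) i) = v + (\<Sum>i\<in>{..<n} - {l}. \<alpha> i)"
      using assms by (subst sum.remove[of _ l]) auto
    moreover have "(\<Sum>i<n. \<alpha> i) = \<alpha> l + (\<Sum>i\<in>{..<n} - {l}. \<alpha> i)"
      using assms by (subst sum.remove[of _ l]) auto
    ultimately show ?thesis by simp
  qed
  show "raise_index l ` homogeneous_indices n d \<subseteq> {\<alpha> \<in> homogeneous_indices n (Suc d). 0 < \<alpha> l}"
  proof (rule image_subsetI)
    fix \<beta> assume \<beta>: "\<beta> \<in> homogeneous_indices n d"
    then have "(\<Sum>i<n. raise_index l \<beta> i) = Suc d"
      using upd[of \<beta> "Suc (\<beta> l)"] homogeneous_indicesD(2)[OF \<beta>] by (simp add: raise_index_def)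
    then show "raise_index l \<beta> \<in> {\<alpha> \<in> homogeneous_indices n (Suc d). 0 < \<alpha> l}"
      using homogeneous_indicesD(1)[OF \<beta>] assms
      by (simp add: raise_index_def homogeneous_indices_def multi_indices_def)
  qed
  show "(\<lambda>\<alpha>. \<alpha>(l := \<alpha> l - 1)) ` {\<alpha> \<in> homogeneous_indices n (Suc d). 0 < \<alpha> l} \<subseteq> homogeneous_indices n d"
  proof (rule image_subsetI)
    fix \<alpha> assume \<alpha>: "\<alpha> \<in> {\<alpha> \<in> homogeneous_indices n (Suc d). 0 < \<alpha> l}"
    then have "(\<Sum>i<n. (\<alpha>(l := \<alpha> l - 1)) i) = d"
      using upd[of \<alpha> "\<alpha> l - 1"] by (auto simp: homogeneous_indices_def)
    then show "\<alpha>(l := \<alpha> l - 1) \<in> homogeneous_indices n d"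
      using \<alpha> assms by (auto simp: homogeneous_indices_def multi_indices_def)
  qed
qed (auto simp: raise_index_def)

text \<open>On the line z + t w a monomial is an ordinary polynomial in t. Its coefficient of t is
  its derivative at 0, that is, the derivative of the monomial at z in the direction w.\<close>

lemma poly_line_monomial:
  fixes z w :: "nat \<Rightarrow> complex" and n :: nat
  defines "p \<equiv> \<lambda>\<alpha>. \<Prod>i<n. [:z i, w i:] ^ \<alpha> i"
  shows "poly (p \<alpha>) t = monomial n (\<lambda>i. z i + t * w i) \<alpha>"
    and "degree (p \<alpha>) \<le> (\<Sum>i<n. \<alpha> i)"
    and "coeff (p \<alpha>) 1 = (\<Sum>l<n. of_nat (\<alpha> l) * w l * monomial n z (\<alpha>(l := \<alpha> l - 1)))"
proof -
  show "poly (p \<alpha>) t = monomial n (\<lambda>i. z i + t * w i) \<alpha>"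
    by (simp add: p_def monomial_def poly_prod poly_power)
  have "degree (p \<alpha>) \<le> (\<Sum>i<n. degree ([:z i, w i:] ^ \<alpha> i))"
    unfolding p_def using degree_prod_sum_le[of "{..<n}" "\<lambda>i. [:z i, w i:] ^ \<alpha> i"] by (simp add: comp_def)
  also have "\<dots> \<le> (\<Sum>i<n. \<alpha> i)"
  proof (rule sum_mono)
    fix i
    have "degree ([:z i, w i:] ^ \<alpha> i) \<le> degree [:z i, w i:] * \<alpha> i" by (rule degree_power_le)
    also have "\<dots> \<le> 1 * \<alpha> i" by (intro mult_right_mono) auto
    finally show "degree ([:z i, w i:] ^ \<alpha> i) \<le> \<alpha> i" by simp
  qed
  finally show "degree (p \<alpha>) \<le> (\<Sum>i<n. \<alpha> i)" .
  have "coeff (p \<alpha>) 1 = poly (pderiv (p \<alpha>)) 0" by (simp add: poly_0_coeff_0 coeff_pderiv)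
  also have "\<dots> = (\<Sum>l<n. (\<Prod>i\<in>{..<n} - {l}. z i ^ \<alpha> i) * (of_nat (\<alpha> l) * (z l ^ (\<alpha> l - 1) * w l)))"
    unfolding p_def pderiv_prod
    by (simp add: poly_sum poly_prod poly_power pderiv_power pderiv_pCons mult_ac)
  also have "\<dots> = (\<Sum>l<n. of_nat (\<alpha> l) * w l * monomial n z (\<alpha>(l := \<alpha> l - 1)))"
  proof (rule sum.cong[OF refl])
    fix l assume l: "l \<in> {..<n}"
    have "monomial n z (\<alpha>(l := \<alpha> l - 1)) = z l ^ (\<alpha> l - 1) * (\<Prod>i\<in>{..<n} - {l}. z i ^ \<alpha> i)"
      unfolding monomial_def using l by (subst prod.remove[of _ l]) auto
    then show "(\<Prod>i\<in>{..<n} - {l}. z i ^ \<alpha> i) * (of_nat (\<alpha> l) * (z l ^ (\<alpha> l - 1) * w l)) =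
      of_nat (\<alpha> l) * w l * monomial n z (\<alpha>(l := \<alpha> l - 1))" by (simp add: mult_ac)
  qed
  finally show "coeff (p \<alpha>) 1 = (\<Sum>l<n. of_nat (\<alpha> l) * w l * monomial n z (\<alpha>(l := \<alpha> l - 1)))" .
qed

text \<open>Cauchy's coefficient formula in discrete form, exact because all exponents stay below L
  and cannot alias.\<close>

lemma coeff_eq_root_average:
  fixes p :: "complex poly"
  assumes "degree p < L" "j < L"
  shows "(\<Sum>s<L. cnj (cis (2 * pi * real s / real L) ^ j) * poly p (cis (2 * pi * real s / real L))) = of_nat L * coeff p j"
proof -
  let ?\<omega> = "\<lambda>s. cis (2 * pi * real s / real L)"
  have "(\<Sum>s<L. cnj (?\<omega> s ^ j) * poly p (?\<omega> s)) = (\<Sum>s<L. \<Sum>i\<le>degree p. coeff p i * (?\<omega> s ^ i * cnj (?\<omega> s ^ j)))"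
    by (simp add: poly_altdef sum_distrib_left mult_ac)
  also have "\<dots> = (\<Sum>i\<le>degree p. coeff p i * (\<Sum>s<L. ?\<omega> s ^ i * cnj (?\<omega> s ^ j)))"
    by (subst sum.swap) (simp add: sum_distrib_left)
  also have "\<dots> = (\<Sum>i\<le>degree p. coeff p i * (if i = j then of_nat L else 0))"
    by (intro sum.cong refl) (subst sum_roots_of_unity, use assms in auto)
  also have "\<dots> = (\<Sum>i\<le>degree p. if i = j then coeff p j * of_nat L else 0)"
    by (intro sum.cong) auto
  also have "\<dots> = of_nat L * coeff p j" by (auto simp: coeff_eq_0)
  finally show ?thesis .
qed

text \<open>The coefficient formula applied to P(z + t w). The number L of roots exceeds the degree
  \<open>Suc d\<close> in t, so the coefficient of t is recovered without error.\<close>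

lemma derivative_as_average:
  fixes a :: "(nat \<Rightarrow> nat) \<Rightarrow> 'a::complex_banach" and d :: nat
  defines "L \<equiv> Suc (Suc (Suc d))"
  shows "of_nat L *\<^sub>C (\<Sum>l<n. w l *\<^sub>C hom_poly n d (pd_coeff l a) z) =
    (\<Sum>s<L. cnj (cis (2 * pi * real s / real L)) *\<^sub>C
      hom_poly n (Suc d) a (\<lambda>i. z i + cis (2 * pi * real s / real L) * w i))"
proof -
  let ?\<omega> = "\<lambda>s. cis (2 * pi * real s / real L)"
  let ?p = "\<lambda>\<alpha>. \<Prod>i<n. [:z i, w i:] ^ \<alpha> i"
  have "(\<Sum>s<L. cnj (?\<omega> s) *\<^sub>C hom_poly n (Suc d) a (\<lambda>i. z i + ?\<omega> s * w i)) =
      (\<Sum>s<L. \<Sum>\<alpha>\<in>homogeneous_indices n (Suc d). (cnj (?\<omega> s ^ 1) * poly (?p \<alpha>) (?\<omega> s)) *\<^sub>C a \<alpha>)"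
    by (simp add: hom_poly_def scaleC_sum_right scaleC_scaleC poly_line_monomial(1))
  also have "\<dots> = (\<Sum>\<alpha>\<in>homogeneous_indices n (Suc d). (\<Sum>s<L. cnj (?\<omega> s ^ 1) * poly (?p \<alpha>) (?\<omega> s)) *\<^sub>C a \<alpha>)"
    by (subst sum.swap) (simp add: scaleC_sum_left)
  also have "\<dots> = (\<Sum>\<alpha>\<in>homogeneous_indices n (Suc d). (of_nat L * coeff (?p \<alpha>) 1) *\<^sub>C a \<alpha>)"
  proof (rule sum.cong[OF refl])
    fix \<alpha> assume \<alpha>: "\<alpha> \<in> homogeneous_indices n (Suc d)"
    have "degree (?p \<alpha>) < L"
      using poly_line_monomial(2)[where z = z and w = w and n = n and \<alpha> = \<alpha>] homogeneous_indicesD(2)[OF \<alpha>] by (simp add: L_def)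
    then show "(\<Sum>s<L. cnj (?\<omega> s ^ 1) * poly (?p \<alpha>) (?\<omega> s)) *\<^sub>C a \<alpha> = (of_nat L * coeff (?p \<alpha>) 1) *\<^sub>C a \<alpha>"
      by (subst coeff_eq_root_average) (simp_all add: L_def)
  qed
  also have "\<dots> = of_nat L *\<^sub>C (\<Sum>\<alpha>\<in>homogeneous_indices n (Suc d).
      (\<Sum>l<n. of_nat (\<alpha> l) * w l * monomial n z (\<alpha>(l := \<alpha> l - 1))) *\<^sub>C a \<alpha>)"
    by (simp only: poly_line_monomial(3) scaleC_sum_right scaleC_scaleC)
  also have "(\<Sum>\<alpha>\<in>homogeneous_indices n (Suc d).
      (\<Sum>l<n. of_nat (\<alpha> l) * w l * monomial n z (\<alpha>(l := \<alpha> l - 1))) *\<^sub>C a \<alpha>) =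
    (\<Sum>l<n. \<Sum>\<alpha>\<in>homogeneous_indices n (Suc d). (of_nat (\<alpha> l) * w l * monomial n z (\<alpha>(l := \<alpha> l - 1))) *\<^sub>C a \<alpha>)"
    unfolding scaleC_sum_left by (rule sum.swap)
  also have "\<dots> = (\<Sum>l<n. w l *\<^sub>C hom_poly n d (pd_coeff l a) z)"
  proof (rule sum.cong[OF refl])
    fix l assume "l \<in> {..<n}"
    then have l: "l < n" by simp
    let ?g = "\<lambda>\<alpha>. (of_nat (\<alpha> l) * w l * monomial n z (\<alpha>(l := \<alpha> l - 1))) *\<^sub>C a \<alpha>"
    have "(\<Sum>\<alpha>\<in>homogeneous_indices n (Suc d). ?g \<alpha>) = (\<Sum>\<alpha>\<in>{\<alpha> \<in> homogeneous_indices n (Suc d). 0 < \<alpha> l}. ?g \<alpha>)"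
      by (rule sum.mono_neutral_right) auto
    also have "\<dots> = (\<Sum>\<beta>\<in>homogeneous_indices n d. ?g (raise_index l \<beta>))"
      by (rule sum.reindex_bij_betw[OF raise_index_bij_betw[OF l], symmetric])
    also have "\<dots> = w l *\<^sub>C hom_poly n d (pd_coeff l a) z"
      unfolding hom_poly_def scaleC_sum_right
      by (intro sum.cong refl) (simp add: raise_index_def pd_coeff_def scaleC_scaleC mult_ac)
    finally show "(\<Sum>\<alpha>\<in>homogeneous_indices n (Suc d). ?g \<alpha>) = w l *\<^sub>C hom_poly n d (pd_coeff l a) z" .
  qed
  finally show ?thesis by simp
qed

text \<open>The points z + \<omega> w have coordinates of modulus at most 2; division by 3 moves
  them into the open polydisc, where B is available, and homogeneity returns the factor
  3^(d+1).\<close>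

lemma norm_derivative_le:
  fixes a :: "(nat \<Rightarrow> nat) \<Rightarrow> 'a::complex_banach"
  assumes B: "\<And>z. z \<in> cspace n \<Longrightarrow> (\<And>i. i < n \<Longrightarrow> cmod (z i) < 1) \<Longrightarrow> norm (hom_poly n (Suc d) a z) \<le> B"
    and z: "z \<in> cspace n" "\<And>i. i < n \<Longrightarrow> cmod (z i) \<le> 1"
    and w: "w \<in> cspace n" "\<And>i. i < n \<Longrightarrow> cmod (w i) \<le> 1"
  shows "norm (\<Sum>l<n. w l *\<^sub>C hom_poly n d (pd_coeff l a) z) \<le> 3 ^ Suc d * B"
proof -
  define L where "L = Suc (Suc (Suc d))"
  let ?\<omega> = "\<lambda>s. cis (2 * pi * real s / real L)"
  let ?D = "\<Sum>l<n. w l *\<^sub>C hom_poly n d (pd_coeff l a) z"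
  have point: "norm (hom_poly n (Suc d) a (\<lambda>i. z i + ?\<omega> s * w i)) \<le> 3 ^ Suc d * B" for s
  proof -
    let ?v = "\<lambda>i. (z i + ?\<omega> s * w i) / 3"
    have "hom_poly n (Suc d) a (\<lambda>i. z i + ?\<omega> s * w i) = 3 ^ Suc d *\<^sub>C hom_poly n (Suc d) a ?v"
    proof -
      have "(\<lambda>i. z i + ?\<omega> s * w i) = (\<lambda>i. 3 * ?v i)"
        by (rule ext) (simp add: field_simps)
      then show ?thesis using hom_poly_scale[of n "Suc d" a 3 ?v] by (simp only:)
    qed
    moreover have "norm (hom_poly n (Suc d) a ?v) \<le> B"
    proof (rule B)
      show "?v \<in> cspace n" using z(1) w(1) by (simp add: cspace_def)
      fix i assume i: "i < n"
      have "cmod (z i + ?\<omega> s * w i) \<le> cmod (z i) + cmod (w i)"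
        using norm_triangle_ineq[of "z i" "?\<omega> s * w i"] by (simp add: norm_mult)
      then have "cmod (z i + ?\<omega> s * w i) \<le> 2" using z(2)[OF i] w(2)[OF i] by simp
      then show "cmod (?v i) < 1" by (simp add: norm_divide)
    qed
    ultimately show ?thesis by (simp add: norm_scaleC norm_power mult_left_mono del: power_Suc)
  qed
  have "real L * norm ?D = norm (of_nat L *\<^sub>C ?D)" by (simp add: norm_scaleC)
  also have "\<dots> = norm (\<Sum>s<L. cnj (?\<omega> s) *\<^sub>C hom_poly n (Suc d) a (\<lambda>i. z i + ?\<omega> s * w i))"
    unfolding L_def derivative_as_average ..
  also have "\<dots> \<le> (\<Sum>s<L. 3 ^ Suc d * B)"
    using point by (intro order_trans[OF norm_sum] sum_mono) (simp add: norm_scaleC del: power_Suc)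
  also have "\<dots> = real L * (3 ^ Suc d * B)" by simp
  finally show ?thesis by (simp add: L_def del: power_Suc of_nat_Suc)
qed

text \<open>For each functional \<phi>, weights that cancel the phases turn the sum of the
  |\<phi>(Q_l)| into \<phi> of a single directional derivative, bounded independently of \<phi>.
  Passing from the \<ell>r-sum of the norms to their sum costs
  \<open>n powr (1 - 1 / r)\<close>.\<close>

lemma summing_derivative_le:
  fixes T :: "'x::complex_banach \<Rightarrow> 'y::complex_banach"
  assumes r: "1 \<le> r" and C: "0 \<le> C"
    and summing: "\<And>(N::nat) (x::nat \<Rightarrow> 'x). (\<Sum>k<N. norm (T (x k)) powr r) powr (1 / r) \<le>
      C * (SUP \<phi>\<in>{\<phi>::'x \<Rightarrow> complex. bounded_clinear \<phi> \<and> onorm \<phi> < 1}. (\<Sum>k<N. cmod (\<phi> (x k)) powr 1) powr (1 / 1))"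
    and B: "\<And>z. z \<in> cspace n \<Longrightarrow> (\<And>i. i < n \<Longrightarrow> cmod (z i) < 1) \<Longrightarrow> norm (hom_poly n (Suc d) a z) \<le> B"
    and z: "z \<in> cspace n" "\<And>i. i < n \<Longrightarrow> cmod (z i) \<le> 1"
  shows "(\<Sum>l<n. norm (T (hom_poly n d (pd_coeff l a) z))) \<le> real n powr (1 - 1 / r) * (C * (3 ^ Suc d * B))"
proof -
  let ?Q = "\<lambda>l. hom_poly n d (pd_coeff l a) z"
  let ?\<Phi> = "{\<phi>::'x \<Rightarrow> complex. bounded_clinear \<phi> \<and> onorm \<phi> < 1}"
  have "(SUP \<phi>\<in>?\<Phi>. (\<Sum>l<n. cmod (\<phi> (?Q l)) powr 1) powr (1 / 1)) \<le> 3 ^ Suc d * B"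
  proof (rule cSUP_least)
    \<comment> \<open>The bound for a conditionally complete supremum requires a nonempty index
      set.\<close>
    have "(\<lambda>x. 0) \<in> ?\<Phi>" by (simp add: bounded_clinear_def bounded_linear_zero onorm_zero)
    then show "?\<Phi> \<noteq> {}" by blast
    fix \<phi> :: "'x \<Rightarrow> complex" assume "\<phi> \<in> ?\<Phi>"
    then have lin: "bounded_linear \<phi>" and hom: "\<And>c x. \<phi> (c *\<^sub>C x) = c * \<phi> x" and small: "onorm \<phi> < 1"
      by (auto simp: bounded_clinear_def scaleC_complex_def)
    define w where "w = (\<lambda>l. if l < n then cnj (sgn (\<phi> (?Q l))) else 0)"
    have w: "w \<in> cspace n" "\<And>l. cmod (w l) \<le> 1"
      by (auto simp: w_def cspace_def norm_sgn)
    have "complex_of_real (\<Sum>l<n. cmod (\<phi> (?Q l))) = (\<Sum>l<n. w l * \<phi> (?Q l))"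
      unfolding of_real_sum
    proof (rule sum.cong[OF refl])
      fix l assume "l \<in> {..<n}"
      have "cnj (sgn x) * x = complex_of_real (cmod x)" for x
      proof (cases "x = 0")
        case False
        then show ?thesis
          by (simp add: sgn_div_norm scaleR_conv_of_real mult.assoc complex_norm_square[symmetric] mult.commute[of "cnj x" x] power2_eq_square)
      qed simp
      then show "complex_of_real (cmod (\<phi> (?Q l))) = w l * \<phi> (?Q l)"
        using \<open>l \<in> {..<n}\<close> by (simp add: w_def)
    qed
    also have "\<dots> = \<phi> (\<Sum>l<n. w l *\<^sub>C ?Q l)"
      by (simp add: linear_sum[OF bounded_linear.linear[OF lin]] hom)
    finally have eq: "complex_of_real (\<Sum>l<n. cmod (\<phi> (?Q l))) = \<phi> (\<Sum>l<n. w l *\<^sub>C ?Q l)" .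
    have "0 \<le> (\<Sum>l<n. cmod (\<phi> (?Q l)))" by (rule sum_nonneg) simp
    then have "(\<Sum>l<n. cmod (\<phi> (?Q l))) = cmod (complex_of_real (\<Sum>l<n. cmod (\<phi> (?Q l))))"
      by (simp only: norm_of_real abs_of_nonneg)
    also have "\<dots> = cmod (\<phi> (\<Sum>l<n. w l *\<^sub>C ?Q l))" by (simp only: eq)
    also have "\<dots> \<le> onorm \<phi> * norm (\<Sum>l<n. w l *\<^sub>C ?Q l)" by (rule onorm[OF lin])
    also have "\<dots> \<le> 1 * norm (\<Sum>l<n. w l *\<^sub>C ?Q l)" using small by (intro mult_right_mono) auto
    also have "\<dots> \<le> 3 ^ Suc d * B" using norm_derivative_le[OF B z w(1) w(2)] by simp
    finally show "(\<Sum>l<n. cmod (\<phi> (?Q l)) powr 1) powr (1 / 1) \<le> 3 ^ Suc d * B"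
      by (simp add: sum_nonneg del: power_Suc)
  qed
  then have "(\<Sum>l<n. norm (T (?Q l)) powr r) powr (1 / r) \<le> C * (3 ^ Suc d * B)"
    using summing[of ?Q n] mult_left_mono[OF _ C] by (meson order_trans)
  then have "real n powr (1 - 1 / r) * (\<Sum>l<n. norm (T (?Q l)) powr r) powr (1 / r) \<le> real n powr (1 - 1 / r) * (C * (3 ^ Suc d * B))"
    by (intro mult_left_mono) auto
  then show ?thesis
    using sum_le_card_powr_mult[OF r, of "{..<n}" "\<lambda>l. norm (T (?Q l))"] by simp
qed

text \<open>Degree \<open>Suc d\<close> is estimated with the number of indices of degree d only;
  this is the gain for which the derivatives were introduced.\<close>

lemma sum_norm_homogeneous_le:
  fixes T :: "'x::complex_banach \<Rightarrow> 'y::complex_banach" and \<iota> :: "'e::real_banach_lattice \<Rightarrow> 'y"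
  assumes \<iota>: "complex_banach_lattice \<iota>" and q: "2 \<le> q" and r: "1 \<le> r" and C: "0 \<le> C" and C': "0 \<le> C'"
    and concave: "\<And>(N::nat) (y::nat \<Rightarrow> 'y). (\<Sum>k<N. norm (y k) powr q) powr (1 / q) \<le>
      C * norm (krivine N (\<lambda>k. modulus \<iota> (y k)) (\<lambda>t. (\<Sum>k<N. \<bar>t k\<bar> powr q) powr (1 / q)))"
    and summing: "\<And>(N::nat) (x::nat \<Rightarrow> 'x). (\<Sum>k<N. norm (T (x k)) powr r) powr (1 / r) \<le>
      C' * (SUP \<phi>\<in>{\<phi>::'x \<Rightarrow> complex. bounded_clinear \<phi> \<and> onorm \<phi> < 1}. (\<Sum>k<N. cmod (\<phi> (x k)) powr 1) powr (1 / 1))"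
    and T: "bounded_clinear T"
    and B: "\<And>z. z \<in> cspace n \<Longrightarrow> (\<And>i. i < n \<Longrightarrow> cmod (z i) < 1) \<Longrightarrow> norm (hom_poly n (Suc d) a z) \<le> B"
  shows "(\<Sum>\<alpha>\<in>homogeneous_indices n (Suc d). norm (T (a \<alpha>))) \<le>
    real (card (homogeneous_indices n d)) powr (1 - 1 / q) *
      (C * (3 * 2 ^ d * (real n powr (1 - 1 / r) * (C' * (3 ^ Suc d * B)))))"
proof -
  let ?B = "homogeneous_indices n d"
  \<comment> \<open>The least grid size for which the fourth-moment estimate applies, since products
    of two indices reach degree 2 d.\<close>
  define M where "M = Suc (2 * d)"
  define V where "V = real (M ^ n)"
  define R where "R = real n powr (1 - 1 / r) * (C' * (3 ^ Suc d * B))"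
  have V: "0 < V" by (simp add: V_def M_def)
  have lin: "linear T" and hom: "\<And>c x. T (c *\<^sub>C x) = c *\<^sub>C T x"
    using T by (auto simp: bounded_clinear_def bounded_linear.linear)
  define y where "y = (\<lambda>l \<beta>. T (pd_coeff l a \<beta>))"
  have T_hom: "T (hom_poly n d (pd_coeff l a) z) = (\<Sum>\<beta>\<in>?B. monomial n z \<beta> *\<^sub>C y l \<beta>)" for l z
    by (simp add: hom_poly_def linear_sum[OF lin] hom y_def)
  have "(\<Sum>\<alpha>\<in>homogeneous_indices n (Suc d). norm (T (a \<alpha>))) \<le>
      (\<Sum>\<alpha>\<in>homogeneous_indices n (Suc d). \<Sum>l<n. if 0 < \<alpha> l then norm (T (a \<alpha>)) else 0)"
  proof (rule sum_mono)
    fix \<alpha> assume \<alpha>: "\<alpha> \<in> homogeneous_indices n (Suc d)"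
    have "\<exists>l<n. 0 < \<alpha> l"
    proof (rule ccontr)
      assume "\<not> (\<exists>l<n. 0 < \<alpha> l)"
      then have "(\<Sum>i<n. \<alpha> i) = 0" by simp
      with homogeneous_indicesD(2)[OF \<alpha>] show False by simp
    qed
    then obtain l where l: "l < n" "0 < \<alpha> l" by blast
    have "(if 0 < \<alpha> l then norm (T (a \<alpha>)) else 0) \<le> (\<Sum>l<n. if 0 < \<alpha> l then norm (T (a \<alpha>)) else 0)"
      by (rule member_le_sum) (use l in auto)
    then show "norm (T (a \<alpha>)) \<le> (\<Sum>l<n. if 0 < \<alpha> l then norm (T (a \<alpha>)) else 0)"
      using l by simp
  qed
  also have "\<dots> = (\<Sum>l<n. \<Sum>\<beta>\<in>?B. norm (T (a (raise_index l \<beta>))))"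
  proof (subst sum.swap, rule sum.cong[OF refl])
    fix l assume "l \<in> {..<n}"
    then have l: "l < n" by simp
    have "(\<Sum>\<alpha>\<in>homogeneous_indices n (Suc d). if 0 < \<alpha> l then norm (T (a \<alpha>)) else 0) =
        (\<Sum>\<alpha>\<in>{\<alpha> \<in> homogeneous_indices n (Suc d). 0 < \<alpha> l}. norm (T (a \<alpha>)))"
      by (simp add: sum.inter_filter)
    also have "\<dots> = (\<Sum>\<beta>\<in>?B. norm (T (a (raise_index l \<beta>))))"
      by (rule sum.reindex_bij_betw[OF raise_index_bij_betw[OF l], symmetric])
    finally show "(\<Sum>\<alpha>\<in>homogeneous_indices n (Suc d). if 0 < \<alpha> l then norm (T (a \<alpha>)) else 0) =
      (\<Sum>\<beta>\<in>?B. norm (T (a (raise_index l \<beta>))))" .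
  qed
  also have "\<dots> \<le> (\<Sum>l<n. \<Sum>\<beta>\<in>?B. norm (y l \<beta>))"
  proof (intro sum_mono)
    fix l \<beta>
    have "norm (y l \<beta>) = real (Suc (\<beta> l)) * norm (T (a (raise_index l \<beta>)))"
      by (simp add: y_def pd_coeff_def hom norm_scaleC del: of_nat_Suc)
    then show "norm (T (a (raise_index l \<beta>))) \<le> norm (y l \<beta>)"
      using mult_right_mono[of 1 "real (Suc (\<beta> l))" "norm (T (a (raise_index l \<beta>)))"] by simp
  qed
  also have "\<dots> \<le> (\<Sum>l<n. real (card ?B) powr (1 - 1 / q) *
      (C * (3 * 2 ^ d / V * (\<Sum>k\<in>root_grid n M. norm (T (hom_poly n d (pd_coeff l a) (root_point n M k)))))))"
  proof (intro sum_mono)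
    fix l
    have "(\<Sum>\<beta>\<in>?B. norm (y l \<beta>)) \<le> real (card ?B) powr (1 - 1 / q) * (\<Sum>\<beta>\<in>?B. norm (y l \<beta>) powr q) powr (1 / q)"
      using q by (intro sum_le_card_powr_mult) auto
    also have "\<dots> \<le> real (card ?B) powr (1 - 1 / q) *
        (C * (3 * 2 ^ d / V * (\<Sum>k\<in>root_grid n M. norm (T (hom_poly n d (pd_coeff l a) (root_point n M k))))))"
      unfolding T_hom V_def
      by (intro mult_left_mono lq_sum_homogeneous_le[OF \<iota> q C concave]) (auto simp: M_def)
    finally show "(\<Sum>\<beta>\<in>?B. norm (y l \<beta>)) \<le> \<dots>" .
  qed
  \<comment> \<open>The average is pulled outside the sum over l, so that the summing property can
    act on the whole family of derivatives at each grid point.\<close>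
  also have "\<dots> = real (card ?B) powr (1 - 1 / q) * (C * (3 * 2 ^ d / V *
      (\<Sum>k\<in>root_grid n M. \<Sum>l<n. norm (T (hom_poly n d (pd_coeff l a) (root_point n M k))))))"
    by (simp only: sum_distrib_left[symmetric] sum.swap[where A = "root_grid n M" and B = "{..<n}"])
  also have "\<dots> \<le> real (card ?B) powr (1 - 1 / q) * (C * (3 * 2 ^ d / V * (\<Sum>k\<in>root_grid n M. R)))"
  proof (intro mult_left_mono sum_mono)
    fix k
    show "(\<Sum>l<n. norm (T (hom_poly n d (pd_coeff l a) (root_point n M k)))) \<le> R"
      unfolding R_def
      by (rule summing_derivative_le[OF r C' summing B]) (auto simp: root_point_def cspace_def)
  qed (use V C in auto)
  also have "\<dots> = real (card ?B) powr (1 - 1 / q) * (C * (3 * 2 ^ d * R))"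
    by (simp add: card_root_grid V_def M_def)
  finally show ?thesis by (simp only: R_def)
qed

section \<open>Homogeneous parts and growth of the constants\<close>

lemma has_sum_eventually_close:
  assumes "(f has_sum S) A" "0 < \<epsilon>"
  obtains F where "finite F" "F \<subseteq> A" "\<And>G. finite G \<Longrightarrow> F \<subseteq> G \<Longrightarrow> G \<subseteq> A \<Longrightarrow> dist (sum f G) S < \<epsilon>"
proof -
  have "eventually (\<lambda>G. dist (sum f G) S < \<epsilon>) (finite_subsets_at_top A)"
    using assms unfolding has_sum_def by (intro tendstoD) auto
  then obtain F where F: "finite F" "F \<subseteq> A" "\<forall>G. finite G \<and> F \<subseteq> G \<and> G \<subseteq> A \<longrightarrow> dist (sum f G) S < \<epsilon>"
    unfolding eventually_finite_subsets_at_top by (elim exE conjE) (rule that)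
  show thesis by (rule that[OF F(1,2)]) (simp add: F(3))
qed

lemma has_sum_finite_sum:
  fixes f :: "'i \<Rightarrow> 'j \<Rightarrow> 'a::{topological_comm_monoid_add}"
  assumes "\<And>i. i \<in> I \<Longrightarrow> (f i has_sum S i) A"
  shows "((\<lambda>x. \<Sum>i\<in>I. f i x) has_sum (\<Sum>i\<in>I. S i)) A"
  using assms by (induction I rule: infinite_finite_induct) (auto intro: has_sum_add)

lemma bounded_linear_scaleC: "bounded_linear (\<lambda>x::'a::complex_banach. c *\<^sub>C x)"
proof (rule bounded_linear_intro[where K = "cmod c"])
  show "c *\<^sub>C (r *\<^sub>R x) = r *\<^sub>R (c *\<^sub>C x)" for r and x :: 'a
    by (simp add: scaleR_scaleC scaleC_scaleC mult.commute)
qed (simp_all add: scaleC_add_right norm_scaleC mult.commute)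

lemma sum_roots_of_unity_mod:
  assumes "m < L"
  shows "(\<Sum>s<L. cis (2 * pi * real s / real L) ^ k * cnj (cis (2 * pi * real s / real L) ^ m)) =
    (if k mod L = m then of_nat L else 0)"
proof -
  have "cis (2 * pi * real s / real L) ^ k = cis (2 * pi * real s / real L) ^ (k mod L)" for s
  proof -
    have "cis (2 * pi * real s / real L) ^ L = cis (2 * pi * real s)"
      using assms by (simp add: Complex.DeMoivre)
    also have "\<dots> = 1" by (rule cis_multiple_2pi) simp
    finally have "cis (2 * pi * real s / real L) ^ (L * (k div L)) = 1" by (simp add: power_mult)
    then have "cis (2 * pi * real s / real L) ^ (L * (k div L) + k mod L) = cis (2 * pi * real s / real L) ^ (k mod L)"
      by (simp only: power_add mult_1)
    then show ?thesis by simp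
  qed
  then show ?thesis using sum_roots_of_unity[of "k mod L" L m] assms by simp
qed

lemma monomial_scale: "monomial n (\<lambda>i. c * z i) \<alpha> = c ^ (\<Sum>i<n. \<alpha> i) * monomial n z \<alpha>"
  by (simp add: monomial_def power_mult_distrib prod.distrib power_sum)

text \<open>Averaging over the \<open>L\<close>-th roots of unity keeps the degrees congruent to \<open>m\<close> modulo \<open>L\<close>;
  for large \<open>L\<close> only degree \<open>m\<close> matters.\<close>

lemma norm_hom_poly_le_of_expansion:
  fixes a :: "(nat \<Rightarrow> nat) \<Rightarrow> 'a::complex_banach"
  assumes sum: "\<And>\<omega>. cmod \<omega> = 1 \<Longrightarrow> ((\<lambda>\<alpha>. monomial n (\<lambda>i. \<omega> * z i) \<alpha> *\<^sub>C a \<alpha>) has_sum F \<omega>) (multi_indices n)"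
    and B: "\<And>\<omega>. cmod \<omega> = 1 \<Longrightarrow> norm (F \<omega>) \<le> B"
  shows "norm (hom_poly n m a z) \<le> B"
proof (rule field_le_epsilon)
  fix \<epsilon> :: real assume \<epsilon>: "0 < \<epsilon>"
  let ?t = "\<lambda>\<alpha>. monomial n z \<alpha> *\<^sub>C a \<alpha>"
  let ?deg = "\<lambda>\<alpha>::nat \<Rightarrow> nat. \<Sum>i<n. \<alpha> i"
  let ?H = "homogeneous_indices n m"
  have t: "(?t has_sum F 1) (multi_indices n)" using sum[of 1] by simp
  have "0 < \<epsilon> / 4" using \<epsilon> by simp
  obtain F0 where F0: "finite F0" "F0 \<subseteq> multi_indices n"
    "\<And>G. finite G \<Longrightarrow> F0 \<subseteq> G \<Longrightarrow> G \<subseteq> multi_indices n \<Longrightarrow> dist (sum ?t G) (F 1) < \<epsilon> / 4"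
    by (rule has_sum_eventually_close[OF t \<open>0 < \<epsilon> / 4\<close>]) (rule that)
  \<comment> \<open>Cauchy criterion for unordered sums: finite sums of terms outside F0 are
    small.\<close>
  have tail: "norm (sum ?t G) \<le> \<epsilon> / 2" if G: "finite G" "G \<subseteq> multi_indices n" "G \<inter> F0 = {}" for G
  proof -
    have "sum ?t (F0 \<union> G) = sum ?t F0 + sum ?t G"
      using G F0(1) by (intro sum.union_disjoint) auto
    then have "norm (sum ?t G) = dist (sum ?t (F0 \<union> G)) (sum ?t F0)" by (simp add: dist_norm)
    also have "\<dots> \<le> dist (sum ?t (F0 \<union> G)) (F 1) + dist (sum ?t F0) (F 1)" by (rule dist_triangle2)
    finally have "norm (sum ?t G) \<le> dist (sum ?t (F0 \<union> G)) (F 1) + dist (sum ?t F0) (F 1)" .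
    then show ?thesis
      using F0(3)[of "F0 \<union> G"] F0(3)[of F0] G F0(1,2) by simp
  qed
  \<comment> \<open>L exceeds m and all degrees in F0, so an index of F0 whose degree is congruent
    to m modulo L has degree exactly m.\<close>
  define L where "L = Suc (m + (\<Sum>\<alpha>\<in>F0. ?deg \<alpha>))"
  have "m < L" by (simp add: L_def)
  have deg_L: "?deg \<alpha> < L" if "\<alpha> \<in> F0" for \<alpha>
    using member_le_sum[of \<alpha> F0 ?deg] that F0(1) by (simp add: L_def)
  define G where "G = {\<alpha> \<in> multi_indices n. ?deg \<alpha> mod L = m}"
  let ?\<omega> = "\<lambda>s. cis (2 * pi * real s / real L)"
  define S where "S = (\<Sum>s<L. (cnj (?\<omega> s ^ m) / of_nat L) *\<^sub>C F (?\<omega> s))"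
  have "((\<lambda>\<alpha>. \<Sum>s<L. (cnj (?\<omega> s ^ m) / of_nat L) *\<^sub>C (monomial n (\<lambda>i. ?\<omega> s * z i) \<alpha> *\<^sub>C a \<alpha>)) has_sum S) (multi_indices n)"
    unfolding S_def by (intro has_sum_finite_sum has_sum_bounded_linear[OF bounded_linear_scaleC] sum) simp
  moreover have "(\<Sum>s<L. (cnj (?\<omega> s ^ m) / of_nat L) *\<^sub>C (monomial n (\<lambda>i. ?\<omega> s * z i) \<alpha> *\<^sub>C a \<alpha>)) =
      (if ?deg \<alpha> mod L = m then ?t \<alpha> else 0)" for \<alpha>
  proof -
    have "(\<Sum>s<L. (cnj (?\<omega> s ^ m) / of_nat L) *\<^sub>C (monomial n (\<lambda>i. ?\<omega> s * z i) \<alpha> *\<^sub>C a \<alpha>)) =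
        ((\<Sum>s<L. ?\<omega> s ^ ?deg \<alpha> * cnj (?\<omega> s ^ m)) / of_nat L * monomial n z \<alpha>) *\<^sub>C a \<alpha>"
      unfolding scaleC_scaleC monomial_scale scaleC_sum_left[symmetric] sum_divide_distrib sum_distrib_right
      by (intro arg_cong[where f = "\<lambda>c. c *\<^sub>C a \<alpha>"] sum.cong refl) (simp add: mult_ac)
    then show ?thesis
      using \<open>m < L\<close> by (simp add: sum_roots_of_unity_mod del: complex_cnj_power)
  qed
  ultimately have avg: "((\<lambda>\<alpha>. if ?deg \<alpha> mod L = m then ?t \<alpha> else 0) has_sum S) (multi_indices n)"
    by simp
  have "norm S \<le> (\<Sum>s<L. B / real L)"
    unfolding S_def
    by (intro order_trans[OF norm_sum] sum_mono)
       (simp add: norm_scaleC norm_divide norm_power B divide_right_mono)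
  moreover have "L \<noteq> 0" by (simp add: L_def)
  ultimately have S: "norm S \<le> B" by simp
  obtain F1 where F1: "finite F1" "F1 \<subseteq> multi_indices n"
    "\<And>G. finite G \<Longrightarrow> F1 \<subseteq> G \<Longrightarrow> G \<subseteq> multi_indices n \<Longrightarrow>
      dist (\<Sum>\<alpha>\<in>G. if ?deg \<alpha> mod L = m then ?t \<alpha> else 0) S < \<epsilon> / 4"
    by (rule has_sum_eventually_close[OF avg \<open>0 < \<epsilon> / 4\<close>]) (rule that)
  let ?E = "F1 \<union> ?H"
  have H_sub: "?H \<subseteq> multi_indices n" by (auto dest: homogeneous_indicesD)
  have E: "dist (\<Sum>\<alpha>\<in>?E. if ?deg \<alpha> mod L = m then ?t \<alpha> else 0) S < \<epsilon> / 4"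
    using F1(1,2) H_sub by (intro F1(3)) auto
  have "(\<Sum>\<alpha>\<in>?E. if ?deg \<alpha> mod L = m then ?t \<alpha> else 0) = (\<Sum>\<alpha>\<in>?E \<inter> G. ?t \<alpha>)"
    using F1(1,2) H_sub by (intro sum.mono_neutral_cong_right) (auto simp: G_def)
  also have "?E \<inter> G = ?H \<union> (F1 \<inter> G - ?H)"
    using homogeneous_indicesD(1,2) \<open>m < L\<close> by (auto simp: G_def)
  also have "(\<Sum>\<alpha>\<in>?H \<union> (F1 \<inter> G - ?H). ?t \<alpha>) = hom_poly n m a z + (\<Sum>\<alpha>\<in>F1 \<inter> G - ?H. ?t \<alpha>)"
    unfolding hom_poly_def using F1(1) by (intro sum.union_disjoint) auto
  finally have split: "(\<Sum>\<alpha>\<in>?E. if ?deg \<alpha> mod L = m then ?t \<alpha> else 0) =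
      hom_poly n m a z + (\<Sum>\<alpha>\<in>F1 \<inter> G - ?H. ?t \<alpha>)" .
  \<comment> \<open>By the choice of L, the aliased terms of degree other than m lie in the
    tail.\<close>
  have "(F1 \<inter> G - ?H) \<inter> F0 = {}"
    using deg_L by (auto simp: G_def homogeneous_indices_def)
  then have "norm (\<Sum>\<alpha>\<in>F1 \<inter> G - ?H. ?t \<alpha>) \<le> \<epsilon> / 2"
    using F1(1,2) by (intro tail) auto
  moreover have "norm p \<le> norm ((p + v) - S) + norm S + norm v" for p v
    using norm_triangle_ineq4[of "p + v" v] norm_triangle_ineq[of "p + v - S" S] by simp
  note this[of "hom_poly n m a z" "\<Sum>\<alpha>\<in>F1 \<inter> G - ?H. ?t \<alpha>"]
  moreover have "norm ((hom_poly n m a z + (\<Sum>\<alpha>\<in>F1 \<inter> G - ?H. ?t \<alpha>)) - S) < \<epsilon> / 4"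
    using E unfolding split dist_norm .
  ultimately show "norm (hom_poly n m a z) \<le> B + \<epsilon>" using S \<epsilon> by linarith
qed

text \<open>Since x^s \<le> 1 + x \<le> (1 + 1/\<delta>)(1 + \<delta> x), the product x^s
  exp(-\<delta> x) is bounded by a constant depending on \<delta> alone.\<close>

lemma powr_le_linear_exp:
  fixes s x \<delta> :: real
  assumes "0 \<le> s" "s \<le> 1" "0 \<le> x" "0 < \<delta>"
  shows "x powr s \<le> (1 + 1 / \<delta>) * exp (\<delta> * x)"
proof -
  have "x powr s \<le> 1 + x"
  proof (cases "x \<le> 1")
    case True
    then have "x powr s \<le> 1" using assms by (intro powr_le1) auto
    then show ?thesis using assms by simp
  next
    case False
    then have "x powr s \<le> x powr 1" using assms by (intro powr_mono) auto
    then show ?thesis using False by simp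
  qed
  also have "\<dots> \<le> (1 + 1 / \<delta>) * (1 + \<delta> * x)"
    using assms by (simp add: algebra_simps)
  also have "\<dots> \<le> (1 + 1 / \<delta>) * exp (\<delta> * x)"
    using assms by (intro mult_left_mono exp_ge_add_one_self) auto
  finally show ?thesis .
qed

lemma real_le_two_power: "real m \<le> 2 ^ m"
  by (metis less_exp less_imp_le of_nat_less_iff of_nat_numeral of_nat_power)

text \<open>With \<open>m = Suc d\<close> and \<open>x = ln n / m\<close>, the case \<open>m < n\<close> amounts to the boundedness of
  \<open>x\<^sup>s exp (- \<delta> x)\<close>; the gain \<open>n\<^sup>-\<^sup>\<delta> = exp (- \<delta> x)\<^sup>m\<close> is what the hypothesis \<open>r < q\<close> buys.\<close>

lemma index_count_growth:
  fixes s t \<delta> :: real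
  assumes s: "0 \<le> s" "s \<le> 1" and \<delta>: "0 < \<delta>" and t: "0 \<le> t" "t = s - \<delta>" and n: "1 \<le> n"
  shows "((1 + real n / real (Suc d)) ^ d) powr s * (real n powr t * ((ln (real n) / real n) powr s) ^ Suc d) \<le>
    (4 * (1 + 1 / \<delta>)) ^ Suc d"
proof -
  define m where "m = Suc d"
  define N where "N = real n"
  define u where "u = 1 + N / real m"
  have N: "1 \<le> N" using n by (simp add: N_def)
  have m: "1 \<le> real m" by (simp add: m_def)
  have u: "1 \<le> u" using N m by (simp add: u_def)
  have ln: "0 \<le> ln N" "ln N \<le> N" using N ln_le_minus_one[of N] by auto
  have ud: "(u ^ d) powr s = (u powr s) ^ d" using u by (simp add: powr_power powr_realpow[symmetric] powr_powr mult.commute)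
  have K1: "1 \<le> 1 + 1 / \<delta>" using \<delta> by simp
  have "(u powr s) ^ d * (N powr t * ((ln N / N) powr s) ^ m) \<le> (4 * (1 + 1 / \<delta>)) ^ m"
  proof (cases "N \<le> real m")
    \<comment> \<open>If the degree is at least the dimension, u \<le> 2 and N \<le> 2^m, and the
      logarithmic factor is at most 1; everything fits into 4^m.\<close>
    case True
    have "u \<le> 2" using True m by (simp add: u_def)
    then have "u powr s \<le> 2 powr s" using u s by (intro powr_mono2) auto
    also have "\<dots> \<le> 2 powr 1" using s by (intro powr_mono) auto
    finally have "(u powr s) ^ d \<le> 2 ^ d" by (intro power_mono) auto
    also have "\<dots> \<le> 2 ^ m" by (intro power_increasing) (auto simp: m_def)
    finally have 1: "(u powr s) ^ d \<le> 2 ^ m" .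
    have "N powr t \<le> N powr 1" using N s \<delta> t by (intro powr_mono) auto
    also have "\<dots> = N" using N by simp
    also have "\<dots> \<le> 2 ^ m" using True real_le_two_power[of m] by (rule order_trans)
    finally have 2: "N powr t \<le> 2 ^ m" .
    have "(ln N / N) powr s \<le> 1" using ln N s by (intro powr_le1) auto
    then have 3: "((ln N / N) powr s) ^ m \<le> 1" by (intro power_le_one) auto
    have "(u powr s) ^ d * (N powr t * ((ln N / N) powr s) ^ m) \<le> 2 ^ m * (2 ^ m * 1)"
      using 1 2 3 by (intro mult_mono) auto
    also have "\<dots> = 4 ^ m * 1" by (simp flip: power_mult_distrib)
    also have "\<dots> \<le> 4 ^ m * (1 + 1 / \<delta>) ^ m" using K1 by (intro mult_left_mono one_le_power) auto
    finally show ?thesis by (simp only: power_mult_distrib)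
  next
    case False
    then have Nm: "1 \<le> N / real m" using m by simp
    define v where "v = (N / real m) powr s"
    have v: "1 \<le> v" unfolding v_def using Nm s by (intro ge_one_powr_ge_zero) auto
    have "u powr s \<le> (2 * (N / real m)) powr s"
      using u Nm s by (intro powr_mono2) (auto simp: u_def)
    also have "\<dots> = 2 powr s * v" by (simp only: v_def powr_mult)
    also have "\<dots> \<le> 2 powr 1 * v" using s v by (intro mult_right_mono powr_mono) auto
    finally have "(u powr s) ^ d \<le> (2 * v) ^ d" by (intro power_mono) auto
    also have "\<dots> \<le> 2 ^ m * v ^ d" using v by (simp add: power_mult_distrib m_def)
    \<comment> \<open>The exponent is d and not m. The spare factor 1/v is, up to 2^m, the power
      N^(-s) that beats N^t.\<close>
    also have "\<dots> = 2 ^ m * v ^ m * (1 / v)" using v by (simp add: m_def)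
    finally have 1: "(u powr s) ^ d \<le> 2 ^ m * v ^ m * (1 / v)" .
    have "1 / v = real m powr s * N powr (- s)"
      using N m by (simp add: v_def powr_divide powr_minus_divide)
    also have "\<dots> \<le> real m powr 1 * N powr (- s)" using m s by (intro mult_right_mono powr_mono) auto
    also have "\<dots> \<le> 2 ^ m * N powr (- s)" using real_le_two_power[of m] by (intro mult_right_mono) auto
    finally have 2: "1 / v \<le> 2 ^ m * N powr (- s)" .
    define x where "x = ln N / real m"
    have x: "0 \<le> x" using ln m by (simp add: x_def)
    have "v * (ln N / N) powr s = x powr s"
      unfolding v_def x_def using N ln m by (simp flip: powr_mult)
    then have 3: "v ^ m * ((ln N / N) powr s) ^ m = (x powr s) ^ m" by (simp flip: power_mult_distrib)
    have "N powr (- s) * N powr t = N powr (- \<delta>)" using t by (simp flip: powr_add)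
    also have "\<dots> = exp (- \<delta> * ln N)" using N by (simp add: powr_def)
    also have "- \<delta> * ln N = real m * (- \<delta> * x)" using m by (simp add: x_def)
    also have "exp (real m * (- \<delta> * x)) = exp (- \<delta> * x) ^ m" by (rule exp_of_nat_mult)
    finally have 4: "N powr (- s) * N powr t = exp (- \<delta> * x) ^ m" .
    have "x powr s * exp (- \<delta> * x) \<le> (1 + 1 / \<delta>) * exp (\<delta> * x) * exp (- \<delta> * x)"
      using powr_le_linear_exp[OF s x \<delta>] by (intro mult_right_mono) auto
    also have "\<dots> = 1 + 1 / \<delta>" by (simp add: mult.assoc flip: exp_add)
    finally have 5: "x powr s * exp (- \<delta> * x) \<le> 1 + 1 / \<delta>" .
    have "(u powr s) ^ d * (N powr t * ((ln N / N) powr s) ^ m) \<le>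
        (2 ^ m * v ^ m * (2 ^ m * N powr (- s))) * (N powr t * ((ln N / N) powr s) ^ m)"
      by (intro mult_right_mono order_trans[OF 1] mult_left_mono 2) (use v in auto)
    also have "\<dots> = (2 ^ m * 2 ^ m) * ((v ^ m * ((ln N / N) powr s) ^ m) * (N powr (- s) * N powr t))"
      by (simp only: ac_simps)
    also have "\<dots> = 4 ^ m * (x powr s * exp (- \<delta> * x)) ^ m"
    proof -
      have "(2::real) ^ m * 2 ^ m = 4 ^ m" by (simp flip: power_mult_distrib)
      then show ?thesis by (simp only: 3 4 power_mult_distrib)
    qed
    also have "\<dots> \<le> 4 ^ m * (1 + 1 / \<delta>) ^ m"
      using 5 by (intro mult_left_mono power_mono) auto
    finally show ?thesis by (simp only: power_mult_distrib)
  qed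
  then show ?thesis using ud by (simp only: m_def N_def u_def)
qed

text \<open>Everything is forced into a single m-th power so that a radius divided by K cancels it
  degree by degree. The prefactor c, which may be below or above 1, is covered by (1 + c)^m.\<close>

lemma coefficient_growth:
  fixes q r c :: real
  assumes q: "2 \<le> q" and r: "1 \<le> r" "r < q" and c: "0 \<le> c"
  obtains K where "0 < K" "\<And>n d. 1 \<le> n \<Longrightarrow>
    real (card (homogeneous_indices n d)) powr (1 - 1 / q) * (2 ^ d * (real n powr (1 - 1 / r) * (c * 3 ^ Suc d))) *
      ((ln (real n) / real n) powr (1 - 1 / q)) ^ Suc d \<le> K ^ Suc d"
proof -
  define s where "s = 1 - 1 / q"
  define t where "t = 1 - 1 / r"
  define \<delta> where "\<delta> = s - t"
  have s: "0 \<le> s" "s \<le> 1" using q by (simp_all add: s_def)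
  have t: "0 \<le> t" using r by (simp add: t_def)
  \<comment> \<open>\<delta> equals 1/r - 1/q; this is where r < q enters.\<close>
  have \<delta>: "0 < \<delta>" using q r by (simp add: \<delta>_def s_def t_def frac_less2)
  define K0 where "K0 = 4 * (1 + 1 / \<delta>)"
  define K where "K = (1 + c) * (2 * (3 * (exp 1 * K0)))"
  have K0: "0 < K0" using \<delta> by (simp add: K0_def add_pos_pos)
  have "0 < K" using K0 c by (simp add: K_def add_pos_nonneg)
  moreover have "real (card (homogeneous_indices n d)) powr s * (2 ^ d * (real n powr t * (c * 3 ^ Suc d))) *
      ((ln (real n) / real n) powr s) ^ Suc d \<le> K ^ Suc d" if n: "1 \<le> n" for n d
  proof -
    let ?w = "((ln (real n) / real n) powr s) ^ Suc d"
    let ?u = "(1 + real n / real (Suc d)) ^ d"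
    have "real (card (homogeneous_indices n d)) powr s \<le> (exp (real (Suc d)) * ?u) powr s"
      using card_homogeneous_indices_le[of "Suc d" n d] n s by (intro powr_mono2) auto
    also have "\<dots> = exp (real (Suc d)) powr s * ?u powr s" by (rule powr_mult)
    also have "\<dots> \<le> exp (real (Suc d)) powr 1 * ?u powr s"
      using s by (intro mult_right_mono powr_mono) auto
    also have "exp (real (Suc d)) powr 1 = exp 1 ^ Suc d"
      using exp_of_nat_mult[of "Suc d" "1::real"] by (simp only: mult_1_right) simp
    finally have card: "real (card (homogeneous_indices n d)) powr s \<le> exp 1 ^ Suc d * ?u powr s" .
    have "real (card (homogeneous_indices n d)) powr s * (2 ^ d * (real n powr t * (c * 3 ^ Suc d))) * ?w \<le>
        (exp 1 ^ Suc d * ?u powr s) * (2 ^ d * (real n powr t * (c * 3 ^ Suc d))) * ?w"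
      using c by (intro mult_right_mono card) auto
    also have "\<dots> = c * (2 ^ d * (3 ^ Suc d * (exp 1 ^ Suc d * (?u powr s * (real n powr t * ?w)))))"
      by (simp only: ac_simps)
    also have "\<dots> \<le> (1 + c) ^ Suc d * (2 ^ Suc d * (3 ^ Suc d * (exp 1 ^ Suc d * K0 ^ Suc d)))"
    proof (intro mult_mono)
      have "c \<le> (1 + c) * 1" by simp
      also have "\<dots> \<le> (1 + c) * (1 + c) ^ d" using c by (intro mult_left_mono one_le_power) auto
      finally show "c \<le> (1 + c) ^ Suc d" by simp
      show "?u powr s * (real n powr t * ?w) \<le> K0 ^ Suc d"
        unfolding K0_def by (rule index_count_growth[OF s \<delta> t _ n]) (simp add: \<delta>_def)
      show "(2::real) ^ d \<le> 2 ^ Suc d" by simp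
    qed (use c K0 in auto)
    also have "\<dots> = K ^ Suc d" by (simp only: K_def power_mult_distrib)
    finally show ?thesis .
  qed
  ultimately show thesis using that unfolding s_def t_def by blast
qed

section \<open>Bohr radii of the unit balls\<close>

lemma infsum_ennreal_le_iff:
  fixes f :: "'i \<Rightarrow> ennreal"
  shows "infsum f A \<le> W \<longleftrightarrow> (\<forall>F. finite F \<and> F \<subseteq> A \<longrightarrow> sum f F \<le> W)"
proof -
  have "infsum f A = (SUP F\<in>{F. finite F \<and> F \<subseteq> A}. sum f F)"
    by (rule nonneg_infsum_complete) simp
  then show ?thesis by (auto simp: SUP_le_iff)
qed

lemma SUP_dilate_monomial:
  fixes y :: "'a::complex_banach"
  assumes "0 \<le> r"
  shows "(SUP z\<in>dilate r \<Omega>. ennreal (norm (monomial n z \<alpha> *\<^sub>C y))) =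
    ennreal (r ^ (\<Sum>i<n. \<alpha> i)) * (SUP z\<in>\<Omega>. ennreal (norm (monomial n z \<alpha> *\<^sub>C y)))"
proof -
  have "ennreal (norm (monomial n (\<lambda>i. complex_of_real r * z i) \<alpha> *\<^sub>C y)) =
      ennreal (r ^ (\<Sum>i<n. \<alpha> i)) * ennreal (norm (monomial n z \<alpha> *\<^sub>C y))" for z
    using assms by (simp add: monomial_scale norm_scaleC norm_mult norm_power mult.assoc flip: ennreal_mult)
  then show ?thesis by (simp add: dilate_def image_image SUP_mult_left_ennreal)
qed

lemma norm_monomial_le_one:
  assumes "\<And>i. i < n \<Longrightarrow> cmod (z i) \<le> 1"
  shows "cmod (monomial n z \<alpha>) \<le> 1"
  unfolding monomial_def prod_norm[symmetric] norm_power
  by (intro prod_le_1) (use assms in \<open>auto intro: power_le_one\<close>)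

definition bohr_admissible ::
    "nat \<Rightarrow> (nat \<Rightarrow> complex) set \<Rightarrow> ('a::complex_banach \<Rightarrow> 'b::complex_banach) \<Rightarrow> real \<Rightarrow> real \<Rightarrow> bool"
  where "bohr_admissible n \<Omega> T lam r \<longleftrightarrow>
    (\<forall>f a. holomorphic_Cn n f \<Omega> \<and> bounded (f ` \<Omega>) \<and> power_series_expansion n a f \<Omega> \<longrightarrow>
      (\<Sum>\<^sub>\<infinity>\<alpha>\<in>multi_indices n. SUP z\<in>dilate r \<Omega>. ennreal (norm (monomial n z \<alpha> *\<^sub>C T (a \<alpha>))))
        \<le> ennreal lam * (SUP z\<in>\<Omega>. ennreal (norm (f z))))"

text \<open>An infinite sum in \<open>ennreal\<close> is bounded by W as soon as its finite partial
  sums are. Each of those is a polynomial in the radius, so for finite W the condition is closed and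
  passes to the supremum.\<close>

lemma bohr_admissible_Sup:
  fixes T :: "'x::complex_banach \<Rightarrow> 'y::complex_banach"
  assumes \<Omega>: "\<And>z i. z \<in> \<Omega> \<Longrightarrow> i < n \<Longrightarrow> cmod (z i) \<le> 1"
    and S: "S \<noteq> {}" "bdd_above S" "\<And>r. r \<in> S \<Longrightarrow> 0 \<le> r \<and> bohr_admissible n \<Omega> T lam r"
  shows "bohr_admissible n \<Omega> T lam (Sup S)"
  unfolding bohr_admissible_def
proof (intro allI impI)
  fix f :: "(nat \<Rightarrow> complex) \<Rightarrow> 'x" and a
  assume fa: "holomorphic_Cn n f \<Omega> \<and> bounded (f ` \<Omega>) \<and> power_series_expansion n a f \<Omega>"
  define W where "W = ennreal lam * (SUP z\<in>\<Omega>. ennreal (norm (f z)))"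
  define c where "c = (\<lambda>\<alpha>. SUP z\<in>\<Omega>. ennreal (norm (monomial n z \<alpha> *\<^sub>C T (a \<alpha>))))"
  have R: "0 \<le> Sup S"
    using S by (metis all_not_in_conv cSup_upper2)
  \<comment> \<open>Monomials are bounded by 1 on \<Omega>, so these suprema are finite and the
    argument can proceed in the reals.\<close>
  have c: "c \<alpha> = ennreal (enn2real (c \<alpha>))" for \<alpha>
  proof -
    have "c \<alpha> \<le> ennreal (norm (T (a \<alpha>)))"
      unfolding c_def
    proof (intro SUP_least ennreal_leI)
      fix z assume "z \<in> \<Omega>"
      then have "cmod (monomial n z \<alpha>) \<le> 1" by (intro norm_monomial_le_one \<Omega>)
      then show "norm (monomial n z \<alpha> *\<^sub>C T (a \<alpha>)) \<le> norm (T (a \<alpha>))"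
        by (simp add: norm_scaleC mult_left_le_one_le)
    qed
    then have "c \<alpha> < top" by (rule le_less_trans) simp
    then show ?thesis by simp
  qed
  have "(\<Sum>\<alpha>\<in>F. SUP z\<in>dilate (Sup S) \<Omega>. ennreal (norm (monomial n z \<alpha> *\<^sub>C T (a \<alpha>)))) \<le> W"
    if F: "finite F" "F \<subseteq> multi_indices n" for F
  proof (cases "W = top")
    case False
    then obtain w where w: "W = ennreal w" "0 \<le> w" by (metis ennreal_cases)
    let ?g = "\<lambda>r. \<Sum>\<alpha>\<in>F. r ^ (\<Sum>i<n. \<alpha> i) * enn2real (c \<alpha>)"
    have eq: "(\<Sum>\<alpha>\<in>F. SUP z\<in>dilate r \<Omega>. ennreal (norm (monomial n z \<alpha> *\<^sub>C T (a \<alpha>)))) = ennreal (?g r)" if "0 \<le> r" for r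
    proof -
      have "(\<Sum>\<alpha>\<in>F. SUP z\<in>dilate r \<Omega>. ennreal (norm (monomial n z \<alpha> *\<^sub>C T (a \<alpha>)))) =
          (\<Sum>\<alpha>\<in>F. ennreal (r ^ (\<Sum>i<n. \<alpha> i)) * ennreal (enn2real (c \<alpha>)))"
        unfolding SUP_dilate_monomial[OF that] c[symmetric] by (simp only: c_def)
      also have "\<dots> = ennreal (?g r)"
        using that by (subst sum_ennreal[symmetric]) (auto simp: ennreal_mult)
      finally show ?thesis .
    qed
    have "S \<subseteq> {r. ?g r \<le> w}"
    proof
      fix r assume "r \<in> S"
      then have r: "0 \<le> r" "bohr_admissible n \<Omega> T lam r" using S(3) by auto
      then have "(\<Sum>\<^sub>\<infinity>\<alpha>\<in>multi_indices n. SUP z\<in>dilate r \<Omega>. ennreal (norm (monomial n z \<alpha> *\<^sub>C T (a \<alpha>)))) \<le> W"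
        using fa unfolding bohr_admissible_def W_def by blast
      then have "ennreal (?g r) \<le> ennreal w"
        using F unfolding infsum_ennreal_le_iff eq[OF r(1), symmetric] w(1)[symmetric] by blast
      then show "r \<in> {r. ?g r \<le> w}" using w(2) by simp
    qed
    moreover have "closed {r. ?g r \<le> w}"
      by (intro closed_Collect_le continuous_on_sum continuous_on_mult continuous_on_power continuous_on_id continuous_on_const)
    ultimately have "Sup S \<in> {r. ?g r \<le> w}" using S(1,2) by (intro closed_subset_contains_Sup)
    then show ?thesis unfolding eq[OF R] w(1) by (intro ennreal_leI) simp
  qed simp
  then show "(\<Sum>\<^sub>\<infinity>\<alpha>\<in>multi_indices n. SUP z\<in>dilate (Sup S) \<Omega>. ennreal (norm (monomial n z \<alpha> *\<^sub>C T (a \<alpha>))))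
      \<le> ennreal lam * (SUP z\<in>\<Omega>. ennreal (norm (f z)))"
    unfolding infsum_ennreal_le_iff W_def by blast
qed

text \<open>The test function is \<open>z\<^sub>0 x\<close>.\<close>

lemma bohr_admissible_le:
  fixes T :: "'x::complex_banach \<Rightarrow> 'y::complex_banach"
  assumes \<Omega>: "\<And>z i. z \<in> \<Omega> \<Longrightarrow> i < n \<Longrightarrow> cmod (z i) \<le> 1" and n: "1 \<le> n" and lam: "0 \<le> lam"
    and pt: "(\<lambda>i. if i = 0 then 1 / 2 else 0) \<in> \<Omega>" and x: "T x \<noteq> 0"
    and r: "0 \<le> r" "bohr_admissible n \<Omega> T lam r"
  shows "r \<le> 2 * (lam * norm x) / norm (T x)"
proof -
  define f where "f = (\<lambda>z::nat \<Rightarrow> complex. z 0 *\<^sub>C x)"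
  define e where "e = (\<lambda>i::nat. if i = 0 then 1 else 0 :: nat)"
  define a where "a = (\<lambda>\<alpha>. if \<alpha> = e then x else 0)"
  have n0: "0 < n" using n by simp
  have mono_e: "monomial n z e = z 0" for z
  proof -
    have "monomial n z e = (\<Prod>i<n. if i = 0 then z i else 1)"
      unfolding monomial_def e_def by (intro prod.cong) auto
    then show ?thesis using n0 by simp
  qed
  have e: "e \<in> multi_indices n" using n by (auto simp: e_def multi_indices_def)
  have f_le: "norm (f z) \<le> norm x" if "z \<in> \<Omega>" for z
    using \<Omega>[OF that n0] by (simp add: f_def norm_scaleC mult_left_le_one_le)
  have "holomorphic_Cn n f \<Omega>"
    unfolding holomorphic_Cn_def
  proof (intro ballI)
    fix z assume "z \<in> \<Omega>"
    have "(\<Sum>i<n. h i *\<^sub>C (if i = 0 then x else 0)) = h 0 *\<^sub>C x" for h :: "nat \<Rightarrow> complex"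
    proof -
      have "(\<Sum>i<n. h i *\<^sub>C (if i = 0 then x else 0)) = (\<Sum>i<n. if i = 0 then h i *\<^sub>C x else 0)"
        by (intro sum.cong) auto
      then show ?thesis using n0 by simp
    qed
    then have "norm (f (\<lambda>i. z i + h i) - f z - (\<Sum>i<n. h i *\<^sub>C (if i = 0 then x else 0))) = 0" for h
      by (simp add: f_def scaleC_add_left)
    then show "\<exists>l::nat \<Rightarrow> 'x. \<forall>\<epsilon>>0. \<exists>\<delta>>0. \<forall>h\<in>cspace n.
        L2_set (\<lambda>i. cmod (h i)) {..<n} < \<delta> \<and> (\<lambda>i. z i + h i) \<in> \<Omega> \<longrightarrow>
        norm (f (\<lambda>i. z i + h i) - f z - (\<Sum>i<n. h i *\<^sub>C l i)) \<le> \<epsilon> * L2_set (\<lambda>i. cmod (h i)) {..<n}"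
      by (intro exI[of _ "\<lambda>i. if i = 0 then x else 0"] allI impI exI[of _ 1]) (simp add: L2_set_nonneg)
  qed
  moreover have "bounded (f ` \<Omega>)" unfolding bounded_iff using f_le by blast
  moreover have "power_series_expansion n a f \<Omega>"
    unfolding power_series_expansion_def
  proof
    fix z
    have "((\<lambda>\<alpha>. monomial n z \<alpha> *\<^sub>C a \<alpha>) has_sum f z) {e}"
      by (rule has_sum_finiteI) (simp_all add: a_def f_def mono_e)
    then show "((\<lambda>\<alpha>. monomial n z \<alpha> *\<^sub>C a \<alpha>) has_sum f z) (multi_indices n)"
      by (rule has_sum_cong_neutral[THEN iffD1, rotated -1]) (use e in \<open>auto simp: a_def\<close>)
  qed
  ultimately have "(\<Sum>\<^sub>\<infinity>\<alpha>\<in>multi_indices n. SUP z\<in>dilate r \<Omega>. ennreal (norm (monomial n z \<alpha> *\<^sub>C T (a \<alpha>))))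
      \<le> ennreal lam * (SUP z\<in>\<Omega>. ennreal (norm (f z)))"
    using r(2) unfolding bohr_admissible_def by blast
  then have "(\<Sum>\<alpha>\<in>{e}. SUP z\<in>dilate r \<Omega>. ennreal (norm (monomial n z \<alpha> *\<^sub>C T (a \<alpha>))))
      \<le> ennreal lam * (SUP z\<in>\<Omega>. ennreal (norm (f z)))"
    unfolding infsum_ennreal_le_iff using e by blast
  also have "\<dots> \<le> ennreal lam * ennreal (norm x)"
    by (intro mult_left_mono SUP_least ennreal_leI f_le) auto
  also have "\<dots> = ennreal (lam * norm x)" using lam by (simp add: ennreal_mult)
  finally have le: "(SUP z\<in>dilate r \<Omega>. ennreal (norm (z 0 *\<^sub>C T x))) \<le> ennreal (lam * norm x)"
    by (simp add: mono_e a_def)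
  have "(\<lambda>i. complex_of_real r * (if i = 0 then 1 / 2 else 0)) \<in> dilate r \<Omega>"
    unfolding dilate_def using pt by (rule imageI)
  from SUP_upper[OF this, of "\<lambda>z. ennreal (norm (z 0 *\<^sub>C T x))"] le
  have "ennreal (norm ((complex_of_real r * (1 / 2)) *\<^sub>C T x)) \<le> ennreal (lam * norm x)"
    by (simp add: order_trans)
  then have "norm ((complex_of_real r * (1 / 2)) *\<^sub>C T x) \<le> lam * norm x"
    using lam by (subst (asm) ennreal_le_iff) auto
  then have "r * norm (T x) \<le> 2 * (lam * norm x)"
    using r(1) by (simp add: norm_scaleC norm_mult)
  then show ?thesis using x by (simp add: pos_le_divide_eq)
qed

text \<open>The greatest admissible radius exists: linear test functions bound the admissible radii,
  and their supremum is itself admissible.\<close>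

lemma bohr_radius_ge:
  fixes T :: "'x::complex_banach \<Rightarrow> 'y::complex_banach"
  assumes \<Omega>: "\<And>z i. z \<in> \<Omega> \<Longrightarrow> i < n \<Longrightarrow> cmod (z i) \<le> 1" and n: "1 \<le> n" and lam: "0 \<le> lam"
    and pt: "(\<lambda>i. if i = 0 then 1 / 2 else 0) \<in> \<Omega>" and x: "T x \<noteq> 0"
    and r: "0 \<le> r" "bohr_admissible n \<Omega> T lam r"
  shows "r \<le> bohr_radius n \<Omega> T lam"
proof -
  define S where "S = {r. 0 \<le> r \<and> bohr_admissible n \<Omega> T lam r}"
  have bdd: "bdd_above S"
  proof (rule bdd_aboveI)
    fix t assume "t \<in> S"
    then show "t \<le> 2 * (lam * norm x) / norm (T x)"
      unfolding S_def by (intro bohr_admissible_le[where n = n and \<Omega> = \<Omega>] \<Omega> n lam pt x) auto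
  qed
  have rS: "r \<in> S" using r by (simp add: S_def)
  have "bohr_admissible n \<Omega> T lam (Sup S)"
    by (rule bohr_admissible_Sup) (use \<Omega> bdd rS in \<open>auto simp: S_def\<close>)
  moreover have "r \<le> Sup S" by (rule cSup_upper[OF rS bdd])
  moreover have "y \<le> Sup S" if "0 \<le> y \<and> bohr_admissible n \<Omega> T lam y" for y
    using that by (intro cSup_upper bdd) (simp add: S_def)
  ultimately have "bohr_radius n \<Omega> T lam = Sup S"
    unfolding bohr_radius_def bohr_admissible_def[symmetric]
    using r(1) by (intro Greatest_equality) auto
  then show ?thesis using \<open>r \<le> Sup S\<close> by simp
qed

section \<open>Geometry of the \<ell>p balls\<close>

lemma lp_norm_unimodular:
  assumes "cmod \<omega> = 1"
  shows "lp_norm p n (\<lambda>i. \<omega> * z i) = lp_norm p n z"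
  using assms by (simp add: lp_norm_def norm_mult)

lemma lp_ball_unimodular: "cmod \<omega> = 1 \<Longrightarrow> z \<in> lp_ball p n \<Longrightarrow> (\<lambda>i. \<omega> * z i) \<in> lp_ball p n"
  by (simp add: lp_ball_def lp_norm_unimodular cspace_def)

lemma lp_norm_less_one_iff:
  assumes "1 \<le> p" "1 \<le> n"
  shows "lp_norm p n z < 1 \<longleftrightarrow>
    (if p = \<infinity> then \<forall>i<n. cmod (z i) < 1 else (\<Sum>i<n. cmod (z i) powr real_of_ereal p) < 1)"
proof (cases "p = \<infinity>")
  case True
  have "{..<n} \<noteq> {}" using assms(2) by (auto simp: lessThan_empty_iff)
  then show ?thesis using True by (auto simp: lp_norm_def Max_less_iff)
next
  case False
  then obtain P where P: "p = ereal P" "1 \<le> P" using assms(1) by (cases p) (auto simp: one_ereal_def)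
  let ?s = "\<Sum>i<n. cmod (z i) powr P"
  have s: "0 \<le> ?s" by (intro sum_nonneg) auto
  have "?s powr (1 / P) < 1 \<longleftrightarrow> ?s < 1"
  proof
    assume "?s < 1"
    then have "?s powr (1 / P) < 1 powr (1 / P)" using P s by (intro powr_less_mono2) auto
    then show "?s powr (1 / P) < 1" by simp
  next
    assume "?s powr (1 / P) < 1"
    moreover have "1 \<le> ?s powr (1 / P)" if "1 \<le> ?s" using that P by (intro ge_one_powr_ge_zero) auto
    ultimately show "?s < 1" by linarith
  qed
  then show ?thesis using False P by (simp add: lp_norm_def)
qed

lemma lp_ball_subset_polydisc:
  assumes "1 \<le> p" "z \<in> lp_ball p n" "i < n"
  shows "cmod (z i) < 1"
proof -
  have z: "lp_norm p n z < 1" using assms by (simp add: lp_ball_def)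
  have n: "1 \<le> n" using assms(3) by simp
  show ?thesis
  proof (cases "p = \<infinity>")
    case True
    then show ?thesis using z lp_norm_less_one_iff[OF assms(1) n, of z] assms(3) by simp
  next
    case False
    then obtain P where P: "p = ereal P" "1 \<le> P" using assms(1) by (cases p) (auto simp: one_ereal_def)
    have "cmod (z i) powr P \<le> (\<Sum>i<n. cmod (z i) powr P)"
      using assms(3) by (intro member_le_sum) auto
    also have "\<dots> < 1" using z lp_norm_less_one_iff[OF assms(1) n, of z] P by simp
    finally have "cmod (z i) powr P < 1" .
    moreover have "1 \<le> cmod (z i) powr P" if "1 \<le> cmod (z i)" using that P by (intro ge_one_powr_ge_zero) auto
    ultimately show ?thesis by linarith
  qed
qed

text \<open>For finite p each of the n coordinates contributes less than \<rho>^p = 1/n to the sum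
  of the p-th powers.\<close>

lemma polydisc_subset_lp_ball:
  assumes "1 \<le> p" "1 \<le> n" "z \<in> cspace n" "\<And>i. i < n \<Longrightarrow> cmod (z i) < 1"
    and \<rho>: "\<rho> = (if p = \<infinity> then 1 else real n powr (- (1 / real_of_ereal p)))"
  shows "(\<lambda>i. complex_of_real \<rho> * z i) \<in> lp_ball p n"
proof -
  have "lp_norm p n (\<lambda>i. complex_of_real \<rho> * z i) < 1"
  proof (cases "p = \<infinity>")
    case True
    then show ?thesis using assms by (simp add: lp_norm_less_one_iff)
  next
    case False
    then obtain P where P: "p = ereal P" "1 \<le> P" using assms(1) by (cases p) (auto simp: one_ereal_def)
    have \<rho>': "\<rho> = real n powr (- (1 / P))" using \<rho> P by simp
    have \<rho>P: "\<rho> powr P = 1 / real n"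
    proof -
      have "- (1 / P) * P = - 1" using P by simp
      then show ?thesis
        using assms(2) by (simp only: \<rho>' powr_powr) (simp add: powr_minus_divide)
    qed
    have "(\<Sum>i<n. cmod (complex_of_real \<rho> * z i) powr P) = (\<Sum>i<n. \<rho> powr P * cmod (z i) powr P)"
      using \<rho>' by (intro sum.cong refl) (simp add: norm_mult powr_mult)
    also have "\<dots> < (\<Sum>i<n. 1 / real n)"
    proof (rule sum_strict_mono)
      show "{..<n} \<noteq> {}" using assms(2) by (auto simp: lessThan_empty_iff)
      fix i assume "i \<in> {..<n}"
      then have "cmod (z i) powr P < 1 powr P" using assms(4) P by (intro powr_less_mono2) auto
      then have "1 / real n * cmod (z i) powr P < 1 / real n * 1"
        using assms(2) by (intro mult_strict_left_mono) auto
      then show "\<rho> powr P * cmod (z i) powr P < 1 / real n" by (simp add: \<rho>P)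
    qed simp
    also have "\<dots> = 1" using assms(2) by simp
    finally show ?thesis
      using lp_norm_less_one_iff[OF assms(1,2), of "\<lambda>i. complex_of_real \<rho> * z i"] P by simp
  qed
  then show ?thesis using assms(3) by (simp add: lp_ball_def cspace_def)
qed

lemma half_in_lp_ball:
  assumes "1 \<le> p" "1 \<le> n"
  shows "(\<lambda>i. if i = 0 then 1 / 2 else 0) \<in> lp_ball p n"
proof -
  let ?z = "\<lambda>i::nat. if i = 0 then 1 / 2 else 0 :: complex"
  have "lp_norm p n ?z < 1"
  proof (cases "p = \<infinity>")
    case True
    then show ?thesis using assms by (simp add: lp_norm_less_one_iff)
  next
    case False
    then obtain P where P: "p = ereal P" "1 \<le> P" using assms(1) by (cases p) (auto simp: one_ereal_def)
    have "(\<Sum>i<n. cmod (?z i) powr P) = (\<Sum>i<n. if i = 0 then (1 / 2) powr P else 0)"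
      using P by (intro sum.cong) auto
    also have "\<dots> = (1 / 2) powr P" using assms(2) by simp
    also have "\<dots> < 1 powr P" using P by (intro powr_less_mono2) auto
    finally show ?thesis using lp_norm_less_one_iff[OF assms, of ?z] P by simp
  qed
  then show ?thesis using assms(2) by (simp add: lp_ball_def cspace_def)
qed

text \<open>With B the supremum of the norm of f, degree 0 contributes at most
  \<open>onorm T\<close> B and degree m \<ge> 1 at most \<epsilon>^m B; the total stays below
  \<open>lam\<close> B by the assumption on \<epsilon>. The bound \<open>coeffs\<close> concerns the
  polydisc, and the shrinking factor \<rho> connects it with the ball.\<close>

lemma bohr_admissible_lp_ball:
  fixes T :: "'x::complex_banach \<Rightarrow> 'y::complex_banach" and p :: ereal
  assumes p: "1 \<le> p" and n: "1 \<le> n" and T: "bounded_clinear T"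
    and \<rho>: "\<rho> = (if p = \<infinity> then 1 else real n powr (- (1 / real_of_ereal p)))"
    and \<epsilon>: "0 \<le> \<epsilon>" "\<epsilon> < 1" "onorm T + \<epsilon> / (1 - \<epsilon>) \<le> lam" and r: "0 \<le> r"
    and coeffs: "\<And>(a::(nat \<Rightarrow> nat) \<Rightarrow> 'x) d B. 0 \<le> B \<Longrightarrow>
      (\<And>z. z \<in> cspace n \<Longrightarrow> (\<And>i. i < n \<Longrightarrow> cmod (z i) < 1) \<Longrightarrow> norm (hom_poly n (Suc d) a z) \<le> B) \<Longrightarrow>
      r ^ Suc d * (\<Sum>\<alpha>\<in>homogeneous_indices n (Suc d). norm (T (a \<alpha>))) \<le> \<epsilon> ^ Suc d * B"
  shows "bohr_admissible n (lp_ball p n) T lam (r * \<rho>)"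
  unfolding bohr_admissible_def
proof (intro allI impI)
  fix f :: "(nat \<Rightarrow> complex) \<Rightarrow> 'x" and a
  let ?\<Omega> = "lp_ball p n"
  assume "holomorphic_Cn n f ?\<Omega> \<and> bounded (f ` ?\<Omega>) \<and> power_series_expansion n a f ?\<Omega>"
  then have bdd: "bounded (f ` ?\<Omega>)" and expansion: "power_series_expansion n a f ?\<Omega>" by auto
  have lin: "bounded_linear T" and hom: "\<And>c x. T (c *\<^sub>C x) = c *\<^sub>C T x"
    using T by (auto simp: bounded_clinear_def)
  have \<rho>0: "0 \<le> \<rho>" by (simp add: \<rho>)
  define S where "S = (SUP z\<in>?\<Omega>. ennreal (norm (f z)))"
  define B where "B = enn2real S"
  have B0: "0 \<le> B" by (simp add: B_def)
  obtain b where "\<And>z. z \<in> ?\<Omega> \<Longrightarrow> norm (f z) \<le> b" using bdd unfolding bounded_iff by blast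
  then have "S \<le> ennreal b" unfolding S_def by (intro SUP_least ennreal_leI)
  then have "S < top" by (rule le_less_trans) simp
  then have S: "S = ennreal B" by (simp add: B_def)
  have fB: "norm (f z) \<le> B" if "z \<in> ?\<Omega>" for z
  proof -
    have "ennreal (norm (f z)) \<le> ennreal B" unfolding S[symmetric] S_def by (rule SUP_upper[OF that])
    then show ?thesis using B0 by simp
  qed
  have hom_le: "norm (hom_poly n m a z) \<le> B" if z: "z \<in> ?\<Omega>" for m z
  proof (rule norm_hom_poly_le_of_expansion)
    fix \<omega> :: complex assume "cmod \<omega> = 1"
    then have "(\<lambda>i. \<omega> * z i) \<in> ?\<Omega>" using z by (rule lp_ball_unimodular)
    then show "((\<lambda>\<alpha>. monomial n (\<lambda>i. \<omega> * z i) \<alpha> *\<^sub>C a \<alpha>) has_sum f (\<lambda>i. \<omega> * z i)) (multi_indices n)"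
      and "norm (f (\<lambda>i. \<omega> * z i)) \<le> B"
      using expansion fB by (auto simp: power_series_expansion_def)
  qed
  define A where "A = (\<lambda>m. (r * \<rho>) ^ m * (\<Sum>\<alpha>\<in>homogeneous_indices n m. norm (T (a \<alpha>))))"
  have A_Suc: "A (Suc d) \<le> \<epsilon> ^ Suc d * B" for d
  proof -
    \<comment> \<open>Absorbing \<rho>^m into the coefficients turns the polynomial on the inscribed
      polydisc of radius \<rho> into one on the unit polydisc.\<close>
    define b where "b = (\<lambda>\<alpha>. complex_of_real (\<rho> ^ Suc d) *\<^sub>C a \<alpha>)"
    have "hom_poly n (Suc d) b z = hom_poly n (Suc d) a (\<lambda>i. complex_of_real \<rho> * z i)" for z
      unfolding hom_poly_scale by (simp add: hom_poly_def b_def scaleC_sum_right scaleC_scaleC mult.commute)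
    then have "r ^ Suc d * (\<Sum>\<alpha>\<in>homogeneous_indices n (Suc d). norm (T (b \<alpha>))) \<le> \<epsilon> ^ Suc d * B"
      using polydisc_subset_lp_ball[OF p n _ _ \<rho>] by (intro coeffs B0) (simp add: hom_le)
    moreover have "norm (T (b \<alpha>)) = \<rho> ^ Suc d * norm (T (a \<alpha>))" for \<alpha>
      using \<rho>0 by (simp add: b_def hom norm_scaleC norm_mult norm_power)
    ultimately show ?thesis
      by (simp add: A_def power_mult_distrib sum_distrib_left mult.assoc del: power_Suc)
  qed
  have A_0: "A 0 \<le> onorm T * B"
  proof -
    have H0: "homogeneous_indices n 0 = {\<lambda>_. 0}"
      by (auto simp: homogeneous_indices_def multi_indices_def fun_eq_iff) (metis lessThan_iff not_less)
    have zero: "(\<lambda>i. 0) \<in> ?\<Omega>"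
      using polydisc_subset_lp_ball[OF p n _ _ \<rho>, of "\<lambda>i. 0"] by (simp add: cspace_def)
    have "hom_poly n 0 a (\<lambda>i. 0) = a (\<lambda>_. 0)" by (simp add: hom_poly_def H0 monomial_def)
    then have "norm (a (\<lambda>_. 0)) \<le> B" using hom_le[OF zero, of 0] by simp
    then have "onorm T * norm (a (\<lambda>_. 0)) \<le> onorm T * B"
      by (intro mult_left_mono onorm_pos_le lin)
    then show ?thesis using onorm[OF lin, of "a (\<lambda>_. 0)"] by (simp add: A_def H0)
  qed
  have total: "(\<Sum>m\<le>D. A m) \<le> lam * B" for D
  proof -
    have "(\<Sum>m\<le>D. A m) = A 0 + (\<Sum>d<D. A (Suc d))" by (rule sum.atMost_shift)
    also have "\<dots> \<le> onorm T * B + (\<Sum>d<D. \<epsilon> ^ Suc d * B)"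
      by (intro add_mono A_0 sum_mono A_Suc)
    also have "(\<Sum>d<D. \<epsilon> ^ Suc d * B) = (\<Sum>d<D. \<epsilon> ^ d) * \<epsilon> * B"
      unfolding sum_distrib_right by (intro sum.cong refl) (simp add: mult_ac)
    also have "(\<Sum>d<D. \<epsilon> ^ d) = (1 - \<epsilon> ^ D) / (1 - \<epsilon>)" using \<epsilon> by (simp add: sum_gp_strict)
    also have "(1 - \<epsilon> ^ D) / (1 - \<epsilon>) * \<epsilon> * B \<le> 1 / (1 - \<epsilon>) * \<epsilon> * B"
      using \<epsilon> B0 by (intro mult_right_mono divide_right_mono) auto
    also have "onorm T * B + 1 / (1 - \<epsilon>) * \<epsilon> * B = (onorm T + \<epsilon> / (1 - \<epsilon>)) * B"
      by (simp add: distrib_right)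
    also have "\<dots> \<le> lam * B" using \<epsilon> B0 by (intro mult_right_mono) auto
    finally show ?thesis by simp
  qed
  have "(\<Sum>\<alpha>\<in>F. SUP z\<in>dilate (r * \<rho>) ?\<Omega>. ennreal (norm (monomial n z \<alpha> *\<^sub>C T (a \<alpha>)))) \<le> ennreal (lam * B)"
    if F: "finite F" "F \<subseteq> multi_indices n" for F
  proof -
    let ?deg = "\<lambda>\<alpha>::nat \<Rightarrow> nat. \<Sum>i<n. \<alpha> i"
    define g where "g = (\<lambda>\<alpha>. (r * \<rho>) ^ ?deg \<alpha> * norm (T (a \<alpha>)))"
    \<comment> \<open>A crude bound for the degree of each index in F, enough to place F among
      finitely many homogeneous parts.\<close>
    define D where "D = (\<Sum>\<alpha>\<in>F. ?deg \<alpha>)"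
    have r\<rho>: "0 \<le> r * \<rho>" using r \<rho>0 by simp
    have g0: "0 \<le> g \<alpha>" for \<alpha> using r\<rho> by (simp add: g_def)
    have "(SUP z\<in>dilate (r * \<rho>) ?\<Omega>. ennreal (norm (monomial n z \<alpha> *\<^sub>C T (a \<alpha>)))) \<le> ennreal (g \<alpha>)" for \<alpha>
    proof -
      have "(SUP z\<in>?\<Omega>. ennreal (norm (monomial n z \<alpha> *\<^sub>C T (a \<alpha>)))) \<le> ennreal (norm (T (a \<alpha>)))"
      proof (intro SUP_least ennreal_leI)
        fix z assume "z \<in> ?\<Omega>"
        then have "cmod (monomial n z \<alpha>) \<le> 1"
          by (intro norm_monomial_le_one less_imp_le lp_ball_subset_polydisc[OF p])
        then show "norm (monomial n z \<alpha> *\<^sub>C T (a \<alpha>)) \<le> norm (T (a \<alpha>))"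
          by (simp add: norm_scaleC mult_left_le_one_le)
      qed
      then show ?thesis
        unfolding SUP_dilate_monomial[OF r\<rho>] g_def using r\<rho>
        by (simp add: ennreal_mult mult_left_mono)
    qed
    then have "(\<Sum>\<alpha>\<in>F. SUP z\<in>dilate (r * \<rho>) ?\<Omega>. ennreal (norm (monomial n z \<alpha> *\<^sub>C T (a \<alpha>)))) \<le> (\<Sum>\<alpha>\<in>F. ennreal (g \<alpha>))"
      by (intro sum_mono)
    also have "\<dots> = ennreal (\<Sum>\<alpha>\<in>F. g \<alpha>)" using g0 by (intro sum_ennreal)
    also have "(\<Sum>\<alpha>\<in>F. g \<alpha>) \<le> (\<Sum>\<alpha>\<in>(\<Union>m\<le>D. homogeneous_indices n m). g \<alpha>)"
    proof (rule sum_mono2)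
      show "F \<subseteq> (\<Union>m\<le>D. homogeneous_indices n m)"
        using F member_le_sum[of _ F ?deg] by (auto simp: homogeneous_indices_def D_def)
    qed (use g0 in auto)
    also have "\<dots> = (\<Sum>m\<le>D. \<Sum>\<alpha>\<in>homogeneous_indices n m. g \<alpha>)"
      by (rule sum.UNION_disjoint) (auto dest: homogeneous_indicesD(2))
    also have "\<dots> = (\<Sum>m\<le>D. A m)"
      by (intro sum.cong refl) (simp add: A_def g_def sum_distrib_left homogeneous_indicesD(2))
    also have "\<dots> \<le> lam * B" by (rule total)
    finally show ?thesis by (simp add: ennreal_leI)
  qed
  moreover have "0 \<le> \<epsilon> / (1 - \<epsilon>)" using \<epsilon> by simp
  with \<epsilon>(3) onorm_pos_le[OF lin] have "0 \<le> lam" by linarith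
  ultimately show "(\<Sum>\<^sub>\<infinity>\<alpha>\<in>multi_indices n. SUP z\<in>dilate (r * \<rho>) ?\<Omega>. ennreal (norm (monomial n z \<alpha> *\<^sub>C T (a \<alpha>))))
      \<le> ennreal lam * (SUP z\<in>?\<Omega>. ennreal (norm (f z)))"
    unfolding S_def[symmetric] S using B0 by (simp add: infsum_ennreal_le_iff flip: ennreal_mult)
qed

theorem theorem2p10:
  fixes p :: ereal and q r lam :: real
    and T :: "'x::complex_banach \<Rightarrow> 'y::complex_banach"
    and \<iota> :: "'e::real_banach_lattice \<Rightarrow> 'y"
  assumes "1 \<le> p"
    and "2 \<le> q"
    and "complex_banach_lattice \<iota>"
    and "q_concave q \<iota>"
    and "1 \<le> r" and "r < q"
    and "bounded_clinear T"
    and "\<exists>x. T x \<noteq> 0"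
    and "summing r 1 T"
    and "onorm T \<le> lam"
  shows "\<exists>C\<^sub>0>0. \<forall>n::nat. n \<ge> 1 \<longrightarrow>
    bohr_radius n (lp_ball p n) T lam \<ge>
      C\<^sub>0 / (1 + 2 * lam) * ((onorm T - lam) / (onorm T - 2 * lam)) *
      (ln (real n) powr (1 - 1 / q) /
       real n powr (if p = \<infinity> then 1 - 1 / q
                    else (real_of_ereal p * q - real_of_ereal p + q) / (real_of_ereal p * q)))"
proof -
  have q0: "0 < q" using assms(2) by simp
  define s where "s = 1 - 1 / q"
  define e where "e = (if p = \<infinity> then 1 - 1 / q
    else (real_of_ereal p * q - real_of_ereal p + q) / (real_of_ereal p * q))"
  define \<rho> where "\<rho> = (\<lambda>n. if p = \<infinity> then 1 else real n powr (- (1 / real_of_ereal p)))"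
  obtain x where x: "T x \<noteq> 0" using assms(8) by blast
  have lin: "bounded_linear T" using assms(7) by (simp add: bounded_clinear_def)
  have T_pos: "0 < onorm T" using x lin by (auto simp: onorm_pos_lt)
  then have lam: "0 < lam" using assms(10) by simp
  have radius_ge: "t \<le> bohr_radius n (lp_ball p n) T lam"
    if "1 \<le> n" "0 \<le> t" "bohr_admissible n (lp_ball p n) T lam t" for n t
    using that lam x half_in_lp_ball[OF assms(1) that(1)] lp_ball_subset_polydisc[OF assms(1)]
    by (intro bohr_radius_ge[where x = x]) (auto intro: less_imp_le)
  \<comment> \<open>For finite p the exponent e is s + 1/p, so the target splits into the polydisc
    rate and the inclusion factor \<rho>.\<close>
  have exponent: "ln (real n) powr s / real n powr e = (ln (real n) / real n) powr s * \<rho> n" if n: "1 \<le> n" for n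
  proof (cases "p = \<infinity>")
    case True
    then show ?thesis using n by (simp add: e_def s_def \<rho>_def powr_divide)
  next
    case False
    then obtain P where P: "p = ereal P" "1 \<le> P" using assms(1) by (cases p) (auto simp: one_ereal_def)
    have "e = s + 1 / P" using P q0 by (simp add: e_def s_def field_simps)
    then show ?thesis using P n
      by (simp add: \<rho>_def powr_divide powr_add powr_minus_divide)
  qed
  show ?thesis
  proof (cases "onorm T = lam")
    case True
    \<comment> \<open>Here the claimed lower bound is 0. The radius 0 is admissible, with \<epsilon>
      = 0, and any positive constant serves.\<close>
    have "0 \<le> bohr_radius n (lp_ball p n) T lam" if n: "1 \<le> n" for n
    proof (rule radius_ge[OF n])
      have "bohr_admissible n (lp_ball p n) T lam (0 * \<rho> n)"
        by (rule bohr_admissible_lp_ball[OF assms(1) n assms(7) _ _ _ _ order_refl, where \<epsilon> = 0])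
           (use assms(10) in \<open>simp_all add: \<rho>_def\<close>)
      then show "bohr_admissible n (lp_ball p n) T lam 0" by simp
    qed simp
    then show ?thesis using True by (intro exI[of _ 1]) simp
  next
    case False
    define \<eta> where "\<eta> = lam - onorm T"
    \<comment> \<open>The solution of \<epsilon> / (1 - \<epsilon>) = \<open>lam - onorm T\<close>:
      the geometric series uses up exactly the room left by degree 0.\<close>
    define \<epsilon> where "\<epsilon> = \<eta> / (1 + \<eta>)"
    have \<eta>: "0 < \<eta>" using False assms(10) by (simp add: \<eta>_def)
    have \<epsilon>: "0 < \<epsilon>" "\<epsilon> < 1" "\<epsilon> / (1 - \<epsilon>) = \<eta>" using \<eta> by (simp_all add: \<epsilon>_def field_simps)
    obtain C where C: "0 < C" "\<And>(N::nat) (y::nat \<Rightarrow> 'y). (\<Sum>k<N. norm (y k) powr q) powr (1 / q) \<le>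
      C * norm (krivine N (\<lambda>k. modulus \<iota> (y k)) (\<lambda>t. (\<Sum>k<N. \<bar>t k\<bar> powr q) powr (1 / q)))"
      using assms(4) unfolding q_concave_def by blast
    obtain C' where C': "0 < C'" "\<And>(N::nat) (x::nat \<Rightarrow> 'x). (\<Sum>k<N. norm (T (x k)) powr r) powr (1 / r) \<le>
      C' * (SUP \<phi>\<in>{\<phi>::'x \<Rightarrow> complex. bounded_clinear \<phi> \<and> onorm \<phi> < 1}. (\<Sum>k<N. cmod (\<phi> (x k)) powr 1) powr (1 / 1))"
      using assms(9) unfolding summing_def by blast
    obtain K where K: "0 < K" "\<And>n d. 1 \<le> n \<Longrightarrow>
      real (card (homogeneous_indices n d)) powr (1 - 1 / q) *
        (2 ^ d * (real n powr (1 - 1 / r) * (3 * C * C' * 3 ^ Suc d))) *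
        ((ln (real n) / real n) powr (1 - 1 / q)) ^ Suc d \<le> K ^ Suc d"
      using coefficient_growth[OF assms(2,5,6), of "3 * C * C'"] C(1) C'(1) by auto
    have radius: "\<epsilon> / K * ((ln (real n) / real n) powr s * \<rho> n) \<le> bohr_radius n (lp_ball p n) T lam"
      if n: "1 \<le> n" for n
    proof -
      \<comment> \<open>The divisor K cancels the growth of the coefficient constants, leaving the
        ratio \<epsilon> per degree.\<close>
      define t where "t = \<epsilon> / K * (ln (real n) / real n) powr s"
      have t: "0 \<le> t" using \<epsilon> K(1) by (simp add: t_def)
      have "t ^ Suc d * (\<Sum>\<alpha>\<in>homogeneous_indices n (Suc d). norm (T (a \<alpha>))) \<le> \<epsilon> ^ Suc d * B"
        if "0 \<le> B" and B: "\<And>z. z \<in> cspace n \<Longrightarrow> (\<And>i. i < n \<Longrightarrow> cmod (z i) < 1) \<Longrightarrow>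
          norm (hom_poly n (Suc d) a z) \<le> B" for a :: "(nat \<Rightarrow> nat) \<Rightarrow> 'x" and d B
      proof -
        let ?w = "((ln (real n) / real n) powr s) ^ Suc d"
        have "(\<Sum>\<alpha>\<in>homogeneous_indices n (Suc d). norm (T (a \<alpha>))) \<le>
            real (card (homogeneous_indices n d)) powr (1 - 1 / q) *
              (C * (3 * 2 ^ d * (real n powr (1 - 1 / r) * (C' * (3 ^ Suc d * B)))))"
          by (rule sum_norm_homogeneous_le[OF assms(3,2,5) _ _ C(2) C'(2) assms(7) B])
             (use C(1) C'(1) in auto)
        then have "t ^ Suc d * (\<Sum>\<alpha>\<in>homogeneous_indices n (Suc d). norm (T (a \<alpha>))) \<le> t ^ Suc d * \<dots>"
          using t by (intro mult_left_mono) auto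
        also have "\<dots> = (\<epsilon> / K) ^ Suc d * (real (card (homogeneous_indices n d)) powr (1 - 1 / q) *
            (2 ^ d * (real n powr (1 - 1 / r) * (3 * C * C' * 3 ^ Suc d))) * ?w) * B"
          unfolding t_def power_mult_distrib by (simp only: ac_simps)
        also have "\<dots> \<le> (\<epsilon> / K) ^ Suc d * K ^ Suc d * B"
          using \<epsilon> K(1) \<open>0 \<le> B\<close> K(2)[OF n, of d] unfolding s_def
          by (intro mult_right_mono mult_left_mono) auto
        also have "\<dots> = \<epsilon> ^ Suc d * B"
          using K(1) by (simp only: power_mult_distrib[symmetric]) simp
        finally show ?thesis .
      qed
      then have "bohr_admissible n (lp_ball p n) T lam (t * \<rho> n)"
        by (intro bohr_admissible_lp_ball[OF assms(1) n assms(7) \<rho>_def[THEN fun_cong] _ \<epsilon>(2) _ t])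
           (use \<epsilon> in \<open>auto simp: \<eta>_def\<close>)
      then have "t * \<rho> n \<le> bohr_radius n (lp_ball p n) T lam"
        using t by (intro radius_ge n) (simp_all add: \<rho>_def)
      then show ?thesis by (simp add: t_def mult.assoc)
    qed
    define \<kappa> where "\<kappa> = (onorm T - lam) / (onorm T - 2 * lam)"
    have \<kappa>: "0 < \<kappa>" using False assms(10) lam by (simp add: \<kappa>_def divide_neg_neg)
    \<comment> \<open>Chosen to cancel the prescribed prefactor. Both differences in \<kappa> are
      negative here, so \<kappa> is positive, and none of the ingredients depends on n.\<close>
    define C0 where "C0 = \<epsilon> / K * (1 + 2 * lam) / \<kappa>"
    have "0 < C0" using \<epsilon> K(1) \<kappa> lam by (simp add: C0_def)
    moreover have "C0 / (1 + 2 * lam) * \<kappa> * (ln (real n) powr s / real n powr e) \<le> bohr_radius n (lp_ball p n) T lam"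
      if n: "1 \<le> n" for n
    proof -
      have "C0 / (1 + 2 * lam) * \<kappa> = \<epsilon> / K" using \<kappa> lam by (simp add: C0_def)
      then show ?thesis using radius[OF n] by (simp only: exponent[OF n])
    qed
    ultimately show ?thesis unfolding s_def e_def \<kappa>_def by blast
  qed
qed

end
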